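(* Consider $K$ moving point sources $F(t,\boldsymbol r)=\sum_{k=1}^Kq_k(t)\,\delta(\boldsymbol r-\boldsymbol p_k(t))$, where for each $k$: $\boldsymbol p_k\in C^6([0,T];D)$, $|d_t\boldsymbol p_k(t)|<c$ on $[0,T]$, $q_k\in C^5([0,T];\mathbb R)$, and $q_k(0)=d_tq_k(0)=\cdots=d_t^5q_k(0)=0$. Let $\phi=\partial_\nu u$ on $[0,T]\times\Gamma$ be the observation data, where $u$ is the corresponding wave field, and let $$I_0=\Big[\max\{0,\sup_{\boldsymbol r\in\Omega}z/c\},\ \min\{T+\inf_{\boldsymbol r\in\Omega}z/c,\,T\}\Big]\subset[0,T].$$ For each $\tau\in I_0$, let $t_k(\tau)$ be the unique solution $t$ of $t-\tau+p_{k,z}(t)/c=0$, and let $K(\tau)$ be the number of point sources such that $q_k(t_k(\tau))\ne0$. Assume that $K(\tau)\le K_M$ for a given $K_M$, and that $p_{j,xy}(t_j(\tau))\neq p_{k,xy}(t_k(\tau))$ if $j\ne k$, where $p_{k,xy}=p_{k,x}+\mathrm i\,p_{k,y}$. Then $K(\tau)$ is uniquely determined by the reciprocity gap functionals $\mathcal R_\phi(f_n)(\tau)$, $n=0,1,2,\dots,2K_M$. Moreover, numbering the sources with $q_k(t_k(\tau))\neq0$ as $k=1,\dots,K(\tau)$, the locations $\boldsymbol p_k(t_k(\tau))$ and magnitudes $q_k(t_k(\tau))$, $k=1,2,\dots,K(\tau)$, are uniquely determined (up to the numbering of the sources) by the values - $\mathcal R_\phi(f_n)(\tau)$, $n=0,1,2,\dots,2K(\tau)-1$,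 - $\mathcal R_\phi(g_n)(\tau)$, $n=0,1,2,\dots,2K(\tau)-1$, - $\mathcal R_\phi(h_n)(\tau)$, $n=1,2,3,\dots,K(\tau)$, - $\mathcal R_\phi(i_n)(\tau)$, $n=0,1,2,\dots,2K(\tau)-1$, - $\mathcal R_\phi(j_n)(\tau)$, $n=1,2,3,\dots,K(\tau)$.
   Context: $\Omega\subset\mathbb R^3$ is a simply connected bounded domain with $C^\infty$ boundary $\Gamma=\partial\Omega$; $D$ is a compact subset of $\Omega$; $c>0$ is the known wave speed; $T>2\,\mathrm{diam}(\Omega)/c$ is a constant. $\boldsymbol r=(x,y,z)$, $\boldsymbol p_k=(p_{k,x},p_{k,y},p_{k,z})$, $\mathrm i=\sqrt{-1}$, $d_t$ is the derivative in $t$, $\partial_\nu$ is the outward normal derivative on $\Gamma$, and $\delta$ is the Dirac distribution. Wave field: $u$ is the weak solution of $\frac1{c^2}\partial_t^2u-\Delta u=F$ in $(0,T)\times\Omega$, $u(0,\cdot)=\partial_tu(0,\cdot)=0$ in $\Omega$, $u=0$ on $(0,T)\times\Gamma$; that is, for every $v\in C^\infty([0,T]\times\overline\Omega)$, $$\frac1{c^2}\int_\Omega\partial_tu(T,\boldsymbol r)v(T,\boldsymbol r)\,dV-\frac1{c^2}\int_\Omega u(T,\boldsymbol r)\partial_tv(T,\boldsymbol r)\,dV-\int_0^T\!\!\int_\Gamma\partial_\nu u\,v\,dS\,dt+\int_0^T\!\!\int_\Omega u\Big(\frac1{c^2}\partial_t^2v-\Delta v\Big)dV\,dt=\mathcal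 F(v),$$ with $\mathcal F(v)=\sum_{k=1}^K\int_0^Tq_k(t)v(t,\boldsymbol p_k(t))\,dt$. Here $u\in C^1([0,T];\mathcal D'(\Omega))$ is, near $\Gamma$ (on $\Omega\setminus D$), a function with values in $H^1$, with vanishing trace on $\Gamma$, and with $\partial_tu$ having values in $L^2$ there and $\partial_\nu u\in L^2((0,T)\times\Gamma)$; volume integrals of $u$ and $\partial_tu$ are duality pairings where $u$ is not a function (split $v$ by a smooth cutoff that equals $1$ near $D$ and has compact support in $\Omega$). Reciprocity gap functional: for $v\in C^\infty([0,T]\times\overline\Omega;\mathbb C)$ with $\frac1{c^2}\partial_t^2v-\Delta v=0$ in $(0,T)\times\Omega$ and $v(T,\cdot)=\partial_tv(T,\cdot)=0$ in $\Omega$, $$\mathcal R_\phi(v)=-\int_0^T\!\!\int_\Gamma\phi(t,\boldsymbol r)v(t,\boldsymbol r)\,dS(\boldsymbol r)\,dt.$$ Test functions: let $\eta_\varepsilon\in C^\infty(\mathbb R;\mathbb R)$ be the standard mollifier with support $[-\varepsilon,\varepsilon]$, $0<\varepsilon\ll1$, and put $$f_{n,\varepsilon}(t,\boldsymbol r;\tau)=(x+\mathrm iy)^n\,\eta_\varepsilon\big(t-(\tau-z/c)\big)\ (n\ge0),\qquad g_{n,\varepsilon}=-\partial_tf_{n,\varepsilon}\ (n\ge0),$$ $$h_{n,\varepsilon}=z(\partial_x-\mathrm i\partial_y)f_{n,\varepsilon}-(x-\mathrm iy)\partial_zf_{n,\varepsilon}\ (n\ge1),\qquad i_{n,\varepsilon}=\partial_t^2f_{n,\varepsilon}\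 (n\ge0),\qquad j_{n,\varepsilon}=-\partial_th_{n,\varepsilon}\ (n\ge1).$$ For $w\in\{f,g,h,i,j\}$, $\mathcal R_\phi(w_n)(\tau)=\lim_{\varepsilon\to+0}\mathcal R_\phi(w_{n,\varepsilon}(\cdot,\cdot;\tau))$ for $\tau$ in the interior of $I_0$, extended by continuity to the endpoints of $I_0$. (For example $\mathcal R_\phi(f_n)(\tau)=-\int_\Gamma(x+\mathrm iy)^n\phi(\tau-z/c,\boldsymbol r)\,dS(\boldsymbol r)$.) "Uniquely determined by given values" means: for any two source configurations satisfying the hypotheses (with the same $\Omega,D,c,T,K_M,\tau$; the number $K$ of sources may differ), equality of the listed values implies equality of the quantities said to be determined.
   Formalization: The "Moreover" part is false if a source with q_k(t_k(τ))=0 has nonzero q_k' or q_k'' there; it is proved when these vanish too, or when K(·) and the listed values agree for all times of I_0 near τ. I_0 is assumed to have nonempty interior, so that the values are defined. *)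

theory Defs
  imports "HOL-Analysis.Analysis"
begin

section \<open>Derivatives and smoothness\<close>

type_synonym spacetime = "real \<times> (real^3)"

definition pd :: "'a::real_normed_vector \<Rightarrow> ('a \<Rightarrow> 'b::real_normed_vector) \<Rightarrow> 'a \<Rightarrow> 'b" where
  "pd e f x = frechet_derivative f (at x) e"

abbreviation Dt :: "(spacetime \<Rightarrow> 'b::real_normed_vector) \<Rightarrow> spacetime \<Rightarrow> 'b" where
  "Dt \<equiv> pd (1, 0)"

abbreviation Dx :: "3 \<Rightarrow> (spacetime \<Rightarrow> 'b::real_normed_vector) \<Rightarrow> spacetime \<Rightarrow> 'b" where
  "Dx i \<equiv> pd (0, axis i 1)"

definition grad :: "(real^3 \<Rightarrow> 'b::real_normed_vector) \<Rightarrow> real^3 \<Rightarrow> 'b^3" where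
  "grad f x = (\<chi> i. pd (axis i 1) f x)"

definition grad_x :: "(spacetime \<Rightarrow> 'b::real_normed_vector) \<Rightarrow> spacetime \<Rightarrow> 'b^3" where
  "grad_x f y = (\<chi> i. Dx i f y)"

definition wave_op :: "real \<Rightarrow> (spacetime \<Rightarrow> complex) \<Rightarrow> spacetime \<Rightarrow> complex" where
  "wave_op c v y = of_real (1 / c\<^sup>2) * Dt (Dt v) y - (\<Sum>i\<in>UNIV. Dx i (Dx i v) y)"

text \<open>\<open>C\<^sup>\<infinity>\<close> on an open set: all iterated partial derivatives are (Frechet) differentiable there.\<close>

definition smooth_on :: "'a::euclidean_space set \<Rightarrow> ('a \<Rightarrow> 'b::real_normed_vector) \<Rightarrow> bool" where
  "smooth_on S f \<longleftrightarrow>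
     (\<forall>es. set es \<subseteq> Basis \<longrightarrow> (\<forall>x\<in>S. (foldr pd es f) differentiable (at x)))"

text \<open>Derivatives on the closed interval \<open>[0,T]\<close> are one-sided at the endpoints.\<close>

definition dIcc :: "real \<Rightarrow> (real \<Rightarrow> 'a::real_normed_vector) \<Rightarrow> real \<Rightarrow> 'a" where
  "dIcc T f t = vector_derivative f (at t within {0..T})"

definition Ck_Icc :: "nat \<Rightarrow> real \<Rightarrow> (real \<Rightarrow> 'a::real_normed_vector) \<Rightarrow> bool" where
  "Ck_Icc k T f \<longleftrightarrow>
     (\<forall>j<k. ((dIcc T ^^ j) f) differentiable_on {0..T}) \<and>
     (\<forall>j\<le>k. continuous_on {0..T} ((dIcc T ^^ j) f))"


section \<open>Domains with smooth boundary, outward normal, surface measure\<close>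

definition local_defining_function :: "(real^3) set \<Rightarrow> (real^3) set \<Rightarrow> (real^3 \<Rightarrow> real) \<Rightarrow> bool" where
  "local_defining_function \<Omega> N \<rho> \<longleftrightarrow>
     open N \<and> smooth_on N \<rho> \<and> (\<forall>y\<in>N. grad \<rho> y \<noteq> 0) \<and> \<Omega> \<inter> N = {y\<in>N. \<rho> y < 0}"

definition smooth_boundary :: "(real^3) set \<Rightarrow> bool" where
  "smooth_boundary \<Omega> \<longleftrightarrow> (\<forall>x\<in>frontier \<Omega>. \<exists>N \<rho>. x \<in> N \<and> local_defining_function \<Omega> N \<rho>)"

definition outward_normal :: "(real^3) set \<Rightarrow> real^3 \<Rightarrow> real^3" where
  "outward_normal \<Omega> x =
     (THE \<nu>. \<exists>N \<rho>. x \<in> N \<and> local_defining_function \<Omega> N \<rho> \<and> \<nu> = grad \<rho> x /\<^sub>R norm (grad \<rho> x))"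

text \<open>
  The surface element \<open>dS\<close> is the two-dimensional Hausdorff measure, normalised so that it
  agrees with area. Bounded covering sets are required because \<open>diameter\<close> carries no
  information for unbounded sets.
\<close>

definition hausdorff2 :: "'a::metric_space set \<Rightarrow> ennreal" where
  "hausdorff2 A =
     (SUP \<delta>\<in>{0<..}.
        INF C\<in>{C :: nat \<Rightarrow> 'a set. A \<subseteq> (\<Union>i. C i) \<and> (\<forall>i. bounded (C i) \<and> diameter (C i) \<le> \<delta>)}.
          \<Sum>i. ennreal (pi / 4 * (diameter (C i))\<^sup>2))"

definition surface_measure :: "(real^3) set \<Rightarrow> (real^3) measure" where
  "surface_measure \<Gamma> = restrict_space (measure_of UNIV (sets borel) hausdorff2) \<Gamma>"


section \<open>Square integrable functions, Sobolev functions and traces\<close>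

definition L2 :: "'a measure \<Rightarrow> ('a \<Rightarrow> 'b::real_normed_vector) \<Rightarrow> bool" where
  "L2 M f \<longleftrightarrow> f \<in> borel_measurable M \<and> integrable M (\<lambda>x. (norm (f x))\<^sup>2)"

definition L2_tendsto :: "'a measure \<Rightarrow> (nat \<Rightarrow> 'a \<Rightarrow> 'b::real_normed_vector) \<Rightarrow> ('a \<Rightarrow> 'b) \<Rightarrow> bool" where
  "L2_tendsto M V f \<longleftrightarrow>
     (\<lambda>n. \<integral>\<^sup>+x. ennreal ((norm (V n x - f x))\<^sup>2) \<partial>M) \<longlonglongrightarrow> 0"

definition testfun :: "'a::euclidean_space set \<Rightarrow> ('a \<Rightarrow> complex) \<Rightarrow> bool" where
  "testfun S \<psi> \<longleftrightarrow> smooth_on UNIV \<psi> \<and>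
     compact (closure {x. \<psi> x \<noteq> 0}) \<and> closure {x. \<psi> x \<noteq> 0} \<subseteq> S"

definition weak_gradient :: "(real^3) set \<Rightarrow> (real^3 \<Rightarrow> complex) \<Rightarrow> (real^3 \<Rightarrow> complex^3) \<Rightarrow> bool" where
  "weak_gradient S f g \<longleftrightarrow> (\<forall>\<psi> i. testfun S \<psi> \<longrightarrow>
     (\<integral>x. f x * pd (axis i 1) \<psi> x \<partial>lebesgue_on S) = - (\<integral>x. g x $ i * \<psi> x \<partial>lebesgue_on S))"

text \<open>
  \<open>S\<close> is the part of \<open>\<Omega>\<close> outside a compact neighbourhood of \<open>D\<close>.
\<close>

definition collar :: "(real^3) set \<Rightarrow> (real^3) set \<Rightarrow> (real^3) set \<Rightarrow> bool" where
  "collar \<Omega> D S \<longleftrightarrow> (\<exists>N. compact N \<and> D \<subseteq> interior N \<and> N \<subseteq> \<Omega> \<and> S = \<Omega> - N)"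

text \<open>
  \<open>f \<in> H\<^sup>1(S)\<close> with zero trace on \<open>\<Gamma>\<close>. The trace is the continuous extension of the
  restriction map: smooth functions converging to \<open>f\<close> in \<open>H\<^sup>1(S)\<close> have boundary values
  converging to it in \<open>L\<^sup>2(\<Gamma>)\<close>.
\<close>

definition H1_zero_trace :: "(real^3) set \<Rightarrow> (real^3) set \<Rightarrow> (real^3 \<Rightarrow> complex) \<Rightarrow> bool" where
  "H1_zero_trace \<Gamma> S f \<longleftrightarrow>
     (\<exists>g V. L2 (lebesgue_on S) f \<and> L2 (lebesgue_on S) g \<and> weak_gradient S f g \<and>
        (\<forall>n. smooth_on UNIV (V n)) \<and>
        L2_tendsto (lebesgue_on S) V f \<and>
        L2_tendsto (lebesgue_on S) (\<lambda>n. grad (V n)) g \<and>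
        L2_tendsto (surface_measure \<Gamma>) V (\<lambda>_. 0))"

text \<open>
  The normal derivative in \<open>L\<^sup>2((0,T) \<times> \<Gamma>)\<close> of a function that has only \<open>H\<^sup>1\<close>
  regularity in space. \<open>H\<^sup>1\<close> functions have no trace of the gradient; the normal derivative
  is therefore the closure of the classical one in the graph norm of the wave operator: \<open>\<phi>\<close>
  is the limit of the classical normal derivatives of smooth functions converging to \<open>U\<close>
  together with their gradients and their images under the wave operator. By Green's formula
  the limit does not depend on the sequence; for solutions of the wave equation with zero
  boundary values and \<open>L\<^sup>2\<close> right-hand side it exists (hidden regularity).
\<close>

definition normal_derivative ::
  "real \<Rightarrow> real \<Rightarrow> (real^3) set \<Rightarrow> (real^3) set \<Rightarrow> (spacetime \<Rightarrow> complex) \<Rightarrow>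
   (spacetime \<Rightarrow> complex) \<Rightarrow> bool" where
  "normal_derivative c T \<Omega> S U \<phi> \<longleftrightarrow>
     (\<exists>V G P. (\<forall>n. smooth_on UNIV (V n)) \<and>
        L2 (lebesgue_on ({0<..<T} \<times> S)) U \<and>
        L2 (lebesgue_on ({0<..<T} \<times> S)) G \<and>
        L2 (lebesgue_on ({0<..<T} \<times> S)) P \<and>
        L2_tendsto (lebesgue_on ({0<..<T} \<times> S)) V U \<and>
        L2_tendsto (lebesgue_on ({0<..<T} \<times> S)) (\<lambda>n. grad_x (V n)) G \<and>
        L2_tendsto (lebesgue_on ({0<..<T} \<times> S)) (\<lambda>n. wave_op c (V n)) P \<and>
        L2_tendsto (lebesgue_on {0<..<T} \<Otimes>\<^sub>M surface_measure (frontier \<Omega>))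
          (\<lambda>n (t, r). pd (0, outward_normal \<Omega> r) (V n) (t, r)) \<phi>)"


section \<open>Distributions\<close>

definition distribution :: "(real^3) set \<Rightarrow> ((real^3 \<Rightarrow> complex) \<Rightarrow> complex) \<Rightarrow> bool" where
  "distribution S u \<longleftrightarrow>
     (\<forall>\<psi> \<psi>'. testfun S \<psi> \<longrightarrow> testfun S \<psi>' \<longrightarrow> u (\<lambda>x. \<psi> x + \<psi>' x) = u \<psi> + u \<psi>') \<and>
     (\<forall>a \<psi>. testfun S \<psi> \<longrightarrow> u (\<lambda>x. a * \<psi> x) = a * u \<psi>) \<and>
     (\<forall>L. compact L \<longrightarrow> L \<subseteq> S \<longrightarrow>
        (\<exists>C m. \<forall>\<psi>. testfun L \<psi> \<longrightarrow>
           norm (u \<psi>) \<le> C * (\<Sum>es\<in>{es. set es \<subseteq> Basis \<and> length es \<le> m}.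
                                SUP x. norm (foldr pd es \<psi> x))))"

text \<open>\<open>f\<close>, locally integrable on the open set \<open>S\<close>, is the restriction of \<open>u\<close> to \<open>S\<close>.\<close>

definition represents :: "(real^3) set \<Rightarrow> ((real^3 \<Rightarrow> complex) \<Rightarrow> complex) \<Rightarrow> (real^3 \<Rightarrow> complex) \<Rightarrow> bool" where
  "represents S u f \<longleftrightarrow>
     (\<forall>\<psi>. testfun S \<psi> \<longrightarrow>
        integrable (lebesgue_on S) (\<lambda>x. f x * \<psi> x) \<and> u \<psi> = (\<integral>x. f x * \<psi> x \<partial>lebesgue_on S))"

definition cutoff :: "(real^3) set \<Rightarrow> (real^3) set \<Rightarrow> (real^3 \<Rightarrow> complex) \<Rightarrow> bool" where
  "cutoff \<Omega> D \<kappa> \<longleftrightarrow> testfun \<Omega> \<kappa> \<and> (\<exists>N. open N \<and> D \<subseteq> N \<and> (\<forall>x\<in>N. \<kappa> x = 1))"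

text \<open>
  The ``volume integral'' over \<open>\<Omega>\<close> of \<open>u w\<close>, where \<open>w\<close> is smooth up to the boundary and
  the distribution \<open>u\<close> is represented by the function \<open>U\<close> on \<open>\<Omega> - D\<close>. Its value does not
  depend on the cutoff \<open>\<kappa>\<close>.
\<close>

definition pairing ::
  "(real^3) set \<Rightarrow> (real^3) set \<Rightarrow> (real^3 \<Rightarrow> complex) \<Rightarrow>
   ((real^3 \<Rightarrow> complex) \<Rightarrow> complex) \<Rightarrow> (real^3 \<Rightarrow> complex) \<Rightarrow> (real^3 \<Rightarrow> complex) \<Rightarrow> complex" where
  "pairing \<Omega> D \<kappa> u U w =
     u (\<lambda>x. \<kappa> x * w x) + (\<integral>x. U x * ((1 - \<kappa> x) * w x) \<partial>lebesgue_on (\<Omega> - D))"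


section \<open>Moving point sources and the wave field\<close>

text \<open>
  The sources are numbered by \<open>{1..K}\<close>; \<open>p k\<close> is the trajectory and \<open>q k\<close> the magnitude of
  the \<open>k\<close>-th source.
\<close>

definition source_config ::
  "real \<Rightarrow> real \<Rightarrow> (real^3) set \<Rightarrow> nat \<Rightarrow> (nat \<Rightarrow> real \<Rightarrow> real^3) \<Rightarrow> (nat \<Rightarrow> real \<Rightarrow> real) \<Rightarrow> bool" where
  "source_config c T D K p q \<longleftrightarrow>
     (\<forall>k\<in>{1..K}.
        Ck_Icc 6 T (p k) \<and> (\<forall>t\<in>{0..T}. p k t \<in> D) \<and>
        (\<forall>t\<in>{0..T}. norm (dIcc T (p k) t) < c) \<and>
        Ck_Icc 5 T (q k) \<and> (\<forall>j\<le>5. (dIcc T ^^ j) (q k) 0 = 0))"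

definition source_functional ::
  "real \<Rightarrow> nat \<Rightarrow> (nat \<Rightarrow> real \<Rightarrow> real^3) \<Rightarrow> (nat \<Rightarrow> real \<Rightarrow> real) \<Rightarrow>
   (spacetime \<Rightarrow> complex) \<Rightarrow> complex" where
  "source_functional T K p q v =
     (\<Sum>k\<in>{1..K}. \<integral>t. of_real (q k t) * v (t, p k t) \<partial>lebesgue_on {0..T})"

definition boundary_integral ::
  "real \<Rightarrow> (real^3) set \<Rightarrow> (spacetime \<Rightarrow> complex) \<Rightarrow> (spacetime \<Rightarrow> complex) \<Rightarrow> complex" where
  "boundary_integral T \<Omega> \<phi> v =
     (\<integral>t. (\<integral>r. \<phi> (t, r) * v (t, r) \<partial>surface_measure (frontier \<Omega>)) \<partial>lebesgue_on {0..T})"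

text \<open>
  \<open>u\<close> is the weak solution of the initial boundary value problem with source functional \<open>F\<close>,
  and \<open>\<phi>\<close> is its normal derivative on \<open>(0,T) \<times> \<Gamma>\<close>. \<open>U\<close> and \<open>W\<close> are the functions which
  \<open>u\<close> and \<open>\<partial>\<^sub>t u\<close> are on \<open>\<Omega> - D\<close>. Their regularity is required near \<open>\<Gamma>\<close>, i.e. away from
  every compact neighbourhood of \<open>D\<close>, and not up to \<open>D\<close>, because a source on the
  boundary of \<open>D\<close> makes \<open>u\<close> singular there. Functions that are smooth up to the boundary of
  \<open>[0,T] \<times> \<Omega>\<close> are represented by smooth functions on the whole space-time.
\<close>

definition wave_field ::
  "real \<Rightarrow> real \<Rightarrow> (real^3) set \<Rightarrow> (real^3) set \<Rightarrow> ((spacetime \<Rightarrow> complex) \<Rightarrow> complex) \<Rightarrow>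
   (real \<Rightarrow> (real^3 \<Rightarrow> complex) \<Rightarrow> complex) \<Rightarrow> (spacetime \<Rightarrow> complex) \<Rightarrow> bool" where
  "wave_field c T \<Omega> D F u \<phi> \<longleftrightarrow>
     (let du = (\<lambda>t \<psi>. dIcc T (\<lambda>s. u s \<psi>) t) in
       (\<forall>t\<in>{0..T}. distribution \<Omega> (u t)) \<and>
       (\<forall>\<psi>. testfun \<Omega> \<psi> \<longrightarrow> Ck_Icc 1 T (\<lambda>t. u t \<psi>)) \<and>
       (\<forall>\<psi>. testfun \<Omega> \<psi> \<longrightarrow> u 0 \<psi> = 0 \<and> du 0 \<psi> = 0) \<and>
       L2 (lebesgue_on {0<..<T} \<Otimes>\<^sub>M surface_measure (frontier \<Omega>)) \<phi> \<and>
       (\<exists>U W.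
          (\<forall>t\<in>{0..T}. represents (\<Omega> - D) (u t) (\<lambda>r. U (t, r)) \<and>
                      represents (\<Omega> - D) (du t) (\<lambda>r. W (t, r))) \<and>
          (\<forall>S. collar \<Omega> D S \<longrightarrow>
             (\<forall>t\<in>{0..T}. H1_zero_trace (frontier \<Omega>) S (\<lambda>r. U (t, r)) \<and>
                         L2 (lebesgue_on S) (\<lambda>r. W (t, r))) \<and>
             normal_derivative c T \<Omega> S U \<phi>) \<and>
          (\<exists>\<kappa>. cutoff \<Omega> D \<kappa> \<and>
             (\<forall>v. smooth_on UNIV v \<longrightarrow>
                integrable (lebesgue_on {0..T})
                  (\<lambda>t. pairing \<Omega> D \<kappa> (u t) (\<lambda>r. U (t, r)) (\<lambda>r. wave_op c v (t, r))) \<and>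
                of_real (1 / c\<^sup>2) * pairing \<Omega> D \<kappa> (du T) (\<lambda>r. W (T, r)) (\<lambda>r. v (T, r))
                - of_real (1 / c\<^sup>2) * pairing \<Omega> D \<kappa> (u T) (\<lambda>r. U (T, r)) (\<lambda>r. Dt v (T, r))
                - boundary_integral T \<Omega> \<phi> v
                + (\<integral>t. pairing \<Omega> D \<kappa> (u t) (\<lambda>r. U (t, r)) (\<lambda>r. wave_op c v (t, r))
                     \<partial>lebesgue_on {0..T})
                = F v))))"


section \<open>Reciprocity gap functionals\<close>

definition RG ::
  "real \<Rightarrow> (real^3) set \<Rightarrow> (spacetime \<Rightarrow> complex) \<Rightarrow> (spacetime \<Rightarrow> complex) \<Rightarrow> complex" where
  "RG T \<Omega> \<phi> v = - boundary_integral T \<Omega> \<phi> v"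

definition bump :: "real \<Rightarrow> real" where
  "bump s = (if \<bar>s\<bar> < 1 then exp (1 / (s\<^sup>2 - 1)) else 0)"

definition mollifier :: "real \<Rightarrow> real \<Rightarrow> real" where
  "mollifier \<epsilon> s = bump (s / \<epsilon>) / (\<epsilon> * (\<integral>x. bump x \<partial>lborel))"

text \<open>The arguments are the wave speed \<open>c\<close>, the index \<open>n\<close>, then \<open>\<epsilon>\<close>, \<open>\<tau>\<close> and \<open>(t, r)\<close>.\<close>

type_synonym test_family = "real \<Rightarrow> nat \<Rightarrow> real \<Rightarrow> real \<Rightarrow> spacetime \<Rightarrow> complex"

definition test_f :: test_family where
  "test_f c n \<epsilon> \<tau> = (\<lambda>(t, r). (Complex (r $ 1) (r $ 2)) ^ n * of_real (mollifier \<epsilon> (t - (\<tau> - r $ 3 / c))))"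

definition test_g :: test_family where
  "test_g c n \<epsilon> \<tau> = (\<lambda>y. - Dt (test_f c n \<epsilon> \<tau>) y)"

definition test_h :: test_family where
  "test_h c n \<epsilon> \<tau> = (\<lambda>(t, r).
     of_real (r $ 3) * (Dx 1 (test_f c n \<epsilon> \<tau>) (t, r) - \<i> * Dx 2 (test_f c n \<epsilon> \<tau>) (t, r))
     - Complex (r $ 1) (- (r $ 2)) * Dx 3 (test_f c n \<epsilon> \<tau>) (t, r))"

definition test_i :: test_family where
  "test_i c n \<epsilon> \<tau> = Dt (Dt (test_f c n \<epsilon> \<tau>))"

definition test_j :: test_family where
  "test_j c n \<epsilon> \<tau> = (\<lambda>y. - Dt (test_h c n \<epsilon> \<tau>) y)"

definition I0 :: "real \<Rightarrow> real \<Rightarrow> (real^3) set \<Rightarrow> real set" where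
  "I0 c T \<Omega> = {max 0 (SUP r\<in>\<Omega>. r $ 3 / c) .. min (T + (INF r\<in>\<Omega>. r $ 3 / c)) T}"

text \<open>Interior points of \<open>I\<^sub>0\<close>: the limit \<open>\<epsilon> \<rightarrow> +0\<close>. End points: extension by continuity.\<close>

definition RG_interior ::
  "real \<Rightarrow> real \<Rightarrow> (real^3) set \<Rightarrow> (spacetime \<Rightarrow> complex) \<Rightarrow> test_family \<Rightarrow> nat \<Rightarrow> real \<Rightarrow> complex" where
  "RG_interior c T \<Omega> \<phi> w n \<tau> = Lim (at_right 0) (\<lambda>\<epsilon>. RG T \<Omega> \<phi> (w c n \<epsilon> \<tau>))"

definition RG_value ::
  "real \<Rightarrow> real \<Rightarrow> (real^3) set \<Rightarrow> (spacetime \<Rightarrow> complex) \<Rightarrow> test_family \<Rightarrow> nat \<Rightarrow> real \<Rightarrow> complex" where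
  "RG_value c T \<Omega> \<phi> w n \<tau> =
     (if \<tau> \<in> interior (I0 c T \<Omega>) then RG_interior c T \<Omega> \<phi> w n \<tau>
      else Lim (at \<tau> within interior (I0 c T \<Omega>)) (RG_interior c T \<Omega> \<phi> w n))"


section \<open>Retarded times and active sources\<close>

definition retarded_time :: "real \<Rightarrow> real \<Rightarrow> (real \<Rightarrow> real^3) \<Rightarrow> real \<Rightarrow> real" where
  "retarded_time c T p \<tau> = (THE t. t \<in> {0..T} \<and> t - \<tau> + p t $ 3 / c = 0)"

definition p_at :: "real \<Rightarrow> real \<Rightarrow> (nat \<Rightarrow> real \<Rightarrow> real^3) \<Rightarrow> real \<Rightarrow> nat \<Rightarrow> real^3" where
  "p_at c T p \<tau> k = p k (retarded_time c T (p k) \<tau>)"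

definition q_at :: "real \<Rightarrow> real \<Rightarrow> (nat \<Rightarrow> real \<Rightarrow> real^3) \<Rightarrow> (nat \<Rightarrow> real \<Rightarrow> real) \<Rightarrow> real \<Rightarrow> nat \<Rightarrow> real" where
  "q_at c T p q \<tau> k = q k (retarded_time c T (p k) \<tau>)"

definition p_xy :: "real^3 \<Rightarrow> complex" where
  "p_xy r = Complex (r $ 1) (r $ 2)"

definition active ::
  "real \<Rightarrow> real \<Rightarrow> nat \<Rightarrow> (nat \<Rightarrow> real \<Rightarrow> real^3) \<Rightarrow> (nat \<Rightarrow> real \<Rightarrow> real) \<Rightarrow> real \<Rightarrow> nat set" where
  "active c T K p q \<tau> = {k\<in>{1..K}. q_at c T p q \<tau> k \<noteq> 0}"

definition separated :: "real \<Rightarrow> real \<Rightarrow> nat \<Rightarrow> (nat \<Rightarrow> real \<Rightarrow> real^3) \<Rightarrow> real \<Rightarrow> bool" where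
  "separated c T K p \<tau> \<longleftrightarrow>
     (\<forall>j\<in>{1..K}. \<forall>k\<in>{1..K}. j \<noteq> k \<longrightarrow> p_xy (p_at c T p \<tau> j) \<noteq> p_xy (p_at c T p \<tau> k))"

text \<open>Equality of the values listed for \<open>m = K(\<tau>)\<close> active sources.\<close>

definition listed_values_agree ::
  "real \<Rightarrow> real \<Rightarrow> (real^3) set \<Rightarrow> (spacetime \<Rightarrow> complex) \<Rightarrow> (spacetime \<Rightarrow> complex) \<Rightarrow> nat \<Rightarrow> real \<Rightarrow> bool" where
  "listed_values_agree c T \<Omega> \<phi> \<phi>' m \<tau> \<longleftrightarrow>
     (\<forall>w\<in>{test_f, test_g, test_i}. \<forall>n. n < 2 * m \<longrightarrow>
        RG_value c T \<Omega> \<phi> w n \<tau> = RG_value c T \<Omega> \<phi>' w n \<tau>) \<and>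
     (\<forall>w\<in>{test_h, test_j}. \<forall>n\<in>{1..m}.
        RG_value c T \<Omega> \<phi> w n \<tau> = RG_value c T \<Omega> \<phi>' w n \<tau>)"

text \<open>Equality of the locations and magnitudes of the active sources up to their numbering.\<close>

definition same_active_sources ::
  "real \<Rightarrow> real \<Rightarrow> nat \<Rightarrow> (nat \<Rightarrow> real \<Rightarrow> real^3) \<Rightarrow> (nat \<Rightarrow> real \<Rightarrow> real) \<Rightarrow>
   nat \<Rightarrow> (nat \<Rightarrow> real \<Rightarrow> real^3) \<Rightarrow> (nat \<Rightarrow> real \<Rightarrow> real) \<Rightarrow> real \<Rightarrow> bool" where
  "same_active_sources c T K p q K' p' q' \<tau> \<longleftrightarrow>
     (\<exists>\<sigma>. bij_betw \<sigma> (active c T K p q \<tau>) (active c T K' p' q' \<tau>) \<and>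
        (\<forall>k\<in>active c T K p q \<tau>.
           p_at c T p' \<tau> (\<sigma> k) = p_at c T p \<tau> k \<and>
           q_at c T p' q' \<tau> (\<sigma> k) = q_at c T p q \<tau> k))"

text \<open>
  A source whose magnitude vanishes at its retarded time is not counted in \<open>K(\<tau>)\<close>. The
  functionals of \<open>g\<close>, \<open>h\<close>, \<open>i\<close>, \<open>j\<close> involve derivatives in \<open>\<tau>\<close> up to second order, so
  such a source still contributes to them unless its magnitude vanishes there together with
  its first two derivatives. Without this condition the listed values do not determine the
  locations. For example, suppose that near the retarded times one configuration consists of a
  source of constant magnitude \<open>1\<close> resting at the origin and a source of magnitude
  \<open>b (t - \<tau>)\<close> resting at \<open>(a, 0, 0)\<close>. Then \<open>K(\<tau>) = 1\<close>, and a single source at height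
  \<open>b a\<^sup>2 / (2 c)\<close> on the \<open>z\<close> axis, suitably moving, yields the same values. The condition
  can fail only for countably many \<open>\<tau>\<close>: an offending zero of \<open>q\<^sub>k\<close> is an isolated one.
\<close>

definition inactive_silent ::
  "real \<Rightarrow> real \<Rightarrow> nat \<Rightarrow> (nat \<Rightarrow> real \<Rightarrow> real^3) \<Rightarrow> (nat \<Rightarrow> real \<Rightarrow> real) \<Rightarrow> real \<Rightarrow> bool" where
  "inactive_silent c T K p q \<tau> \<longleftrightarrow>
     (\<forall>k\<in>{1..K}. q_at c T p q \<tau> k = 0 \<longrightarrow>
        dIcc T (q k) (retarded_time c T (p k) \<tau>) = 0 \<and>
        (dIcc T ^^ 2) (q k) (retarded_time c T (p k) \<tau>) = 0)"

end

theory Submission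
  imports Defs "HOL-Computational_Algebra.Polynomial"
begin

text \<open>
  The test functions are solutions of the wave equation which, for small \<open>\<epsilon>\<close>, vanish near the
  final time. Inserted in the weak formulation, such a solution \<open>v\<close> leaves only the boundary term
  and the source term, so that the reciprocity gap of \<open>v\<close> is \<open>\<Sum>\<^sub>k \<integral> q\<^sub>k(t) v(t, p\<^sub>k(t)) dt\<close>
  (\<open>RG_test_waves\<close>). Each test function is a polynomial in \<open>w = x + i y\<close>, its conjugate and
  \<open>z\<close>, times a derivative of a pulse concentrated at \<open>t + z / c = \<tau>\<close>. Along the \<open>k\<close>-th
  trajectory the pulse is met once, at the retarded time \<open>t\<^sub>k(\<tau>)\<close>, because the speed is below
  \<open>c\<close>. Write \<open>L = (1 / \<theta>') d/dt\<close> with \<open>\<theta>(t) = t + p\<^sub>z(t) / c\<close>; this is differentiation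
  with respect to \<open>\<tau>\<close>, seen in emission time. Integration by parts moves the derivatives from
  the pulse to the source, and in the limit \<open>\<epsilon> \<rightarrow> 0\<close> the functionals become, with the
  amplitude \<open>a = q / \<theta>'\<close> and all terms evaluated at the retarded times (\<open>RG_values\<close>),

    \<open>f\<^sub>n = \<Sum> a w\<^sup>n\<close>, \<open>g\<^sub>n = \<Sum> L(a w\<^sup>n)\<close>, \<open>i\<^sub>n = \<Sum> L(L(a w\<^sup>n))\<close>,

    \<open>h\<^sub>n = \<Sum> 2 n z a w\<^sup>n\<^sup>-\<^sup>1 + L(a w\<^sup>* w\<^sup>n) / c\<close>, \<open>j\<^sub>n = \<Sum> 2 n L(z a w\<^sup>n\<^sup>-\<^sup>1) + L(L(a w\<^sup>* w\<^sup>n)) / c\<close>,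

  where \<open>w\<^sup>*\<close> is the conjugate of \<open>w\<close>. These sums determine the sources by linear algebra. The
  \<open>f\<^sub>n\<close> form an exponential sum with distinct nodes \<open>w\<^sub>k\<close> and nonzero weights \<open>a\<^sub>k\<close>, and
  Prony's argument recovers both (\<open>prony_unique\<close>). The \<open>g\<^sub>n\<close> are then a confluent
  Vandermonde system for \<open>L a\<close> and \<open>L w\<close>, the \<open>i\<^sub>n\<close> one for \<open>L L a\<close> and \<open>L L w\<close>.
  Once these are known, \<open>h\<^sub>n\<close> and \<open>j\<^sub>n\<close> are Vandermonde systems for \<open>z\<close> and \<open>L z\<close>
  (\<open>sources_from_moments\<close>). Finally \<open>1 / \<theta>' = 1 - L z / c\<close>, which turns the amplitude into
  the magnitude \<open>q\<close>.

  Only the sources with \<open>q\<^sub>k(t\<^sub>k(\<tau>)) \<noteq> 0\<close> may enter the linear algebra. A silent source has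
  \<open>a = L a = L L a = 0\<close> and drops out of all sums. When the values agree in a whole neighbourhood
  of \<open>\<tau>\<close>, silence is arranged by moving \<open>\<tau>\<close>: every interval contains a smaller one on which
  each source is either active throughout or has magnitude identically zero (\<open>silent_window\<close>).
  The sources coincide at such times, arbitrarily close to \<open>\<tau>\<close>, and by continuity those active
  at \<open>\<tau>\<close> coincide as well (\<open>partner_from_nearby_times\<close>).
\<close>

section \<open>Exponential sums with coalescing nodes\<close>

text \<open>
  A moment sequence \<open>\<Sum> b\<^sub>k w\<^sub>k\<^sup>n\<close>, possibly with derivatives at the nodes, is the value of a
  linear functional on the monomial \<open>X\<^sup>n\<close>. Vanishing moments thus allow evaluation at any
  polynomial of small degree, chosen to isolate a single unknown.
\<close>

lemma poly_functional_zero: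
  fixes \<mu> :: "complex poly \<Rightarrow> complex"
  assumes add: "\<And>P Q. \<mu> (P + Q) = \<mu> P + \<mu> Q"
    and smult: "\<And>a P. \<mu> (smult a P) = a * \<mu> P"
    and mon: "\<And>n. n < N \<Longrightarrow> \<mu> (monom 1 n) = 0"
    and deg: "degree P < N"
  shows "\<mu> P = 0"
proof -
  have zero: "\<mu> 0 = 0" using smult[of 0 0] by simp
  have sums: "\<mu> (\<Sum>i\<in>S. g i) = (\<Sum>i\<in>S. \<mu> (g i))" if "finite S" for S :: "nat set" and g
    using that by induction (auto simp: zero add)
  have "\<mu> P = \<mu> (\<Sum>i\<le>degree P. monom (coeff P i) i)"
    by (simp add: poly_as_sum_of_monoms)
  also have "\<dots> = (\<Sum>i\<le>degree P. \<mu> (smult (coeff P i) (monom 1 i)))"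
    by (simp add: sums smult_monom)
  also have "\<dots> = 0"
    using mon deg by (simp add: smult)
  finally show ?thesis .
qed

definition node_poly :: "complex set \<Rightarrow> complex poly" where
  "node_poly S = (\<Prod>x\<in>S. [:- x, 1:])"

lemma poly_node_poly: "finite S \<Longrightarrow> poly (node_poly S) y = (\<Prod>x\<in>S. y - x)"
  by (simp add: node_poly_def poly_prod)

lemma poly_node_poly_eq_0_iff: "finite S \<Longrightarrow> poly (node_poly S) y = 0 \<longleftrightarrow> y \<in> S"
  by (auto simp: poly_node_poly)

lemma degree_node_poly: "degree (node_poly S) \<le> card S"
proof (cases "finite S")
  case True
  then show ?thesis
  proof (induction S)
    case empty
    then show ?case by (simp add: node_poly_def)
  next
    case (insert x S)
    have "degree (node_poly (insert x S)) \<le> degree [:- x, 1:] + degree (node_poly S)"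
      using insert degree_mult_le[of "[:- x, 1:]" "node_poly S"]
      by (simp add: node_poly_def del: mult_pCons_left)
    then show ?case using insert by simp
  qed
qed (simp add: node_poly_def)

text \<open>
  The polynomial vanishing at all nodes except \<open>y\<close> isolates \<open>b y\<close>.
\<close>

lemma vandermonde_unique:
  assumes S: "finite S" and eq: "\<And>n. n < card S \<Longrightarrow> (\<Sum>x\<in>S. b x * x ^ n) = 0" and y: "y \<in> S"
  shows "b y = (0::complex)"
proof -
  define \<mu> where "\<mu> P = (\<Sum>x\<in>S. b x * poly P x)" for P
  let ?P = "node_poly (S - {y})"
  have "card S > 0" using S y card_gt_0_iff by blast
  then have "degree ?P < card S"
    using degree_node_poly[of "S - {y}"] S y by simp
  then have "\<mu> ?P = 0"
    by (rule poly_functional_zero[rotated 3])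
       (auto simp: \<mu>_def algebra_simps sum.distrib sum_distrib_left poly_monom eq)
  moreover have "poly ?P x = 0" if "x \<in> S - {y}" for x
    using that S by (simp add: poly_node_poly_eq_0_iff)
  then have "\<mu> ?P = b y * poly ?P y"
    unfolding \<mu>_def using S y by (simp add: sum.remove[of _ y])
  ultimately show ?thesis using S by (auto simp: poly_node_poly_eq_0_iff)
qed

lemma vandermonde_unique_indexed:
  assumes A: "finite A" and inj: "inj_on w A"
    and eq: "\<And>n. n < card A \<Longrightarrow> (\<Sum>k\<in>A. b k * w k ^ n) = 0" and k: "k \<in> A"
  shows "b k = (0::complex)"
proof -
  have "(\<Sum>x\<in>w ` A. b (inv_into A w x) * x ^ n) = 0" if "n < card (w ` A)" for n
    using eq[of n] that inj by (simp add: sum.reindex card_image)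
  then have "b (inv_into A w (w k)) = 0"
    by (rule vandermonde_unique[rotated]) (use A k in auto)
  then show ?thesis using inj k by simp
qed

text \<open>
  With \<open>N\<close> the polynomial vanishing exactly at the nodes other than \<open>w\<^sub>k\<close>, the square \<open>N\<^sup>2\<close>
  has double zeros there, so only the \<open>k\<close>-th unknowns survive. The extra factor \<open>X - w\<^sub>k\<close>
  isolates \<open>d\<^sub>k\<close>; then \<open>N\<^sup>2\<close> itself isolates \<open>b\<^sub>k\<close>. The degree \<open>2 |A| - 1\<close> is just admissible.
\<close>

lemma confluent_vandermonde_unique:
  assumes A: "finite A" and inj: "inj_on w A"
    and eq: "\<And>n. n < 2 * card A \<Longrightarrow> (\<Sum>k\<in>A. b k * w k ^ n + d k * (of_nat n * w k ^ (n - 1))) = 0"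
    and k: "k \<in> A"
  shows "b k = (0::complex)" "d k = 0"
proof -
  define \<mu> where "\<mu> P = (\<Sum>k\<in>A. b k * poly P (w k) + d k * poly (pderiv P) (w k))" for P
  have \<mu>0: "\<mu> P = 0" if "degree P < 2 * card A" for P
    using that
  proof (rule poly_functional_zero[rotated 3])
    fix n assume "n < 2 * card A"
    then show "\<mu> (monom 1 n) = 0"
      using eq by (simp add: \<mu>_def pderiv_monom poly_monom mult.assoc)
  qed (auto simp: \<mu>_def algebra_simps sum.distrib sum_distrib_left pderiv_add pderiv_smult)
  define N where "N = node_poly (w ` (A - {k}))"
  have pos: "card A > 0" using A k card_gt_0_iff by blast
  have N0: "poly N (w j) = 0" if "j \<in> A - {k}" for j
    using that A by (auto simp: N_def poly_node_poly_eq_0_iff)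
  have Nk: "poly N (w k) \<noteq> 0"
    using inj k A by (auto simp: N_def poly_node_poly_eq_0_iff dest: inj_onD)
  have "degree N \<le> card (w ` (A - {k}))" unfolding N_def by (rule degree_node_poly)
  also have "\<dots> \<le> card A - 1" using card_image_le[of "A - {k}" w] A k by simp
  finally have degN: "degree N \<le> card A - 1" .
  have degN2: "degree (N * N) \<le> 2 * (card A - 1)"
    using degree_mult_le[of N N] degN by linarith
  have single: "\<mu> (N * N * R) = b k * poly (N * N * R) (w k) + d k * poly (pderiv (N * N * R)) (w k)" for R
    unfolding \<mu>_def using A k by (simp add: sum.remove[of _ k] pderiv_mult N0)
  define R where "R = [:- w k, 1:]"
  have R: "poly R (w k) = 0" "pderiv R = 1" "degree R = 1"
    by (simp_all add: R_def pderiv_pCons)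
  have "\<mu> (N * N * R) = 0"
    using degN2 pos degree_mult_le[of "N * N" R] R(3) by (intro \<mu>0) linarith
  moreover have "poly (pderiv (N * N * R)) (w k) = poly N (w k) * poly N (w k)"
    by (simp add: pderiv_mult[of "N * N" R] R)
  ultimately have "d k * (poly N (w k) * poly N (w k)) = 0"
    using single[of R] R(1) by simp
  then show d: "d k = 0" using Nk by simp
  have "\<mu> (N * N * 1) = 0" using degN2 pos by (intro \<mu>0) simp
  then show "b k = 0" using single[of 1] Nk d by simp
qed

text \<open>
  The difference of the two exponential sums is one exponential sum over the union of the node
  sets, which has at most \<open>|A| + |A'|\<close> elements. Hence the total weights of both sides agree at
  every node, and a node carrying a nonzero weight on one side must occur on the other.
\<close>

lemma prony_nodes_subset:
  assumes A: "finite A" "finite A'" and inj: "inj_on w A" "inj_on w' A'"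
    and nz: "\<And>k. k \<in> A \<Longrightarrow> a k \<noteq> 0"
    and eq: "\<And>n. n < card A + card A' \<Longrightarrow> (\<Sum>k\<in>A. a k * w k ^ n) = (\<Sum>k\<in>A'. a' k * w' k ^ n)"
    and k: "k \<in> A"
  obtains k' where "k' \<in> A'" "w' k' = w k" "a' k' = (a k :: complex)"
proof -
  define S where "S = w ` A \<union> w' ` A'"
  \<comment> \<open>The total weight that each side puts on the node \<open>x\<close>; zero if \<open>x\<close> is not one of its nodes.\<close>
  define m where "m x = (\<Sum>k | k \<in> A \<and> w k = x. a k)" for x
  define m' where "m' x = (\<Sum>k | k \<in> A' \<and> w' k = x. a' k)" for x
  have S: "finite S" using A by (simp add: S_def)
  have "card S \<le> card (w ` A) + card (w' ` A')" unfolding S_def by (rule card_Un_le)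
  also have "\<dots> \<le> card A + card A'" using A by (intro add_mono card_image_le) auto
  finally have card: "card S \<le> card A + card A'" .
  have 1: "(\<Sum>x\<in>S. m x * x ^ n) = (\<Sum>k\<in>A. a k * w k ^ n)" for n
    unfolding m_def sum_distrib_right
    using A S by (subst sum.group[symmetric, of A S w]) (auto simp: S_def intro!: sum.cong)
  have 2: "(\<Sum>x\<in>S. m' x * x ^ n) = (\<Sum>k\<in>A'. a' k * w' k ^ n)" for n
    unfolding m'_def sum_distrib_right
    using A S by (subst sum.group[symmetric, of A' S w']) (auto simp: S_def intro!: sum.cong)
  have "m (w k) - m' (w k) = 0"
    using S card k eq
    by (intro vandermonde_unique[of S "\<lambda>x. m x - m' x"])
       (auto simp: S_def left_diff_distrib sum_subtractf 1[unfolded S_def] 2[unfolded S_def])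
  moreover have "{j. j \<in> A \<and> w j = w k} = {k}" using inj k by (auto dest: inj_onD)
  ultimately have m': "m' (w k) = a k" by (simp add: m_def)
  then have "m' (w k) \<noteq> 0" using nz k by simp
  then obtain k' where k': "k' \<in> A'" "w' k' = w k"
    unfolding m'_def by (metis (mono_tags, lifting) mem_Collect_eq sum.not_neutral_contains_not_neutral)
  then have "{j. j \<in> A' \<and> w' j = w k} = {k'}" using inj(2) by (auto simp: inj_on_def)
  then have "a' k' = a k" using m' by (simp add: m'_def)
  with k' show thesis by (rule that)
qed

lemma prony_unique:
  assumes A: "finite A" "finite A'" and inj: "inj_on w A" "inj_on w' A'"
    and nz: "\<And>k. k \<in> A \<Longrightarrow> a k \<noteq> 0" "\<And>k. k \<in> A' \<Longrightarrow> a' k \<noteq> 0"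
    and eq: "\<And>n. n < card A + card A' \<Longrightarrow> (\<Sum>k\<in>A. a k * w k ^ n) = (\<Sum>k\<in>A'. a' k * w' k ^ n)"
  obtains \<sigma> where "bij_betw \<sigma> A A'" "\<And>k. k \<in> A \<Longrightarrow> w' (\<sigma> k) = w k"
    "\<And>k. k \<in> A \<Longrightarrow> a' (\<sigma> k) = (a k :: complex)"
proof -
  have "\<forall>k\<in>A. \<exists>k'. k' \<in> A' \<and> w' k' = w k \<and> a' k' = a k"
    using prony_nodes_subset[OF A inj nz(1) eq] by metis
  then obtain \<sigma> where \<sigma>: "\<And>k. k \<in> A \<Longrightarrow> \<sigma> k \<in> A' \<and> w' (\<sigma> k) = w k \<and> a' (\<sigma> k) = a k"
    by metis
  have "A' \<subseteq> \<sigma> ` A"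
  proof
    fix k' assume k': "k' \<in> A'"
    have "(\<Sum>k\<in>A'. a' k * w' k ^ n) = (\<Sum>k\<in>A. a k * w k ^ n)" if "n < card A' + card A" for n
      using eq[of n] that by simp
    from prony_nodes_subset[OF A(2,1) inj(2,1) nz(2) this k']
    obtain k where "k \<in> A" "w k = w' k'" by blast
    then show "k' \<in> \<sigma> ` A" using \<sigma>[of k] inj(2) k' by (metis image_eqI inj_onD)
  qed
  then have "\<sigma> ` A = A'" using \<sigma> by blast
  moreover have "inj_on \<sigma> A" using \<sigma> inj(1) by (metis inj_on_def)
  ultimately show thesis using \<sigma> that[of \<sigma>] by (auto simp: bij_betw_def)
qed

text \<open>
  The triangular structure of the listed values. Each group of equations involves new unknowns
  linearly, plus a remainder (\<open>\<Phi>\<close>, \<open>\<Psi>\<close>, \<open>\<Theta>\<close>) depending only on unknowns that earlier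
  groups determine: first the nodes and weights, then their first and second derivatives, then
  the heights and their derivatives. Once the sources are matched, the remainders
  of both sides cancel, whatever functions they are.
\<close>

lemma sources_from_moments:
  fixes a da dda w dw ddw z dz :: "'i \<Rightarrow> complex"
    and a' da' dda' w' dw' ddw' z' dz' :: "'j \<Rightarrow> complex"
  assumes A: "finite A" "finite A'" "card A = m" "card A' = m"
    and inj: "inj_on w A" "inj_on w' A'"
    and nz: "\<And>k. k \<in> A \<Longrightarrow> a k \<noteq> 0" "\<And>k. k \<in> A' \<Longrightarrow> a' k \<noteq> 0"
    and f: "\<And>n. n < 2 * m \<Longrightarrow> (\<Sum>k\<in>A. a k * w k ^ n) = (\<Sum>k\<in>A'. a' k * w' k ^ n)"
    and g: "\<And>n. n < 2 * m \<Longrightarrow>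
        (\<Sum>k\<in>A. da k * w k ^ n + a k * dw k * (of_nat n * w k ^ (n - 1)))
      = (\<Sum>k\<in>A'. da' k * w' k ^ n + a' k * dw' k * (of_nat n * w' k ^ (n - 1)))"
    and i: "\<And>n. n < 2 * m \<Longrightarrow>
        (\<Sum>k\<in>A. dda k * w k ^ n + a k * ddw k * (of_nat n * w k ^ (n - 1))
                 + \<Phi> n (a k) (da k) (w k) (dw k))
      = (\<Sum>k\<in>A'. dda' k * w' k ^ n + a' k * ddw' k * (of_nat n * w' k ^ (n - 1))
                 + \<Phi> n (a' k) (da' k) (w' k) (dw' k))"
    and h: "\<And>n. n < m \<Longrightarrow>
        (\<Sum>k\<in>A. of_nat (2 * Suc n) * (z k * a k * w k ^ n) + \<Psi> n (a k) (da k) (w k) (dw k))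
      = (\<Sum>k\<in>A'. of_nat (2 * Suc n) * (z' k * a' k * w' k ^ n) + \<Psi> n (a' k) (da' k) (w' k) (dw' k))"
    and j: "\<And>n. n < m \<Longrightarrow>
        (\<Sum>k\<in>A. of_nat (2 * Suc n) * (dz k * a k * w k ^ n)
                 + \<Theta> n (z k) (a k) (da k) (dda k) (w k) (dw k) (ddw k))
      = (\<Sum>k\<in>A'. of_nat (2 * Suc n) * (dz' k * a' k * w' k ^ n)
                 + \<Theta> n (z' k) (a' k) (da' k) (dda' k) (w' k) (dw' k) (ddw' k))"
  obtains \<sigma> where "bij_betw \<sigma> A A'"
    "\<And>k. k \<in> A \<Longrightarrow> w' (\<sigma> k) = w k \<and> a' (\<sigma> k) = a k \<and> z' (\<sigma> k) = z k \<and> dz' (\<sigma> k) = dz k"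
proof -
  have "\<And>n. n < card A + card A' \<Longrightarrow> (\<Sum>k\<in>A. a k * w k ^ n) = (\<Sum>k\<in>A'. a' k * w' k ^ n)"
    using f A by simp
  from prony_unique[OF A(1,2) inj nz this]
  obtain \<sigma> where \<sigma>: "bij_betw \<sigma> A A'"
    and w: "\<And>k. k \<in> A \<Longrightarrow> w' (\<sigma> k) = w k" and a: "\<And>k. k \<in> A \<Longrightarrow> a' (\<sigma> k) = a k"
    by blast
  have reindex: "(\<Sum>k\<in>A'. G k) = (\<Sum>k\<in>A. G (\<sigma> k))" for G :: "'j \<Rightarrow> complex"
    using sum.reindex_bij_betw[OF \<sigma>, of G] by simp
  note unique2 = confluent_vandermonde_unique[OF A(1) inj(1)]
  note unique1 = vandermonde_unique_indexed[OF A(1) inj(1)]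
  have "(\<Sum>k\<in>A. (da k - da' (\<sigma> k)) * w k ^ n
      + (a k * (dw k - dw' (\<sigma> k))) * (of_nat n * w k ^ (n - 1))) = 0" if "n < 2 * card A" for n
    using g[of n] that A unfolding reindex
    by (simp add: w a algebra_simps sum.distrib sum_subtractf)
  from unique2[OF this] nz have da: "\<And>k. k \<in> A \<Longrightarrow> da' (\<sigma> k) = da k"
    and dw: "\<And>k. k \<in> A \<Longrightarrow> dw' (\<sigma> k) = dw k" by auto
  have "(\<Sum>k\<in>A. (dda k - dda' (\<sigma> k)) * w k ^ n
      + (a k * (ddw k - ddw' (\<sigma> k))) * (of_nat n * w k ^ (n - 1))) = 0" if "n < 2 * card A" for n
    using i[of n] that A unfolding reindex
    by (simp add: w a da dw algebra_simps sum.distrib sum_subtractf)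
  from unique2[OF this] nz have dda: "\<And>k. k \<in> A \<Longrightarrow> dda' (\<sigma> k) = dda k"
    and ddw: "\<And>k. k \<in> A \<Longrightarrow> ddw' (\<sigma> k) = ddw k" by auto
  have "of_nat (2 * Suc n) * (\<Sum>k\<in>A. ((z k - z' (\<sigma> k)) * a k) * w k ^ n) = 0" if "n < card A" for n
    using h[of n] that A unfolding reindex sum_distrib_left
    by (simp add: w a da dw algebra_simps sum.distrib sum_subtractf del: of_nat_Suc)
  then have "(\<Sum>k\<in>A. ((z k - z' (\<sigma> k)) * a k) * w k ^ n) = 0" if "n < card A" for n
    using that by (simp del: of_nat_Suc)
  from unique1[OF this] nz have z: "\<And>k. k \<in> A \<Longrightarrow> z' (\<sigma> k) = z k" by auto
  have "of_nat (2 * Suc n) * (\<Sum>k\<in>A. ((dz k - dz' (\<sigma> k)) * a k) * w k ^ n) = 0" if "n < card A" for n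
    using j[of n] that A unfolding reindex sum_distrib_left
    by (simp add: w a da dw dda ddw z algebra_simps sum.distrib sum_subtractf del: of_nat_Suc)
  then have "(\<Sum>k\<in>A. ((dz k - dz' (\<sigma> k)) * a k) * w k ^ n) = 0" if "n < card A" for n
    using that by (simp del: of_nat_Suc)
  from unique1[OF this] nz have dz: "\<And>k. k \<in> A \<Longrightarrow> dz' (\<sigma> k) = dz k" by auto
  show thesis using that[OF \<sigma>] w a z dz by blast
qed

section \<open>Smoothness of the mollifier\<close>

text \<open>
  The ring generated by \<open>1/x\<close> times \<open>exp (-1/x)\<close>, continued by zero. Keeping a whole
  polynomial factor makes the family closed under differentiation.
\<close>

definition flat_exp :: "real poly \<Rightarrow> real \<Rightarrow> real" where
  "flat_exp P x = (if x > 0 then poly P (1 / x) * exp (- (1 / x)) else 0)"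

text \<open>
  In the variable \<open>y = 1/x\<close> this is the decay of a polynomial times \<open>exp (-y)\<close> at infinity.
\<close>

lemma flat_exp_tendsto_0: "(flat_exp P \<longlongrightarrow> 0) (at 0)"
proof -
  have mon: "((\<lambda>y::real. y ^ n * exp (- y)) \<longlongrightarrow> 0) at_top" for n :: nat
    using tendsto_power_div_exp_0[of n] by (simp only: exp_minus divide_inverse)
  have "((\<lambda>y. \<Sum>i\<le>degree P. coeff P i * (y ^ i * exp (- y))) \<longlongrightarrow> (\<Sum>i\<le>degree P. coeff P i * 0)) at_top"
    by (intro tendsto_intros mon)
  then have top: "((\<lambda>y. poly P y * exp (- y)) \<longlongrightarrow> 0) at_top"
    by (simp add: poly_altdef sum_distrib_right mult.assoc)
  have "((\<lambda>x. poly P (inverse x) * exp (- inverse x)) \<longlongrightarrow> 0) (at_right (0::real))"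
    by (rule filterlim_compose[OF top filterlim_inverse_at_top_right])
  then have "(flat_exp P \<longlongrightarrow> 0) (at_right 0)"
    by (rule Lim_transform_eventually)
       (auto simp: flat_exp_def eventually_at_filter field_simps)
  moreover have "(flat_exp P \<longlongrightarrow> 0) (at_left 0)"
    by (rule tendsto_eventually) (auto simp: flat_exp_def eventually_at_filter)
  ultimately show ?thesis by (simp add: filterlim_split_at)
qed

text \<open>
  The chain rule for \<open>P(1/x) exp (-1/x)\<close> gives \<open>x\<^sup>-\<^sup>2 (P - P')(1/x) exp (-1/x)\<close>, again in the
  family. At zero the difference quotient is itself a member of the family, which tends to zero.
\<close>

lemma flat_exp_has_derivative:
  "(flat_exp P has_real_derivative flat_exp ([:0, 0, 1:] * (P - pderiv P)) x) (at x)"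
proof -
  consider "x > 0" | "x < 0" | "x = 0" by linarith
  then show ?thesis
  proof cases
    case 1
    have "((\<lambda>x. poly P (1 / x) * exp (- (1 / x))) has_real_derivative
        flat_exp ([:0, 0, 1:] * (P - pderiv P)) x) (at x)"
      using 1 by (auto intro!: derivative_eq_intros DERIV_chain2[where f = "poly P"] poly_DERIV
          simp: flat_exp_def field_simps power2_eq_square)
    then show ?thesis
      by (rule has_field_derivative_transform_within_open[where S = "{0<..}"])
         (use 1 in \<open>auto simp: flat_exp_def\<close>)
  next
    case 2
    have "((\<lambda>x. 0) has_real_derivative flat_exp ([:0, 0, 1:] * (P - pderiv P)) x) (at x)"
      using 2 by (simp add: flat_exp_def)
    then show ?thesis
      by (rule has_field_derivative_transform_within_open[where S = "{..<0}"])
         (use 2 in \<open>auto simp: flat_exp_def\<close>)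
  next
    case 3
    \<comment> \<open>Dividing by \<open>h\<close> multiplies the polynomial in \<open>1/h\<close> by its variable.\<close>
    have "(\<lambda>h. (flat_exp P (0 + h) - flat_exp P 0) / h) = flat_exp (pCons 0 P)"
      by (auto simp: flat_exp_def fun_eq_iff)
    with flat_exp_tendsto_0[of "pCons 0 P"]
    show ?thesis using 3 by (simp add: DERIV_def flat_exp_def)
  qed
qed

text \<open>
  The functions to which differentiation can lead, starting from \<open>bump s = exp (-1/(1 - s\<^sup>2))\<close>.
\<close>

inductive_set bump_algebra :: "(real \<Rightarrow> real) set" where
  gen: "(\<lambda>s. poly Q s * flat_exp P (1 - s\<^sup>2)) \<in> bump_algebra"
| add: "f \<in> bump_algebra \<Longrightarrow> g \<in> bump_algebra \<Longrightarrow> (\<lambda>s. f s + g s) \<in> bump_algebra"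

lemma bump_algebra_derivative:
  "f \<in> bump_algebra \<Longrightarrow> \<exists>f'\<in>bump_algebra. \<forall>s. (f has_real_derivative f' s) (at s)"
proof (induction rule: bump_algebra.induct)
  case (gen Q P)
  let ?R = "[:0, 0, 1:] * (P - pderiv P)"
  have "((\<lambda>s. flat_exp P (1 - s\<^sup>2)) has_real_derivative flat_exp ?R (1 - s\<^sup>2) * (- (2 * s))) (at s)" for s
    by (rule DERIV_chain2[OF flat_exp_has_derivative]) (auto intro!: derivative_eq_intros)
  then have "((\<lambda>s. poly Q s * flat_exp P (1 - s\<^sup>2)) has_real_derivative
      poly (pderiv Q) s * flat_exp P (1 - s\<^sup>2) + poly ([:0, -2:] * Q) s * flat_exp ?R (1 - s\<^sup>2)) (at s)" for s
    by (auto intro!: derivative_eq_intros poly_DERIV simp: algebra_simps simp del: mult_pCons_left)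
  moreover have "(\<lambda>s. poly (pderiv Q) s * flat_exp P (1 - s\<^sup>2) +
      poly ([:0, -2:] * Q) s * flat_exp ?R (1 - s\<^sup>2)) \<in> bump_algebra"
    by (intro bump_algebra.intros)
  ultimately show ?case by (intro bexI allI)
next
  case (add f g)
  then obtain f' g' where "f' \<in> bump_algebra" "g' \<in> bump_algebra"
    "\<forall>s. (f has_real_derivative f' s) (at s)" "\<forall>s. (g has_real_derivative g' s) (at s)" by blast
  then show ?case
    by (intro bexI[of _ "\<lambda>s. f' s + g' s"]) (auto intro: bump_algebra.add derivative_intros)
qed

lemma bump_in_bump_algebra: "bump \<in> bump_algebra"
proof -
  have "bump = (\<lambda>s. poly 1 s * flat_exp 1 (1 - s\<^sup>2))"
  proof
    fix s :: real
    have "\<bar>s\<bar> < 1 \<longleftrightarrow> 0 < 1 - s\<^sup>2" by (simp add: abs_square_less_1)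
    moreover have "1 / (s\<^sup>2 - 1) = - (1 / (1 - s\<^sup>2))" by (metis minus_diff_eq minus_divide_right)
    ultimately show "bump s = poly 1 s * flat_exp 1 (1 - s\<^sup>2)" by (simp add: bump_def flat_exp_def)
  qed
  then show ?thesis using bump_algebra.gen[of 1 1] by simp
qed

text \<open>
  \<open>bump\<close> lies in a class of differentiable functions closed under taking derivatives.
\<close>

lemma higher_deriv_bump:
  "((deriv ^^ m) bump has_real_derivative (deriv ^^ Suc m) bump s) (at s)"
proof -
  have "(deriv ^^ m) bump \<in> bump_algebra"
  proof (induction m)
    case (Suc m)
    then obtain f' where "f' \<in> bump_algebra" "\<forall>s. ((deriv ^^ m) bump has_real_derivative f' s) (at s)"
      using bump_algebra_derivative by blast
    moreover from this have "deriv ((deriv ^^ m) bump) = f'" by (auto intro: DERIV_imp_deriv)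
    ultimately show ?case by simp
  qed (simp add: bump_in_bump_algebra)
  then obtain f' where "\<forall>s. ((deriv ^^ m) bump has_real_derivative f' s) (at s)"
    using bump_algebra_derivative by blast
  then show ?thesis by (metis DERIV_imp_deriv comp_apply funpow.simps(2))
qed

lemma continuous_on_bump: "continuous_on A bump"
  by (rule DERIV_continuous_on[OF has_field_derivative_at_within])
     (use higher_deriv_bump[of 0] in simp)

lemma bump_nonneg: "bump s \<ge> 0"
  by (simp add: bump_def)

lemma bump_eq_0: "\<bar>s\<bar> \<ge> 1 \<Longrightarrow> bump s = 0"
  by (simp add: bump_def)

lemma bump_integrable: "integrable lborel bump"
proof -
  have "set_integrable lborel {-1..1} bump"
    by (rule borel_integrable_atLeastAtMost') (rule continuous_on_bump)
  moreover have "(\<lambda>x. indicator {-1..1} x *\<^sub>R bump x) = bump"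
    by (auto simp: fun_eq_iff indicator_def bump_def)
  ultimately show ?thesis by (simp add: set_integrable_def)
qed

text \<open>
  The mollifier divides by this integral. On \<open>[-1/2, 1/2]\<close> the bump is at least \<open>exp (-4/3)\<close>.
\<close>

lemma bump_integral_pos: "(\<integral>x. bump x \<partial>lborel) > 0"
proof -
  have hi: "(bump has_integral (\<integral>x. bump x \<partial>lborel)) UNIV"
    by (rule has_integral_integral_lborel) (rule bump_integrable)
  have "((\<lambda>_. exp (- 4 / 3) :: real) has_integral exp (- 4 / 3)) {-1/2..1/2::real}"
    using has_integral_const_real[of "exp (- 4 / 3) :: real" "-1/2" "1/2"] by simp
  moreover have "exp (- 4 / 3 :: real) \<le> bump s" if "s \<in> {-1/2..1/2}" for s
  proof -
    have s: "\<bar>s\<bar> \<le> 1/2" using that unfolding atLeastAtMost_iff by linarith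
    from power_mono[OF s, of 2] have "\<bar>s\<bar>\<^sup>2 \<le> (1/2)\<^sup>2" by simp
    then have "s\<^sup>2 \<le> 1/4" by (simp add: power2_eq_square)
    then have "- 4 / 3 \<le> 1 / (s\<^sup>2 - 1)" by (simp add: divide_simps)
    then show ?thesis using s by (simp add: bump_def)
  qed
  moreover have "(bump has_integral integral {-1/2..1/2} bump) {-1/2..1/2}"
    by (intro integrable_integral integrable_continuous_real continuous_on_bump)
  moreover from this have "integral {-1/2..1/2} bump \<le> (\<integral>x. bump x \<partial>lborel)"
    by (intro has_integral_subset_le[OF _ _ hi]) (auto simp: bump_nonneg)
  ultimately have "exp (- 4 / 3) \<le> (\<integral>x. bump x \<partial>lborel)"
    using has_integral_le order_trans by blast
  then show ?thesis by (smt (verit) exp_gt_zero)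
qed

lemma higher_deriv_mollifier_eq:
  assumes "\<epsilon> > 0"
  shows "(deriv ^^ m) (mollifier \<epsilon>) = (\<lambda>s. (deriv ^^ m) bump (s / \<epsilon>) / (\<epsilon> ^ Suc m * (\<integral>x. bump x \<partial>lborel)))"
proof (induction m)
  case 0
  show ?case by (simp add: fun_eq_iff mollifier_def)
next
  case (Suc m)
  have "((\<lambda>s. (deriv ^^ m) bump (s / \<epsilon>) / (\<epsilon> ^ Suc m * (\<integral>x. bump x \<partial>lborel))) has_real_derivative
      (deriv ^^ Suc m) bump (s / \<epsilon>) / (\<epsilon> ^ Suc (Suc m) * (\<integral>x. bump x \<partial>lborel))) (at s)" for s
    using assms bump_integral_pos
    by (auto intro!: derivative_eq_intros DERIV_chain2[OF higher_deriv_bump] simp: field_simps)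
  then show ?case by (simp add: Suc fun_eq_iff DERIV_imp_deriv)
qed

lemma higher_deriv_mollifier:
  assumes "\<epsilon> > 0"
  shows "((deriv ^^ m) (mollifier \<epsilon>) has_real_derivative (deriv ^^ Suc m) (mollifier \<epsilon>) s) (at s)"
  unfolding higher_deriv_mollifier_eq[OF assms]
  using assms bump_integral_pos
  by (auto intro!: derivative_eq_intros DERIV_chain2[OF higher_deriv_bump] simp: field_simps)

lemma higher_deriv_mollifier_eq_0:
  assumes "\<epsilon> > 0" "\<bar>s\<bar> > \<epsilon>"
  shows "(deriv ^^ m) (mollifier \<epsilon>) s = 0"
  using assms(2)
proof (induction m arbitrary: s)
  case 0
  then show ?case using assms(1) by (simp add: mollifier_def bump_eq_0)
next
  case (Suc m)
  have "open {s::real. \<bar>s\<bar> > \<epsilon>}" by (intro open_Collect_less continuous_intros)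
  then have "((deriv ^^ m) (mollifier \<epsilon>) has_real_derivative 0) (at s)"
    by (intro has_field_derivative_transform_within_open[OF DERIV_const[of 0]])
       (use Suc in auto)
  then show ?case by (simp add: DERIV_imp_deriv)
qed

lemma mollifier_nonneg: "\<epsilon> > 0 \<Longrightarrow> mollifier \<epsilon> s \<ge> 0"
  using bump_integral_pos by (simp add: mollifier_def bump_nonneg)

lemma continuous_on_higher_deriv_mollifier: "\<epsilon> > 0 \<Longrightarrow> continuous_on A ((deriv ^^ m) (mollifier \<epsilon>))"
  by (rule DERIV_continuous_on[OF has_field_derivative_at_within[OF higher_deriv_mollifier]])

lemma mollifier_has_integral_1:
  assumes "\<epsilon> > 0" "a \<le> - \<epsilon>" "\<epsilon> \<le> b"
  shows "(mollifier \<epsilon> has_integral 1) {a..b}"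
proof -
  let ?C = "\<integral>x. bump x \<partial>lborel"
  have scale: "bump \<circ> (\<lambda>x. x / \<epsilon>) = (\<lambda>x. bump (0 + (1 / \<epsilon>) * x))" by auto
  have int: "integrable lborel (\<lambda>x. bump (0 + (1 / \<epsilon>) * x))"
    using assms bump_integrable by (subst lborel_integrable_real_affine_iff) auto
  have "?C = (1 / \<epsilon>) * (\<integral>x. bump (0 + (1 / \<epsilon>) * x) \<partial>lborel)"
    using assms by (subst lborel_integral_real_affine[of "1 / \<epsilon>" _ 0]) auto
  moreover have "((\<lambda>x. bump (0 + (1 / \<epsilon>) * x)) has_integral (\<integral>x. bump (0 + (1 / \<epsilon>) * x) \<partial>lborel)) UNIV"
    using int by (rule has_integral_integral_lborel)
  ultimately have "((\<lambda>x. bump (x / \<epsilon>)) has_integral \<epsilon> * ?C) UNIV"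
    using assms by (simp add: field_simps)
  then have "((\<lambda>x. bump (x / \<epsilon>) * (1 / (\<epsilon> * ?C))) has_integral \<epsilon> * ?C * (1 / (\<epsilon> * ?C))) UNIV"
    by (rule has_integral_mult_left)
  then have "(mollifier \<epsilon> has_integral 1) UNIV"
    using assms bump_integral_pos by (simp add: mollifier_def[abs_def])
  moreover have "(\<lambda>x. if x \<in> {a..b} then mollifier \<epsilon> x else 0) = mollifier \<epsilon>"
  proof
    fix x show "(if x \<in> {a..b} then mollifier \<epsilon> x else 0) = mollifier \<epsilon> x"
      using assms higher_deriv_mollifier_eq_0[of \<epsilon> x 0] by auto
  qed
  ultimately show ?thesis using has_integral_restrict_UNIV[of "{a..b}" "mollifier \<epsilon>" 1] by simp
qed

section \<open>Travelling test waves\<close>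

lemma pd_eq: "(f has_derivative f') (at x) \<Longrightarrow> pd e f x = f' e"
  by (simp add: pd_def frechet_derivative_at[symmetric])

text \<open>
  Smoothness by coinduction: it suffices to exhibit a class of differentiable functions that
  contains \<open>f\<close> and is closed under the partial derivatives.
\<close>

lemma smooth_on_coinduct:
  assumes "f \<in> \<F>" and "\<And>g x. g \<in> \<F> \<Longrightarrow> g differentiable (at x)"
    and "\<And>g e. g \<in> \<F> \<Longrightarrow> e \<in> Basis \<Longrightarrow> pd e g \<in> \<F>"
  shows "smooth_on UNIV f"
proof -
  have "foldr pd es f \<in> \<F>" if "set es \<subseteq> Basis" for es
    using that assms by (induction es) auto
  then show ?thesis using assms(2) by (auto simp: smooth_on_def)
qed

text \<open>
  A common shape for everything obtained from the test functions by differentiation; the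
  profile \<open>E\<close> comes with all its derivatives \<open>E m\<close>, and \<open>w = x + i y\<close> and its conjugate
  are treated as independent variables.
\<close>

definition travelling ::
  "real \<Rightarrow> real \<Rightarrow> (nat \<Rightarrow> real \<Rightarrow> real) \<Rightarrow> nat \<Rightarrow> nat \<Rightarrow> nat \<Rightarrow> nat \<Rightarrow> spacetime \<Rightarrow> complex" where
  "travelling c \<tau> E a b d m = (\<lambda>(t, r).
     p_xy r ^ a * cnj (p_xy r) ^ b * of_real (r $ 3) ^ d * of_real (E m (t - (\<tau> - r $ 3 / c))))"

lemma bounded_linear_p_xy: "bounded_linear p_xy"
  unfolding p_xy_def[abs_def] Complex_eq
  by (intro bounded_linear_add bounded_linear_const_mult
      bounded_linear_compose[OF bounded_linear_of_real] bounded_linear_vec_nth)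

lemma travelling_has_derivative:
  assumes E: "\<And>m s. (E m has_real_derivative E (Suc m) s) (at s)"
  shows "(travelling c \<tau> E a b d m has_derivative (\<lambda>(t, r).
      of_nat a * p_xy r * travelling c \<tau> E (a - 1) b d m x
      + of_nat b * cnj (p_xy r) * travelling c \<tau> E a (b - 1) d m x
      + of_nat d * of_real (r $ 3) * travelling c \<tau> E a b (d - 1) m x
      + of_real (t + r $ 3 / c) * travelling c \<tau> E a b d (Suc m) x)) (at x)"
proof -
  obtain t0 r0 where x: "x = (t0, r0)" by (cases x)
  have Em: "((\<lambda>y. E m (fst y - (\<tau> - snd y $ 3 / c))) has_derivative
      (\<lambda>y. E (Suc m) (t0 - (\<tau> - r0 $ 3 / c)) * (fst y + snd y $ 3 / c))) (at (t0, r0))"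
  proof (rule has_derivative_compose[where f = "\<lambda>y. fst y - (\<tau> - snd y $ 3 / c)" and g = "E m"
        and g' = "(*) (E (Suc m) (t0 - (\<tau> - r0 $ 3 / c)))"])
    show "((\<lambda>y. fst y - (\<tau> - snd y $ 3 / c)) has_derivative (\<lambda>y. fst y + snd y $ 3 / c)) (at (t0, r0))"
      unfolding divide_inverse
      by (rule derivative_eq_intros refl bounded_linear.has_derivative[OF bounded_linear_vec_nth])+ auto
  qed (use E[of m "t0 - (\<tau> - r0 $ 3 / c)"] in \<open>simp add: has_field_derivative_def\<close>)
  show ?thesis
    unfolding travelling_def x case_prod_beta
    by (rule derivative_eq_intros Em refl
        bounded_linear.has_derivative[OF bounded_linear_vec_nth]
        bounded_linear.has_derivative[OF bounded_linear_p_xy]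
        bounded_linear.has_derivative[OF bounded_linear_cnj]
        bounded_linear.has_derivative[OF bounded_linear_of_real])+
       (auto simp: fun_eq_iff algebra_simps)
qed

text \<open>
  Differentiation turns one travelling monomial into a combination of several, so the class
  closed under partial derivatives is their linear span.
\<close>

inductive_set travelling_span :: "real \<Rightarrow> real \<Rightarrow> (nat \<Rightarrow> real \<Rightarrow> real) \<Rightarrow> (spacetime \<Rightarrow> complex) set"
  for c \<tau> E where
  gen: "travelling c \<tau> E a b d m \<in> travelling_span c \<tau> E"
| add: "f \<in> travelling_span c \<tau> E \<Longrightarrow> g \<in> travelling_span c \<tau> E \<Longrightarrow>
    (\<lambda>y. f y + g y) \<in> travelling_span c \<tau> E"
| scale: "f \<in> travelling_span c \<tau> E \<Longrightarrow> (\<lambda>y. \<alpha> * f y) \<in> travelling_span c \<tau> E"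

text \<open>
  The shape of \<open>f\<close>, \<open>g\<close> and \<open>i\<close>: a function harmonic in the plane, carried along the axis.
\<close>

definition harmonic_wave where
  "harmonic_wave c \<tau> E n m = travelling c \<tau> E n 0 0 m"

text \<open>
  The shape of \<open>h\<close> and \<open>j\<close>: the image of \<open>f\<close> (with \<open>m\<close> time derivatives) under the operator
  \<open>z (\<partial>\<^sub>x - i \<partial>\<^sub>y) - (x - i y) \<partial>\<^sub>z\<close>, a combination of rotation generators.
\<close>

definition rotated_wave where
  "rotated_wave c \<tau> E n m = (\<lambda>y. of_nat (2 * n) * travelling c \<tau> E (n - 1) 0 1 m y
     + of_real (- (1 / c)) * travelling c \<tau> E n 1 0 (Suc m) y)"

lemma harmonic_wave_span: "harmonic_wave c \<tau> E n m \<in> travelling_span c \<tau> E"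
  unfolding harmonic_wave_def by (rule travelling_span.gen)

lemma rotated_wave_span: "rotated_wave c \<tau> E n m \<in> travelling_span c \<tau> E"
  unfolding rotated_wave_def by (intro travelling_span.intros)

context
  fixes c \<tau> :: real and E :: "nat \<Rightarrow> real \<Rightarrow> real"
  assumes E: "\<And>m s. (E m has_real_derivative E (Suc m) s) (at s)"
begin

abbreviation (input) "\<T> \<equiv> travelling c \<tau> E"
abbreviation (input) "\<S> \<equiv> travelling_span c \<tau> E"

lemma pd_travelling:
  "pd e (\<T> a b d m) = (\<lambda>y.
      ((of_nat a * p_xy (snd e)) * \<T> (a - 1) b d m y
      + (of_nat b * cnj (p_xy (snd e))) * \<T> a (b - 1) d m y)
      + ((of_nat d * of_real (snd e $ 3)) * \<T> a b (d - 1) m y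
      + of_real (fst e + snd e $ 3 / c) * \<T> a b d (Suc m) y))"
  by (simp add: fun_eq_iff pd_eq[OF travelling_has_derivative[where E = E, OF E]] case_prod_beta)

lemma travelling_span_differentiable: "f \<in> \<S> \<Longrightarrow> f differentiable (at x)"
proof (induction rule: travelling_span.induct)
  case (gen a b d m)
  show ?case using travelling_has_derivative[where E = E, OF E] by (rule differentiableI)
qed (auto intro: derivative_intros)

lemma pd_span_add:
  assumes "f \<in> \<S>" "g \<in> \<S>"
  shows "pd e (\<lambda>y. f y + g y) = (\<lambda>y. pd e f y + pd e g y)"
proof
  fix x
  have "((\<lambda>y. f y + g y) has_derivative (\<lambda>h. frechet_derivative f (at x) h + frechet_derivative g (at x) h)) (at x)"
    using assms[THEN travelling_span_differentiable, of x]
    by (intro has_derivative_add) (simp_all add: frechet_derivative_works[symmetric])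
  then show "pd e (\<lambda>y. f y + g y) x = pd e f x + pd e g x"
    by (subst pd_eq) (auto simp: pd_def)
qed

lemma pd_span_scale:
  assumes "f \<in> \<S>"
  shows "pd e (\<lambda>y. \<alpha> * f y) = (\<lambda>y. \<alpha> * pd e f y)"
proof
  fix x
  have "((\<lambda>y. \<alpha> * f y) has_derivative (\<lambda>h. \<alpha> * frechet_derivative f (at x) h)) (at x)"
    using assms[THEN travelling_span_differentiable, of x]
    by (intro has_derivative_mult_right) (simp add: frechet_derivative_works[symmetric])
  then show "pd e (\<lambda>y. \<alpha> * f y) x = \<alpha> * pd e f x"
    by (subst pd_eq) (auto simp: pd_def)
qed

lemma pd_in_travelling_span: "f \<in> \<S> \<Longrightarrow> pd e f \<in> \<S>"
proof (induction rule: travelling_span.induct)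
  case (gen a b d m)
  show ?case unfolding pd_travelling by (intro travelling_span.intros)
qed (auto simp: pd_span_add pd_span_scale intro: travelling_span.intros)

lemma travelling_span_smooth: "f \<in> \<S> \<Longrightarrow> smooth_on UNIV f"
  by (rule smooth_on_coinduct[of f \<S>])
     (auto intro: travelling_span_differentiable pd_in_travelling_span)

lemma Dt_travelling: "Dt (\<T> a b d m) = \<T> a b d (Suc m)"
  by (simp add: pd_travelling p_xy_def Complex_eq)

lemma Dx1_travelling: "Dx 1 (\<T> a b d m) = (\<lambda>y. of_nat a * \<T> (a - 1) b d m y + of_nat b * \<T> a (b - 1) d m y)"
  by (simp add: pd_travelling p_xy_def Complex_eq axis_def)

lemma Dx2_travelling:
  "Dx 2 (\<T> a b d m) = (\<lambda>y. (\<i> * of_nat a) * \<T> (a - 1) b d m y + (- \<i> * of_nat b) * \<T> a (b - 1) d m y)"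
  by (simp add: pd_travelling p_xy_def Complex_eq axis_def mult_ac)

lemma Dx3_travelling:
  "Dx 3 (\<T> a b d m) = (\<lambda>y. of_nat d * \<T> a b (d - 1) m y + of_real (1 / c) * \<T> a b d (Suc m) y)"
  by (simp add: pd_travelling p_xy_def Complex_eq axis_def)

text \<open>
  In the plane the Laplacian is \<open>4 \<partial>\<^sub>w \<partial>\<^sub>w\<^sub>*\<close>. The second time derivative cancels the part of
  \<open>\<partial>\<^sub>z\<^sup>2\<close> acting on the profile alone, which leaves the terms with at least one derivative of
  the monomial.
\<close>

lemma wave_op_travelling:
  "wave_op c (\<T> a b d m) y = - (of_nat (4 * a * b) * \<T> (a - 1) (b - 1) d m y
     + of_nat (d * (d - 1)) * \<T> a b (d - 2) m y
     + of_real (2 / c) * of_nat d * \<T> a b (d - 1) (Suc m) y)"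
proof -
  have "Dx 1 (Dx 1 (\<T> a b d m)) y + Dx 2 (Dx 2 (\<T> a b d m)) y
      = of_nat (4 * a * b) * \<T> (a - 1) (b - 1) d m y"
    by (simp only: Dx1_travelling Dx2_travelling pd_span_add pd_span_scale travelling_span.intros)
       (simp add: algebra_simps)
  moreover have "Dx 3 (Dx 3 (\<T> a b d m)) y = of_nat (d * (d - 1)) * \<T> a b (d - 2) m y
      + of_real (2 / c) * of_nat d * \<T> a b (d - 1) (Suc m) y
      + of_real (1 / c\<^sup>2) * \<T> a b d (Suc (Suc m)) y"
    by (simp only: Dx3_travelling pd_span_add pd_span_scale travelling_span.intros)
       (cases d, simp_all add: algebra_simps add_divide_distrib power2_eq_square numeral_2_eq_2)
  ultimately show ?thesis
    by (simp add: wave_op_def sum_3 Dt_travelling)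
qed

lemma wave_op_span_add:
  assumes "f \<in> \<S>" "g \<in> \<S>"
  shows "wave_op c (\<lambda>y. f y + g y) y = wave_op c f y + wave_op c g y"
  using assms by (simp add: wave_op_def pd_span_add pd_in_travelling_span sum.distrib algebra_simps)

lemma wave_op_span_scale:
  assumes "f \<in> \<S>"
  shows "wave_op c (\<lambda>y. \<alpha> * f y) y = \<alpha> * wave_op c f y"
  using assms by (simp add: wave_op_def pd_span_scale pd_in_travelling_span sum_distrib_left algebra_simps)

lemma wave_op_harmonic_wave: "wave_op c (harmonic_wave c \<tau> E n m) y = 0"
  unfolding harmonic_wave_def wave_op_travelling by simp

text \<open>
  The wave operator maps the part with the factor \<open>z\<close> to \<open>- 4 n w\<^sup>n\<^sup>-\<^sup>1 E' / c\<close> through the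
  mixed term of \<open>\<partial>\<^sub>z\<^sup>2\<close>, and the part with the conjugate of \<open>w\<close> to the opposite value through
  \<open>4 \<partial>\<^sub>w \<partial>\<^sub>w\<^sub>*\<close>.
\<close>

lemma wave_op_rotated_wave: "wave_op c (rotated_wave c \<tau> E n m) y = 0"
  unfolding rotated_wave_def
  by (simp only: wave_op_span_add wave_op_span_scale travelling_span.intros wave_op_travelling)
     (simp add: algebra_simps)

lemma Dt_harmonic_wave: "Dt (harmonic_wave c \<tau> E n m) = harmonic_wave c \<tau> E n (Suc m)"
  by (simp add: harmonic_wave_def Dt_travelling)

lemma Dt_rotated_wave: "Dt (rotated_wave c \<tau> E n m) = rotated_wave c \<tau> E n (Suc m)"
  by (simp only: rotated_wave_def pd_span_add pd_span_scale travelling_span.intros Dt_travelling)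

end

section \<open>The reciprocity gap identity\<close>

text \<open>
  For a wave with vanishing final data all volume terms of the weak formulation disappear:
  each pairs \<open>u\<close> or its time derivative with a function that is zero on \<open>\<Omega>\<close>, and a
  distribution applied to zero is zero.
\<close>

lemma wave_field_gap_identity:
  assumes wf: "wave_field c T \<Omega> D F u \<phi>" and T: "0 < T" and v: "smooth_on UNIV v"
    and eq: "\<And>y. wave_op c v y = 0"
    and final: "\<And>r. r \<in> \<Omega> \<Longrightarrow> v (T, r) = 0" "\<And>r. r \<in> \<Omega> \<Longrightarrow> Dt v (T, r) = 0"
  shows "RG T \<Omega> \<phi> v = F v"
proof -
  define du where "du t \<psi> = dIcc T (\<lambda>s. u s \<psi>) t" for t \<psi>
  have "\<exists>U W \<kappa>. (\<forall>t\<in>{0..T}. distribution \<Omega> (u t)) \<and> cutoff \<Omega> D \<kappa> \<and>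
      (\<forall>v. smooth_on UNIV v \<longrightarrow>
         of_real (1 / c\<^sup>2) * pairing \<Omega> D \<kappa> (du T) (\<lambda>r. W (T, r)) (\<lambda>r. v (T, r))
         - of_real (1 / c\<^sup>2) * pairing \<Omega> D \<kappa> (u T) (\<lambda>r. U (T, r)) (\<lambda>r. Dt v (T, r))
         - boundary_integral T \<Omega> \<phi> v
         + (\<integral>t. pairing \<Omega> D \<kappa> (u t) (\<lambda>r. U (t, r)) (\<lambda>r. wave_op c v (t, r)) \<partial>lebesgue_on {0..T})
         = F v)"
    using wf unfolding wave_field_def Let_def du_def[abs_def] by blast
  then obtain U W \<kappa> where dist: "\<And>t. t \<in> {0..T} \<Longrightarrow> distribution \<Omega> (u t)" and \<kappa>: "cutoff \<Omega> D \<kappa>"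
    and weak: "\<And>v. smooth_on UNIV v \<Longrightarrow>
         of_real (1 / c\<^sup>2) * pairing \<Omega> D \<kappa> (du T) (\<lambda>r. W (T, r)) (\<lambda>r. v (T, r))
         - of_real (1 / c\<^sup>2) * pairing \<Omega> D \<kappa> (u T) (\<lambda>r. U (T, r)) (\<lambda>r. Dt v (T, r))
         - boundary_integral T \<Omega> \<phi> v
         + (\<integral>t. pairing \<Omega> D \<kappa> (u t) (\<lambda>r. U (t, r)) (\<lambda>r. wave_op c v (t, r)) \<partial>lebesgue_on {0..T})
         = F v"
    by blast
  \<comment> \<open>The cutoff serves as a test function to scale by zero.\<close>
  have u0: "u t (\<lambda>_. 0) = 0" if "t \<in> {0..T}" for t
  proof -
    have "testfun \<Omega> \<kappa>" using \<kappa> by (simp add: cutoff_def)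
    then have "u t (\<lambda>x. 0 * \<kappa> x) = 0 * u t \<kappa>"
      using dist[OF that] unfolding distribution_def by blast
    then show ?thesis by simp
  qed
  have du0: "du T (\<lambda>_. 0) = 0"
  proof -
    have "((\<lambda>s. u s (\<lambda>_. 0)) has_vector_derivative 0) (at T within {0..T})"
      using T u0 by (intro has_vector_derivative_transform[OF _ _ has_vector_derivative_const]) auto
    then show ?thesis
      unfolding du_def dIcc_def using T by (intro vector_derivative_within_closed_interval[of 0 T]) auto
  qed
  have pair0: "pairing \<Omega> D \<kappa> f V w = 0" if "f (\<lambda>_. 0) = 0" "\<And>r. r \<in> \<Omega> \<Longrightarrow> w r = 0" for f V w
  proof -
    have "\<kappa> x * w x = 0" for x
    proof (cases "x \<in> \<Omega>")
      case False
      have "closure {x. \<kappa> x \<noteq> 0} \<subseteq> \<Omega>" using \<kappa> by (simp add: cutoff_def testfun_def)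
      with closure_subset[of "{x. \<kappa> x \<noteq> 0}"] have "{x. \<kappa> x \<noteq> 0} \<subseteq> \<Omega>" by (rule subset_trans)
      then have "\<kappa> x = 0" using False by auto
      then show ?thesis by simp
    qed (simp add: that)
    then have "(\<lambda>x. \<kappa> x * w x) = (\<lambda>_. 0)" by auto
    moreover have "(\<integral>x. V x * ((1 - \<kappa> x) * w x) \<partial>lebesgue_on (\<Omega> - D)) = (\<integral>x. 0 \<partial>lebesgue_on (\<Omega> - D))"
      by (rule Bochner_Integration.integral_cong) (auto simp: that)
    ultimately show ?thesis by (simp add: pairing_def that)
  qed
  have "(\<integral>t. pairing \<Omega> D \<kappa> (u t) (\<lambda>r. U (t, r)) (\<lambda>r. wave_op c v (t, r)) \<partial>lebesgue_on {0..T})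
      = (\<integral>t. 0 \<partial>lebesgue_on {0..T})"
    by (rule Bochner_Integration.integral_cong) (auto intro!: pair0 u0 simp: eq)
  then show ?thesis
    using weak[OF v] T by (simp add: pair0 final du0 u0 RG_def)
qed

definition mollifier_derivs :: "real \<Rightarrow> nat \<Rightarrow> real \<Rightarrow> real" where
  "mollifier_derivs \<epsilon> m = (deriv ^^ m) (mollifier \<epsilon>)"

context
  fixes \<epsilon> :: real
  assumes \<epsilon>: "0 < \<epsilon>"
begin

lemma mollifier_derivs:
  "(mollifier_derivs \<epsilon> m has_real_derivative mollifier_derivs \<epsilon> (Suc m) s) (at s)"
  unfolding mollifier_derivs_def by (rule higher_deriv_mollifier[OF \<epsilon>])

lemma test_f_eq: "test_f c n \<epsilon> \<tau> = harmonic_wave c \<tau> (mollifier_derivs \<epsilon>) n 0"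
  unfolding test_f_def harmonic_wave_def travelling_def mollifier_derivs_def p_xy_def
  by (simp add: fun_eq_iff)

lemma test_g_eq: "test_g c n \<epsilon> \<tau> = (\<lambda>y. - harmonic_wave c \<tau> (mollifier_derivs \<epsilon>) n 1 y)"
  by (simp only: test_g_def test_f_eq Dt_harmonic_wave[where E = "mollifier_derivs \<epsilon>", OF mollifier_derivs] One_nat_def)

lemma test_i_eq: "test_i c n \<epsilon> \<tau> = harmonic_wave c \<tau> (mollifier_derivs \<epsilon>) n 2"
  by (simp only: test_i_def test_f_eq Dt_harmonic_wave[where E = "mollifier_derivs \<epsilon>", OF mollifier_derivs] numeral_2_eq_2)

lemma test_h_eq: "test_h c n \<epsilon> \<tau> = rotated_wave c \<tau> (mollifier_derivs \<epsilon>) n 0"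
proof -
  have "Complex (r $ 1) (- (r $ 2)) = cnj (p_xy r)" for r
    by (simp add: p_xy_def complex_eq_iff)
  then show ?thesis
    unfolding test_h_def test_f_eq harmonic_wave_def rotated_wave_def
    by (simp only: Dx1_travelling[where E = "mollifier_derivs \<epsilon>", OF mollifier_derivs] Dx2_travelling[where E = "mollifier_derivs \<epsilon>", OF mollifier_derivs]
        Dx3_travelling[where E = "mollifier_derivs \<epsilon>", OF mollifier_derivs])
       (auto simp: travelling_def fun_eq_iff algebra_simps)
qed

lemma test_j_eq: "test_j c n \<epsilon> \<tau> = (\<lambda>y. - rotated_wave c \<tau> (mollifier_derivs \<epsilon>) n 1 y)"
  by (simp only: test_j_def test_h_eq Dt_rotated_wave[where E = "mollifier_derivs \<epsilon>", OF mollifier_derivs] One_nat_def)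

text \<open>
  The pulse reaches height \<open>z\<close> at time \<open>\<tau> - z / c\<close>. If this is earlier than \<open>T - \<epsilon>\<close> throughout
  \<open>\<Omega>\<close>, the pulse has left the domain before the final time.
\<close>

lemma RG_test_waves:
  assumes wf: "wave_field c T \<Omega> D F u \<phi>" and T: "0 < T"
    and late: "\<And>r. r \<in> \<Omega> \<Longrightarrow> \<epsilon> < T - (\<tau> - r $ 3 / c)"
    and w: "w \<in> {test_f, test_g, test_h, test_i, test_j}"
  shows "RG T \<Omega> \<phi> (w c n \<epsilon> \<tau>) = F (w c n \<epsilon> \<tau>)"
proof -
  let ?span = "travelling_span c \<tau> (mollifier_derivs \<epsilon>)"
  have travelling0: "travelling c \<tau> (mollifier_derivs \<epsilon>) a b d m (T, r) = 0" if "r \<in> \<Omega>" for a b d m r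
    using higher_deriv_mollifier_eq_0[OF \<epsilon>, of "T - (\<tau> - r $ 3 / c)" m] late[OF that] \<epsilon>
    by (simp add: travelling_def mollifier_derivs_def)
  have span0: "v (T, r) = 0" if "v \<in> ?span" "r \<in> \<Omega>" for v r
    using that(1) by (induction rule: travelling_span.induct) (auto simp: travelling0 that(2))
  \<comment> \<open>The functions \<open>g\<close> and \<open>j\<close> carry a minus sign.\<close>
  have uminus: "(\<lambda>y. - v y) \<in> ?span" if "v \<in> ?span" for v
    using travelling_span.scale[OF that, of "- 1"] by simp
  have span: "w c n \<epsilon> \<tau> \<in> ?span"
    using w by (elim insertE emptyE; simp only: test_f_eq test_g_eq test_h_eq test_i_eq test_j_eq
        uminus harmonic_wave_span rotated_wave_span)
  have wave_uminus: "wave_op c (\<lambda>y. - v y) y = - wave_op c v y" if "v \<in> ?span" for v y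
    using wave_op_span_scale[where E = "mollifier_derivs \<epsilon>", OF mollifier_derivs that, of "- 1"] by simp
  have "wave_op c (w c n \<epsilon> \<tau>) y = 0" for y
    using w by (elim insertE emptyE; simp only: test_f_eq test_g_eq test_h_eq test_i_eq test_j_eq
        wave_uminus harmonic_wave_span rotated_wave_span
        wave_op_harmonic_wave[where E = "mollifier_derivs \<epsilon>", OF mollifier_derivs]
        wave_op_rotated_wave[where E = "mollifier_derivs \<epsilon>", OF mollifier_derivs] minus_zero)
  then show ?thesis
    using wave_field_gap_identity[OF wf T travelling_span_smooth[where E = "mollifier_derivs \<epsilon>", OF mollifier_derivs span]]
      span0 span pd_in_travelling_span[where E = "mollifier_derivs \<epsilon>", OF mollifier_derivs span] by blast
qed

end

section \<open>Calculus on a closed time interval\<close>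

lemma dIcc_eqI:
  assumes "0 < T" "t \<in> {0..T}" "(f has_vector_derivative d) (at t within {0..T})"
  shows "dIcc T f t = d"
proof -
  have "at t within {0..T} \<noteq> bot" using assms by (simp add: trivial_limit_within islimpt_Icc)
  then show ?thesis
    unfolding dIcc_def using assms(3) by (rule vector_derivative_within)
qed

lemma dIcc_has_vector_derivative:
  assumes "f differentiable_on {0..T}" "t \<in> {0..T}"
  shows "(f has_vector_derivative dIcc T f t) (at t within {0..T})"
  using assms unfolding dIcc_def differentiable_on_def by (simp add: vector_derivative_works)

text \<open>
  Derivatives relative to the closed interval only see values on that interval. This is what
  allows rewriting under \<open>dIcc\<close>, since the functions at hand are unrestricted outside.
\<close>

lemma dIcc_cong:
  assumes "\<And>s. s \<in> {0..T} \<Longrightarrow> f s = g s" "t \<in> {0..T}"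
  shows "dIcc T f t = dIcc T g t"
proof -
  have "(f has_vector_derivative d) (at t within {0..T}) \<longleftrightarrow> (g has_vector_derivative d) (at t within {0..T})" for d
    using assms has_vector_derivative_transform[of t "{0..T}" f g d]
      has_vector_derivative_transform[of t "{0..T}" g f d] by auto
  then show ?thesis by (simp add: dIcc_def vector_derivative_def)
qed

lemma Ck_Icc_0: "Ck_Icc 0 T f \<longleftrightarrow> continuous_on {0..T} f"
  by (simp add: Ck_Icc_def)

text \<open>
  The recursive form of the definition, on which all inductions below rest.
\<close>

lemma Ck_Icc_Suc: "Ck_Icc (Suc k) T f \<longleftrightarrow> f differentiable_on {0..T} \<and> Ck_Icc k T (dIcc T f)"
proof -
  have shift: "(dIcc T ^^ j) (dIcc T f) = (dIcc T ^^ Suc j) f" for j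
    by (simp add: funpow_swap1)
  have less: "(\<forall>j<Suc k. P j) \<longleftrightarrow> P 0 \<and> (\<forall>j<k. P (Suc j))" for P
    by (auto simp: less_Suc_eq_0_disj)
  have le: "(\<forall>j\<le>Suc k. P j) \<longleftrightarrow> P 0 \<and> (\<forall>j\<le>k. P (Suc j))" for P
    by (metis Suc_le_mono le0 not0_implies_Suc)
  show ?thesis
    unfolding Ck_Icc_def less le shift
    by (auto dest: differentiable_imp_continuous_on)
qed

lemma Ck_Icc_cong:
  assumes "\<And>t. t \<in> {0..T} \<Longrightarrow> f t = g t"
  shows "Ck_Icc k T f \<longleftrightarrow> Ck_Icc k T g"
  using assms
proof (induction k arbitrary: f g)
  case 0
  then show ?case unfolding Ck_Icc_0 by (intro continuous_on_cong) auto
next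
  case (Suc k)
  have "Ck_Icc k T (dIcc T f) \<longleftrightarrow> Ck_Icc k T (dIcc T g)"
    by (rule Suc.IH) (rule dIcc_cong, use Suc.prems in auto)
  moreover have "f differentiable_on {0..T} \<longleftrightarrow> g differentiable_on {0..T}"
    unfolding differentiable_on_def differentiable_def
    using has_derivative_transform[of _ "{0..T}" f g] has_derivative_transform[of _ "{0..T}" g f] Suc.prems
    by metis
  ultimately show ?case by (simp add: Ck_Icc_Suc)
qed

text \<open>
  Any function that is a derivative on the interval may be used in place of \<open>dIcc\<close>, so the
  explicit formulas of the product and chain rules can be plugged in.
\<close>

lemma Ck_Icc_SucI:
  assumes "0 < T" and deriv: "\<And>t. t \<in> {0..T} \<Longrightarrow> (f has_vector_derivative f' t) (at t within {0..T})"
    and "Ck_Icc k T f'"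
  shows "Ck_Icc (Suc k) T f"
proof -
  have "Ck_Icc k T (dIcc T f)"
    using assms by (subst Ck_Icc_cong[of T _ f']) (auto intro!: dIcc_eqI)
  moreover have "f differentiable_on {0..T}"
    using deriv unfolding differentiable_on_def has_vector_derivative_def differentiable_def by blast
  ultimately show ?thesis by (simp add: Ck_Icc_Suc)
qed

lemma Ck_Icc_SucD:
  assumes "Ck_Icc (Suc k) T f"
  shows "f differentiable_on {0..T}" "Ck_Icc k T (dIcc T f)"
    "t \<in> {0..T} \<Longrightarrow> (f has_vector_derivative dIcc T f t) (at t within {0..T})"
  using assms dIcc_has_vector_derivative by (auto simp: Ck_Icc_Suc)

lemma Ck_Icc_mono: "Ck_Icc k T f \<Longrightarrow> j \<le> k \<Longrightarrow> Ck_Icc j T f"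
  by (auto simp: Ck_Icc_def)

lemma Ck_Icc_continuous: "Ck_Icc k T f \<Longrightarrow> continuous_on {0..T} f"
  using Ck_Icc_mono[of k T f 0] by (simp add: Ck_Icc_0)

lemma Ck_Icc_const: "0 < T \<Longrightarrow> Ck_Icc k T (\<lambda>_. a)"
proof (induction k arbitrary: a)
  case (Suc k)
  then show ?case by (intro Ck_Icc_SucI[where f' = "\<lambda>_. 0"]) auto
qed (simp add: Ck_Icc_0)

lemma Ck_Icc_add:
  assumes "0 < T" "Ck_Icc k T f" "Ck_Icc k T g"
  shows "Ck_Icc k T (\<lambda>t. f t + g t)"
  using assms(2,3)
proof (induction k arbitrary: f g)
  case 0
  then show ?case by (simp add: Ck_Icc_0 continuous_on_add)
next
  case (Suc k)
  then show ?case
    by (intro Ck_Icc_SucI[where f' = "\<lambda>t. dIcc T f t + dIcc T g t", OF assms(1)])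
       (auto intro!: has_vector_derivative_add dest: Ck_Icc_SucD)
qed

lemma Ck_Icc_mult:
  fixes f g :: "real \<Rightarrow> 'a::real_normed_algebra"
  assumes "0 < T" "Ck_Icc k T f" "Ck_Icc k T g"
  shows "Ck_Icc k T (\<lambda>t. f t * g t)"
  using assms(2,3)
proof (induction k arbitrary: f g)
  case 0
  then show ?case by (simp add: Ck_Icc_0 continuous_on_mult)
next
  case (Suc k)
  have "Ck_Icc k T (\<lambda>t. f t * dIcc T g t + dIcc T f t * g t)"
    using Suc.prems
    by (intro Ck_Icc_add assms(1) Suc.IH) (auto dest: Ck_Icc_SucD intro: Ck_Icc_mono[of "Suc k"])
  then show ?case
    using Suc.prems
    by (intro Ck_Icc_SucI[where f' = "\<lambda>t. f t * dIcc T g t + dIcc T f t * g t", OF assms(1)])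
       (auto intro!: has_vector_derivative_mult dest: Ck_Icc_SucD)
qed

lemma Ck_Icc_power:
  fixes f :: "real \<Rightarrow> 'a::real_normed_algebra_1"
  assumes "0 < T" "Ck_Icc k T f"
  shows "Ck_Icc k T (\<lambda>t. f t ^ n)"
  by (induction n) (auto intro!: Ck_Icc_const Ck_Icc_mult assms)

lemma Ck_Icc_bounded_linear:
  assumes "0 < T" "bounded_linear h" "Ck_Icc k T f"
  shows "Ck_Icc k T (\<lambda>t. h (f t))"
  using assms(3)
proof (induction k arbitrary: f)
  case 0
  then show ?case
    using bounded_linear.continuous_on[OF assms(2)] by (simp add: Ck_Icc_0)
next
  case (Suc k)
  then show ?case
    by (intro Ck_Icc_SucI[where f' = "\<lambda>t. h (dIcc T f t)", OF assms(1)])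
       (auto intro!: bounded_linear.has_vector_derivative[OF assms(2)] dest: Ck_Icc_SucD)
qed

lemma Ck_Icc_inverse:
  fixes f :: "real \<Rightarrow> real"
  assumes "0 < T" "Ck_Icc k T f" and nz: "\<And>t. t \<in> {0..T} \<Longrightarrow> f t \<noteq> 0"
  shows "Ck_Icc k T (\<lambda>t. inverse (f t))"
  using assms(2)
proof (induction k)
  case 0
  then show ?case using nz by (simp add: Ck_Icc_0 continuous_on_inverse)
next
  case (Suc k)
  have "Ck_Icc k T (\<lambda>t. (- 1 * dIcc T f t) * (inverse (f t) * inverse (f t)))"
    using Suc Suc.prems[THEN Ck_Icc_mono, of k] Ck_Icc_SucD(2)[OF Suc.prems]
    by (intro Ck_Icc_mult Ck_Icc_const assms(1)) auto
  moreover have "((\<lambda>t. inverse (f t)) has_vector_derivative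
      (- 1 * dIcc T f t) * (inverse (f t) * inverse (f t))) (at t within {0..T})" if t: "t \<in> {0..T}" for t
    using DERIV_inverse_fun[of f "dIcc T f t" t "{0..T}"] Ck_Icc_SucD(3)[OF Suc.prems t] nz[OF t]
    by (simp add: has_real_derivative_iff_has_vector_derivative power2_eq_square mult_ac)
  ultimately show ?case by (intro Ck_Icc_SucI[OF assms(1)])
qed

section \<open>Retarded time along one trajectory\<close>

text \<open>
  A source below the wave speed. Its wave emitted at time \<open>t\<close> belongs to the front
  \<open>t + z / c = arrival t\<close>, and the retarded time inverts \<open>arrival\<close>.
\<close>

locale moving_point =
  fixes c T :: real and p :: "real \<Rightarrow> real^3"
  assumes c_pos: "0 < c" and T_pos: "0 < T" and Ck_p: "Ck_Icc 6 T p"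
    and subsonic: "\<And>t. t \<in> {0..T} \<Longrightarrow> norm (dIcc T p t) < c"
begin

definition arrival :: "real \<Rightarrow> real" where
  "arrival t = t + p t $ 3 / c"

text \<open>
  The derivative of emission time with respect to arrival time.
\<close>

definition doppler :: "real \<Rightarrow> real" where
  "doppler t = inverse (1 + dIcc T p t $ 3 / c)"

text \<open>
  Differentiation with respect to arrival time, written as a derivation on functions of emission
  time. The calculus thus stays on the fixed interval \<open>[0, T]\<close> and never differentiates the
  retarded time.
\<close>

definition ret_deriv :: "(real \<Rightarrow> complex) \<Rightarrow> real \<Rightarrow> complex" where
  "ret_deriv H t = of_real (doppler t) * dIcc T H t"

lemma p_has_derivative: "t \<in> {0..T} \<Longrightarrow> (p has_vector_derivative dIcc T p t) (at t within {0..T})"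
  by (rule Ck_Icc_SucD(3)[of 5]) (use Ck_p in \<open>simp add: eval_nat_numeral\<close>)

lemma slope_pos:
  assumes "t \<in> {0..T}" shows "0 < 1 + dIcc T p t $ 3 / c"
proof -
  have "\<bar>dIcc T p t $ 3\<bar> < c"
    using component_le_norm_cart[of "dIcc T p t" 3] subsonic[OF assms] by linarith
  then show ?thesis using c_pos by (simp add: field_simps)
qed

lemma doppler_pos: "t \<in> {0..T} \<Longrightarrow> 0 < doppler t"
  using slope_pos by (simp add: doppler_def)

lemma arrival_has_derivative:
  assumes "t \<in> {0..T}"
  shows "(arrival has_real_derivative inverse (doppler t)) (at t within {0..T})"
proof -
  have "((\<lambda>t. t + p t $ 3 / c) has_vector_derivative 1 + dIcc T p t $ 3 / c) (at t within {0..T})"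
    using p_has_derivative[OF assms]
    by (intro has_vector_derivative_add has_vector_derivative_id has_vector_derivative_divide
        bounded_linear.has_vector_derivative[OF bounded_linear_vec_nth])
  then show ?thesis
    by (simp add: arrival_def[abs_def] doppler_def has_real_derivative_iff_has_vector_derivative)
qed

lemma continuous_on_arrival: "continuous_on {0..T} arrival"
  using arrival_has_derivative by (rule DERIV_continuous_on)

lemma arrival_strict_mono:
  assumes "0 \<le> s" "s < t" "t \<le> T"
  shows "arrival s < arrival t"
proof (rule DERIV_pos_imp_increasing_open[OF assms(2)])
  fix x assume x: "s < x" "x < t"
  then have "(arrival has_real_derivative inverse (doppler x)) (at x)"
    using arrival_has_derivative[of x] assms by (simp add: at_within_Icc_at)
  then show "\<exists>y. (arrival has_real_derivative y) (at x) \<and> 0 < y"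
    using doppler_pos[of x] x assms by auto
qed (use assms in \<open>auto intro: continuous_on_subset[OF continuous_on_arrival]\<close>)

lemma arrival_le_iff:
  assumes "s \<in> {0..T}" "t \<in> {0..T}"
  shows "arrival s \<le> arrival t \<longleftrightarrow> s \<le> t"
  using arrival_strict_mono[of s t] arrival_strict_mono[of t s] assms by force

lemma arrival_image: "arrival ` {0..T} = {arrival 0..arrival T}"
proof
  show "arrival ` {0..T} \<subseteq> {arrival 0..arrival T}"
    using T_pos by (auto simp: arrival_le_iff)
  show "{arrival 0..arrival T} \<subseteq> arrival ` {0..T}"
    using IVT'[of arrival 0 _ T] T_pos continuous_on_arrival by force
qed

abbreviation rt :: "real \<Rightarrow> real" where
  "rt \<equiv> retarded_time c T p"

lemma rt_arrival:
  assumes "t \<in> {0..T}" shows "rt (arrival t) = t"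
  unfolding retarded_time_def
proof (rule the_equality)
  show "t \<in> {0..T} \<and> t - arrival t + p t $ 3 / c = 0"
    using assms by (simp add: arrival_def)
  fix s assume s: "s \<in> {0..T} \<and> s - arrival t + p s $ 3 / c = 0"
  then have "arrival s = arrival t" by (simp add: arrival_def)
  then show "s = t" using s assms arrival_le_iff[of s t] arrival_le_iff[of t s] by simp
qed

lemma rt_props:
  assumes "\<tau> \<in> {arrival 0..arrival T}"
  shows "rt \<tau> \<in> {0..T}" "arrival (rt \<tau>) = \<tau>"
  using assms unfolding arrival_image[symmetric] by (auto simp: rt_arrival)

text \<open>
  The inverse of a continuous injection on a compact interval is continuous.
\<close>

lemma continuous_on_rt: "continuous_on {arrival 0..arrival T} rt"
  unfolding arrival_image[symmetric]
  by (intro continuous_on_inv continuous_on_arrival compact_Icc) (auto simp: rt_arrival)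

lemma Ck_doppler: "Ck_Icc 5 T doppler"
proof -
  have "Ck_Icc 5 T (dIcc T p)" using Ck_p by (intro Ck_Icc_SucD(2)) (simp add: eval_nat_numeral)
  then have "Ck_Icc 5 T (\<lambda>t. 1 + inverse c * dIcc T p t $ 3)"
    by (intro Ck_Icc_add Ck_Icc_const Ck_Icc_mult T_pos Ck_Icc_bounded_linear[OF _ bounded_linear_vec_nth])
  then have "Ck_Icc 5 T (\<lambda>t. 1 + dIcc T p t $ 3 / c)" by (simp add: field_simps)
  then show ?thesis
    unfolding doppler_def[abs_def] by (rule Ck_Icc_inverse[OF T_pos]) (use slope_pos in force)
qed

lemma Ck_ret_deriv:
  assumes "Ck_Icc (Suc k) T H" "k \<le> 5"
  shows "Ck_Icc k T (ret_deriv H)"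
  unfolding ret_deriv_def[abs_def]
  using assms by (intro Ck_Icc_mult T_pos Ck_Icc_bounded_linear[OF _ bounded_linear_of_real]
      Ck_Icc_mono[OF Ck_doppler] Ck_Icc_SucD(2))

lemma continuous_on_pulse:
  assumes "0 < \<epsilon>" "continuous_on {0..T} G"
  shows "continuous_on {0..T} (\<lambda>t. G t * complex_of_real (mollifier_derivs \<epsilon> m (arrival t - \<tau>)))"
proof -
  have "continuous_on UNIV (mollifier_derivs \<epsilon> m)"
    unfolding mollifier_derivs_def[abs_def] by (rule continuous_on_higher_deriv_mollifier[OF assms(1)])
  then have "continuous_on {0..T} (\<lambda>t. mollifier_derivs \<epsilon> m (arrival t - \<tau>))"
    by (rule continuous_on_compose2) (auto intro!: continuous_intros continuous_on_arrival)
  then show ?thesis by (intro continuous_intros assms(2))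
qed

lemma continuous_on_slope: "continuous_on {0..T} (\<lambda>t. inverse (doppler t))"
  using Ck_Icc_continuous[OF Ck_doppler] doppler_pos by (intro continuous_on_inverse) force+

lemma pulse_has_integral_1:
  assumes \<epsilon>: "0 < \<epsilon>" "arrival 0 \<le> \<tau> - \<epsilon>" "\<tau> + \<epsilon> \<le> arrival T"
  shows "((\<lambda>t. inverse (doppler t) * mollifier \<epsilon> (arrival t - \<tau>)) has_integral 1) {0..T}"
proof -
  have "((\<lambda>t. inverse (doppler t) *\<^sub>R mollifier \<epsilon> (arrival t - \<tau>)) has_integral
      integral {arrival 0 - \<tau>..arrival T - \<tau>} (mollifier \<epsilon>)) {0..T}"
  proof (rule has_integral_substitution[where c = "arrival 0 - \<tau>" and d = "arrival T - \<tau>"])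
    show "((\<lambda>t. arrival t - \<tau>) has_real_derivative inverse (doppler t)) (at t within {0..T})"
      if "t \<in> {0..T}" for t
      using DERIV_diff[OF arrival_has_derivative[OF that] DERIV_const] by simp
    show "(\<lambda>t. arrival t - \<tau>) ` {0..T} \<subseteq> {arrival 0 - \<tau>..arrival T - \<tau>}"
      using arrival_image by auto
    show "continuous_on {arrival 0 - \<tau>..arrival T - \<tau>} (mollifier \<epsilon>)"
      using continuous_on_higher_deriv_mollifier[OF \<epsilon>(1), of _ 0] by simp
  qed (use T_pos arrival_le_iff[of 0 T] in auto)
  moreover have "integral {arrival 0 - \<tau>..arrival T - \<tau>} (mollifier \<epsilon>) = 1"
    by (rule integral_unique) (rule mollifier_has_integral_1, use \<epsilon> in auto)
  ultimately show ?thesis by simp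
qed

text \<open>
  The weight \<open>inverse (doppler t)\<close> is the Jacobian of \<open>arrival\<close>, so this is the mollification of
  \<open>H\<close> in arrival time, with the pulse differentiated \<open>m\<close> times.
\<close>

definition pulse_integral :: "(real \<Rightarrow> complex) \<Rightarrow> nat \<Rightarrow> real \<Rightarrow> real \<Rightarrow> complex" where
  "pulse_integral H m \<tau> \<epsilon> = integral {0..T}
     (\<lambda>t. of_real (inverse (doppler t)) * H t * of_real (mollifier_derivs \<epsilon> m (arrival t - \<tau>)))"

text \<open>
  In arrival time the kernel is a nonnegative function of integral one concentrated within
  \<open>\<epsilon>\<close> of \<open>\<tau>\<close>, and \<open>H\<close> is continuous there.
\<close>

lemma pulse_integral_0_tendsto:
  assumes H: "continuous_on {0..T} H" and \<tau>: "arrival 0 < \<tau>" "\<tau> < arrival T"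
  shows "(pulse_integral H 0 \<tau> \<longlongrightarrow> H (rt \<tau>)) (at_right 0)"
proof (rule tendstoI)
  fix e :: real assume "0 < e"
  have \<tau>I: "\<tau> \<in> {arrival 0..arrival T}" using \<tau> by simp
  have "continuous_on {arrival 0..arrival T} (\<lambda>s. H (rt s))"
    by (rule continuous_on_compose2[OF H continuous_on_rt]) (use rt_props in auto)
  then obtain d where d: "0 < d"
    "\<And>s. s \<in> {arrival 0..arrival T} \<Longrightarrow> dist s \<tau> < d \<Longrightarrow> dist (H (rt s)) (H (rt \<tau>)) < e / 2"
    using \<tau>I \<open>0 < e\<close> unfolding continuous_on_iff by (metis half_gt_zero)
  \<comment> \<open>The pulse must fit into the range of arrival times, where its integral is one.\<close>
  define \<epsilon>0 where "\<epsilon>0 = Min {d, \<tau> - arrival 0, arrival T - \<tau>}"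
  have "\<epsilon>0 > 0" using d \<tau> by (simp add: \<epsilon>0_def)
  have "dist (pulse_integral H 0 \<tau> \<epsilon>) (H (rt \<tau>)) < e" if \<epsilon>: "0 < \<epsilon>" "\<epsilon> < \<epsilon>0" for \<epsilon>
  proof -
    have \<epsilon>': "\<epsilon> < d" "arrival 0 \<le> \<tau> - \<epsilon>" "\<tau> + \<epsilon> \<le> arrival T" using \<epsilon> by (auto simp: \<epsilon>0_def)
    define k where "k t = inverse (doppler t) * mollifier \<epsilon> (arrival t - \<tau>)" for t
    have k1: "(k has_integral 1) {0..T}"
      using pulse_has_integral_1[OF \<epsilon>(1) \<epsilon>'(2,3)] by (simp add: k_def[abs_def])
    have k_nonneg: "0 \<le> k t" if "t \<in> {0..T}" for t
      using doppler_pos[OF that] mollifier_nonneg[OF \<epsilon>(1)] by (simp add: k_def)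
    have "((\<lambda>t. of_real (k t)) has_integral (1::complex)) {0..T}"
      using has_integral_linear[OF k1 bounded_linear_of_real] by (simp add: o_def)
    then have const: "((\<lambda>t. of_real (k t) * H (rt \<tau>)) has_integral 1 * H (rt \<tau>)) {0..T}"
      by (rule has_integral_mult_left)
    have "continuous_on {0..T} (\<lambda>t. of_real (inverse (doppler t)) * H t *
        complex_of_real (mollifier_derivs \<epsilon> 0 (arrival t - \<tau>)))"
      by (intro continuous_on_pulse \<epsilon>(1) continuous_intros H continuous_on_slope)
    then have "(\<lambda>t. of_real (k t) * H t) integrable_on {0..T}"
      by (intro integrable_continuous_real) (simp add: k_def mollifier_derivs_def mult_ac)
    then have "((\<lambda>t. of_real (k t) * H t) has_integral pulse_integral H 0 \<tau> \<epsilon>) {0..T}"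
      by (simp add: pulse_integral_def k_def mollifier_derivs_def mult_ac has_integral_integral)
    from has_integral_diff[OF this const]
    have diff: "((\<lambda>t. of_real (k t) * (H t - H (rt \<tau>))) has_integral
        pulse_integral H 0 \<tau> \<epsilon> - H (rt \<tau>)) {0..T}"
      by (simp add: algebra_simps)
    have bound: "norm (of_real (k t) * (H t - H (rt \<tau>))) \<le> k t * (e / 2)" if t: "t \<in> {0..T}" for t
    proof (cases "\<bar>arrival t - \<tau>\<bar> > \<epsilon>")
      case True
      then have "k t = 0"
        using higher_deriv_mollifier_eq_0[OF \<epsilon>(1), of _ 0] by (simp add: k_def)
      then show ?thesis by simp
    next
      case False
      then have "dist (arrival t) \<tau> < d" using \<epsilon>'(1) by (simp add: dist_real_def)
      moreover have "arrival t \<in> {arrival 0..arrival T}" using arrival_image t by blast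
      ultimately have "dist (H (rt (arrival t))) (H (rt \<tau>)) < e / 2" using d(2) by blast
      then have "norm (H t - H (rt \<tau>)) \<le> e / 2" using t by (simp add: rt_arrival dist_norm)
      then show ?thesis
        using k_nonneg[OF t] mult_left_mono[of "norm (H t - H (rt \<tau>))" "e / 2" "k t"]
        by (simp add: norm_mult)
    qed
    have "norm (pulse_integral H 0 \<tau> \<epsilon> - H (rt \<tau>)) \<le> integral {0..T} (\<lambda>t. k t * (e / 2))"
      unfolding integral_unique[OF diff, symmetric]
      using has_integral_integrable[OF diff] has_integral_integrable[OF has_integral_mult_left[OF k1]]
      by (rule integral_norm_bound_integral) (rule bound)
    also have "\<dots> = e / 2"
      using integral_unique[OF has_integral_mult_left[OF k1, of "e / 2"]] by simp
    finally show ?thesis using \<open>0 < e\<close> by (simp add: dist_norm)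
  qed
  then show "\<forall>\<^sub>F \<epsilon> in at_right 0. dist (pulse_integral H 0 \<tau> \<epsilon>) (H (rt \<tau>)) < e"
    using \<open>\<epsilon>0 > 0\<close> by (auto simp: eventually_at_right intro!: exI[of _ \<epsilon>0])
qed

text \<open>
  The pulse vanishes at both ends of the time interval, as the fronts through the initial and
  final positions of the source are at a distance of more than \<open>\<epsilon>\<close> from \<open>\<tau>\<close>.
\<close>

lemma pulse_integral_by_parts:
  assumes H: "Ck_Icc (Suc 0) T H" and \<epsilon>: "0 < \<epsilon>" "arrival 0 < \<tau> - \<epsilon>" "\<tau> + \<epsilon> < arrival T"
  shows "pulse_integral H (Suc m) \<tau> \<epsilon> = - pulse_integral (ret_deriv H) m \<tau> \<epsilon>"
proof -
  let ?\<eta> = "\<lambda>m t. complex_of_real (mollifier_derivs \<epsilon> m (arrival t - \<tau>))"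
  have \<eta>: "(?\<eta> m has_vector_derivative of_real (inverse (doppler t)) * ?\<eta> (Suc m) t) (at t within {0..T})"
    if t: "t \<in> {0..T}" for t
  proof -
    have "((\<lambda>t. mollifier_derivs \<epsilon> m (arrival t - \<tau>)) has_real_derivative
        mollifier_derivs \<epsilon> (Suc m) (arrival t - \<tau>) * inverse (doppler t)) (at t within {0..T})"
      using DERIV_diff[OF arrival_has_derivative[OF t] DERIV_const]
      by (intro DERIV_chain2[OF mollifier_derivs[OF \<epsilon>(1)]]) simp
    from has_vector_derivative_of_real[OF this] show ?thesis
      by (simp only: of_real_mult mult.commute)
  qed
  have H': "(H has_vector_derivative dIcc T H t) (at t within {0..T})" if "t \<in> {0..T}" for t
    using Ck_Icc_SucD(3)[of 0 T H t] H that by simp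
  have "((\<lambda>t. H t * (of_real (inverse (doppler t)) * ?\<eta> (Suc m) t) + dIcc T H t * ?\<eta> m t) has_integral
      H T * ?\<eta> m T - H 0 * ?\<eta> m 0) {0..T}"
    using T_pos
    by (intro fundamental_theorem_of_calculus[where f = "\<lambda>t. H t * ?\<eta> m t"] has_vector_derivative_mult H' \<eta>) auto
  moreover have "?\<eta> m T = 0" "?\<eta> m 0 = 0"
    using \<epsilon> higher_deriv_mollifier_eq_0[OF \<epsilon>(1)] by (auto simp: mollifier_derivs_def)
  ultimately have sum0: "((\<lambda>t. of_real (inverse (doppler t)) * H t * ?\<eta> (Suc m) t + dIcc T H t * ?\<eta> m t)
      has_integral 0) {0..T}"
    by (simp add: mult_ac)
  have "continuous_on {0..T} (ret_deriv H)"
    using Ck_ret_deriv[of 0 H] H by (simp add: Ck_Icc_0)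
  then have "continuous_on {0..T} (\<lambda>t. of_real (inverse (doppler t)) * ret_deriv H t * ?\<eta> m t)"
    by (intro continuous_on_pulse \<epsilon>(1) continuous_intros continuous_on_slope)
  then have "((\<lambda>t. of_real (inverse (doppler t)) * ret_deriv H t * ?\<eta> m t) has_integral
      pulse_integral (ret_deriv H) m \<tau> \<epsilon>) {0..T}"
    unfolding pulse_integral_def by (intro integrable_integral integrable_continuous_real)
  then have "((\<lambda>t. dIcc T H t * ?\<eta> m t) has_integral pulse_integral (ret_deriv H) m \<tau> \<epsilon>) {0..T}"
    by (rule has_integral_eq[rotated]) (use doppler_pos in \<open>force simp: ret_deriv_def\<close>)
  from has_integral_diff[OF sum0 this]
  have "((\<lambda>t. of_real (inverse (doppler t)) * H t * ?\<eta> (Suc m) t) has_integral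
      - pulse_integral (ret_deriv H) m \<tau> \<epsilon>) {0..T}"
    by simp
  then show ?thesis unfolding pulse_integral_def by (rule integral_unique)
qed

lemma pulse_integral_tendsto:
  assumes "Ck_Icc m T H" "m \<le> 5" and \<tau>: "arrival 0 < \<tau>" "\<tau> < arrival T"
  shows "(pulse_integral H m \<tau> \<longlongrightarrow> (- 1) ^ m * (ret_deriv ^^ m) H (rt \<tau>)) (at_right 0)"
  using assms(1,2)
proof (induction m arbitrary: H)
  case 0
  then show ?case using pulse_integral_0_tendsto[OF _ \<tau>] by (simp add: Ck_Icc_0)
next
  case (Suc m)
  have "(pulse_integral (ret_deriv H) m \<tau> \<longlongrightarrow> (- 1) ^ m * (ret_deriv ^^ m) (ret_deriv H) (rt \<tau>)) (at_right 0)"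
    using Suc by (intro Suc.IH Ck_ret_deriv) auto
  then have "((\<lambda>\<epsilon>. - pulse_integral (ret_deriv H) m \<tau> \<epsilon>) \<longlongrightarrow>
      (- 1) ^ Suc m * (ret_deriv ^^ Suc m) H (rt \<tau>)) (at_right 0)"
    unfolding funpow_Suc_right comp_apply using tendsto_minus by fastforce
  moreover have "\<forall>\<^sub>F \<epsilon> in at_right 0. - pulse_integral (ret_deriv H) m \<tau> \<epsilon> = pulse_integral H (Suc m) \<tau> \<epsilon>"
  proof -
    have "\<forall>\<^sub>F \<epsilon> in at_right 0. 0 < \<epsilon> \<and> \<epsilon> < min (\<tau> - arrival 0) (arrival T - \<tau>)"
      unfolding eventually_at_right_field
      using \<tau> by (intro exI[of _ "min (\<tau> - arrival 0) (arrival T - \<tau>)"]) auto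
    then show ?thesis
      by eventually_elim
        (use Ck_Icc_mono[OF Suc.prems(1), of "Suc 0"] in \<open>auto intro!: pulse_integral_by_parts[symmetric]\<close>)
  qed
  ultimately show ?case by (rule Lim_transform_eventually)
qed

lemma ret_deriv_cong:
  assumes "\<And>s. s \<in> {0..T} \<Longrightarrow> H s = G s" "t \<in> {0..T}"
  shows "ret_deriv H t = ret_deriv G t"
  unfolding ret_deriv_def using dIcc_cong[OF assms] by simp

lemma ret_derivI:
  assumes "t \<in> {0..T}" "(H has_vector_derivative d) (at t within {0..T})"
  shows "ret_deriv H t = of_real (doppler t) * d"
  unfolding ret_deriv_def using dIcc_eqI[OF T_pos assms] by simp

lemma Ck_Icc_1D:
  "Ck_Icc (Suc 0) T H \<Longrightarrow> t \<in> {0..T} \<Longrightarrow> (H has_vector_derivative dIcc T H t) (at t within {0..T})"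
  using Ck_Icc_SucD(3)[of 0 T H t] by simp

lemma ret_deriv_add:
  assumes "Ck_Icc (Suc 0) T H" "Ck_Icc (Suc 0) T G" "t \<in> {0..T}"
  shows "ret_deriv (\<lambda>t. H t + G t) t = ret_deriv H t + ret_deriv G t"
  using ret_derivI[OF assms(3) has_vector_derivative_add[OF assms(1,2)[THEN Ck_Icc_1D[OF _ assms(3)]]]]
  by (simp add: ret_deriv_def algebra_simps)

lemma ret_deriv_mult:
  assumes "Ck_Icc (Suc 0) T H" "Ck_Icc (Suc 0) T G" "t \<in> {0..T}"
  shows "ret_deriv (\<lambda>t. H t * G t) t = ret_deriv H t * G t + H t * ret_deriv G t"
  using ret_derivI[OF assms(3) has_vector_derivative_mult[OF assms(1,2)[THEN Ck_Icc_1D[OF _ assms(3)]]]]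
  by (simp add: ret_deriv_def algebra_simps)

lemma ret_deriv_const: "t \<in> {0..T} \<Longrightarrow> ret_deriv (\<lambda>_. a) t = 0"
  using ret_derivI[of t "\<lambda>_. a" 0] by simp

lemma Ck_1_of_2: "Ck_Icc 2 T H \<Longrightarrow> Ck_Icc (Suc 0) T H"
  by (erule Ck_Icc_mono) simp

lemma Ck_ret_deriv_1: "Ck_Icc 2 T H \<Longrightarrow> Ck_Icc (Suc 0) T (ret_deriv H)"
  using Ck_ret_deriv[of 1 H] by (simp add: numeral_2_eq_2)

lemma ret_deriv2_mult:
  assumes "Ck_Icc 2 T H" "Ck_Icc 2 T G" "t \<in> {0..T}"
  shows "ret_deriv (ret_deriv (\<lambda>t. H t * G t)) t
    = ret_deriv (ret_deriv H) t * G t + 2 * ret_deriv H t * ret_deriv G t + H t * ret_deriv (ret_deriv G) t"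
proof -
  have "ret_deriv (ret_deriv (\<lambda>t. H t * G t)) t
      = ret_deriv (\<lambda>t. ret_deriv H t * G t + H t * ret_deriv G t) t"
    by (rule ret_deriv_cong) (use assms ret_deriv_mult Ck_1_of_2 in auto)
  also have "\<dots> = ret_deriv (\<lambda>t. ret_deriv H t * G t) t + ret_deriv (\<lambda>t. H t * ret_deriv G t) t"
    using assms by (intro ret_deriv_add Ck_Icc_mult T_pos Ck_1_of_2 Ck_ret_deriv_1)
  finally show ?thesis
    using assms by (simp add: ret_deriv_mult Ck_1_of_2 Ck_ret_deriv_1)
qed

lemma ret_deriv_power:
  assumes "Ck_Icc (Suc 0) T H" "t \<in> {0..T}"
  shows "ret_deriv (\<lambda>t. H t ^ n) t = of_nat n * H t ^ (n - 1) * ret_deriv H t"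
proof (induction n)
  case 0
  show ?case using assms by (simp add: ret_deriv_const)
next
  case (Suc n)
  have "ret_deriv (\<lambda>t. H t ^ Suc n) t = ret_deriv H t * H t ^ n + H t * ret_deriv (\<lambda>t. H t ^ n) t"
    using assms by (simp add: ret_deriv_mult Ck_Icc_power T_pos)
  then have "ret_deriv (\<lambda>t. H t ^ Suc n) t
      = ret_deriv H t * H t ^ n + H t * (of_nat n * H t ^ (n - 1) * ret_deriv H t)"
    by (simp only: Suc)
  then show ?case by (cases n) (simp_all add: algebra_simps)
qed

lemma ret_deriv2_power:
  assumes "Ck_Icc 2 T H" "t \<in> {0..T}"
  shows "ret_deriv (ret_deriv (\<lambda>t. H t ^ n)) t
    = of_nat n * of_nat (n - 1) * H t ^ (n - 2) * (ret_deriv H t)\<^sup>2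
      + of_nat n * H t ^ (n - 1) * ret_deriv (ret_deriv H) t"
proof -
  have C1: "Ck_Icc (Suc 0) T H" using assms by (intro Ck_1_of_2)
  have "ret_deriv (ret_deriv (\<lambda>t. H t ^ n)) t = ret_deriv (\<lambda>t. of_nat n * (H t ^ (n - 1) * ret_deriv H t)) t"
    by (rule ret_deriv_cong) (use assms in \<open>auto simp: ret_deriv_power[OF C1] mult.assoc\<close>)
  also have "\<dots> = of_nat n * ret_deriv (\<lambda>t. H t ^ (n - 1) * ret_deriv H t) t"
    using assms by (subst ret_deriv_mult)
      (auto simp: ret_deriv_const intro!: Ck_Icc_const Ck_Icc_mult Ck_Icc_power C1 T_pos Ck_ret_deriv_1)
  also have "ret_deriv (\<lambda>t. H t ^ (n - 1) * ret_deriv H t) t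
      = ret_deriv (\<lambda>t. H t ^ (n - 1)) t * ret_deriv H t + H t ^ (n - 1) * ret_deriv (ret_deriv H) t"
    using assms by (intro ret_deriv_mult Ck_Icc_power C1 T_pos Ck_ret_deriv_1)
  finally show ?thesis
    using assms(2)
    by (simp add: ret_deriv_power[OF C1] algebra_simps power2_eq_square numeral_2_eq_2)
qed

lemma ret_deriv_cnj:
  assumes "Ck_Icc (Suc 0) T H" "t \<in> {0..T}"
  shows "ret_deriv (\<lambda>t. cnj (H t)) t = cnj (ret_deriv H t)"
  using ret_derivI[OF assms(2) bounded_linear.has_vector_derivative[OF bounded_linear_cnj Ck_Icc_1D[OF assms]]]
  by (simp add: ret_deriv_def)

lemma ret_deriv2_cnj:
  assumes "Ck_Icc 2 T H" "t \<in> {0..T}"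
  shows "ret_deriv (ret_deriv (\<lambda>t. cnj (H t))) t = cnj (ret_deriv (ret_deriv H) t)"
proof -
  have "ret_deriv (ret_deriv (\<lambda>t. cnj (H t))) t = ret_deriv (\<lambda>t. cnj (ret_deriv H t)) t"
    by (rule ret_deriv_cong) (use assms ret_deriv_cnj Ck_1_of_2 in auto)
  then show ?thesis using assms by (simp add: ret_deriv_cnj Ck_ret_deriv_1)
qed

text \<open>
  From \<open>1 / doppler = 1 + p\<^sub>z' / c\<close>. This relation recovers the Doppler factor, hence the
  magnitude of the source, from the derivative of its height in arrival time.
\<close>

lemma ret_deriv_height:
  assumes "t \<in> {0..T}"
  shows "ret_deriv (\<lambda>t. of_real (p t $ 3)) t = of_real (c * (1 - doppler t))"
proof -
  have "doppler t * (dIcc T p t $ 3) = c * (1 - doppler t)"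
    using slope_pos[OF assms] c_pos by (simp add: doppler_def field_simps)
  then have eq: "complex_of_real (doppler t) * of_real (dIcc T p t $ 3) = of_real (c * (1 - doppler t))"
    by (simp only: of_real_mult[symmetric])
  have "((\<lambda>t. complex_of_real (p t $ 3)) has_vector_derivative of_real (dIcc T p t $ 3)) (at t within {0..T})"
    using p_has_derivative[OF assms]
    by (intro bounded_linear.has_vector_derivative[OF bounded_linear_of_real]
        bounded_linear.has_vector_derivative[OF bounded_linear_vec_nth])
  from ret_derivI[OF assms this] show ?thesis unfolding eq .
qed

lemma Ck_position: "Ck_Icc 2 T (\<lambda>t. p_xy (p t))" "Ck_Icc 2 T (\<lambda>t. complex_of_real (p t $ 3))"
proof -
  have C: "Ck_Icc 2 T p" using Ck_p by (rule Ck_Icc_mono) simp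
  show "Ck_Icc 2 T (\<lambda>t. p_xy (p t))" "Ck_Icc 2 T (\<lambda>t. complex_of_real (p t $ 3))"
    by (rule Ck_Icc_bounded_linear[OF T_pos bounded_linear_p_xy C])
      (rule Ck_Icc_bounded_linear[OF T_pos bounded_linear_of_real
        Ck_Icc_bounded_linear[OF T_pos bounded_linear_vec_nth C]])
qed

text \<open>
  The weight with which the source enters the reciprocity gap values.
\<close>

definition amplitude :: "(real \<Rightarrow> real) \<Rightarrow> real \<Rightarrow> complex" where
  "amplitude q t = of_real (q t) * of_real (doppler t)"

lemma Ck_amplitude: "Ck_Icc 5 T q \<Longrightarrow> Ck_Icc 5 T (amplitude q)"
  unfolding amplitude_def[abs_def]
  by (intro Ck_Icc_mult T_pos Ck_Icc_bounded_linear[OF _ bounded_linear_of_real] Ck_doppler)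

lemma amplitude_eq_0_iff: "t \<in> {0..T} \<Longrightarrow> amplitude q t = 0 \<longleftrightarrow> q t = 0"
  using doppler_pos[of t] by (auto simp: amplitude_def)

text \<open>
  By the product rule, \<open>q\<close> vanishing to second order makes the amplitude vanish to second order.
\<close>

lemma amplitude_silent:
  assumes Cq: "Ck_Icc 5 T q" and t: "t \<in> {0..T}"
    and "q t = 0" "dIcc T q t = 0" "(dIcc T ^^ 2) q t = 0"
  shows "amplitude q t = 0" "ret_deriv (amplitude q) t = 0" "ret_deriv (ret_deriv (amplitude q)) t = 0"
proof -
  have C: "Ck_Icc (Suc (Suc 0)) T q" "Ck_Icc (Suc 0) T (dIcc T q)"
    using Ck_Icc_mono[OF Cq, of 2] Ck_Icc_SucD(2)[of "Suc 0" T q] by (simp_all add: numeral_2_eq_2)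
  have Cc: "Ck_Icc 2 T (\<lambda>t. complex_of_real (q t))" "Ck_Icc 2 T (\<lambda>t. complex_of_real (doppler t))"
    by (rule Ck_Icc_bounded_linear[OF T_pos bounded_linear_of_real], rule Ck_Icc_mono, rule Cq Ck_doppler, simp)+
  have 1: "ret_deriv (\<lambda>t. complex_of_real (q t)) s = of_real (doppler s) * of_real (dIcc T q s)"
    if "s \<in> {0..T}" for s
    using that C by (intro ret_derivI bounded_linear.has_vector_derivative[OF bounded_linear_of_real] Ck_Icc_SucD(3))
  have "ret_deriv (\<lambda>t. complex_of_real (dIcc T q t)) t = of_real (doppler t) * of_real (dIcc T (dIcc T q) t)"
    using t C by (intro ret_derivI bounded_linear.has_vector_derivative[OF bounded_linear_of_real] Ck_Icc_SucD(3)) auto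
  moreover have "ret_deriv (ret_deriv (\<lambda>t. complex_of_real (q t))) t
      = ret_deriv (\<lambda>s. complex_of_real (doppler s) * of_real (dIcc T q s)) t"
    by (rule ret_deriv_cong) (use 1 t in auto)
  moreover have "ret_deriv (\<lambda>s. complex_of_real (doppler s) * of_real (dIcc T q s)) t
      = ret_deriv (\<lambda>s. complex_of_real (doppler s)) t * of_real (dIcc T q t)
        + of_real (doppler t) * ret_deriv (\<lambda>s. complex_of_real (dIcc T q s)) t"
    by (rule ret_deriv_mult[OF Ck_1_of_2[OF Cc(2)]
        Ck_Icc_bounded_linear[OF T_pos bounded_linear_of_real C(2)] t])
  ultimately have "ret_deriv (ret_deriv (\<lambda>t. complex_of_real (q t))) t = 0"
    using assms by (simp add: numeral_2_eq_2)
  then show "amplitude q t = 0" "ret_deriv (amplitude q) t = 0" "ret_deriv (ret_deriv (amplitude q)) t = 0"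
    using assms unfolding amplitude_def[abs_def]
    by (simp_all add: ret_deriv_mult ret_deriv2_mult Cc Ck_1_of_2 1)
qed

lemma source_integrand_continuous:
  assumes "0 < \<epsilon>" "continuous_on {0..T} q" "continuous_on {0..T} W"
  shows "continuous_on {0..T}
    (\<lambda>t. of_real (q t) * (W t * complex_of_real (mollifier_derivs \<epsilon> m (t - (\<tau> - p t $ 3 / c)))))"
proof -
  have "continuous_on {0..T} (\<lambda>t. (of_real (q t) * W t) * complex_of_real (mollifier_derivs \<epsilon> m (arrival t - \<tau>)))"
    by (intro continuous_on_pulse assms continuous_intros)
  then show ?thesis by (simp add: arrival_def mult.assoc algebra_simps)
qed

text \<open>
  The amplitude absorbs the Jacobian, which brings the integral into the form of
  \<open>pulse_integral\<close>.
\<close>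

lemma source_integral_tendsto:
  assumes q: "Ck_Icc 5 T q" and W: "Ck_Icc m T W" and m: "m \<le> 5"
    and \<tau>: "arrival 0 < \<tau>" "\<tau> < arrival T"
  shows "((\<lambda>\<epsilon>. \<integral>t. of_real (q t) * (W t * of_real (mollifier_derivs \<epsilon> m (t - (\<tau> - p t $ 3 / c))))
      \<partial>lebesgue_on {0..T}) \<longlongrightarrow> (- 1) ^ m * (ret_deriv ^^ m) (\<lambda>t. amplitude q t * W t) (rt \<tau>)) (at_right 0)"
proof (rule Lim_transform_eventually)
  show "(pulse_integral (\<lambda>t. amplitude q t * W t) m \<tau> \<longlongrightarrow>
      (- 1) ^ m * (ret_deriv ^^ m) (\<lambda>t. amplitude q t * W t) (rt \<tau>)) (at_right 0)"
    by (intro pulse_integral_tendsto Ck_Icc_mult T_pos W m \<tau> Ck_Icc_mono[OF Ck_amplitude[OF q]])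
  have "pulse_integral (\<lambda>t. amplitude q t * W t) m \<tau> \<epsilon>
      = (\<integral>t. of_real (q t) * (W t * of_real (mollifier_derivs \<epsilon> m (t - (\<tau> - p t $ 3 / c)))) \<partial>lebesgue_on {0..T})"
    if "0 < \<epsilon>" for \<epsilon>
  proof -
    have "pulse_integral (\<lambda>t. amplitude q t * W t) m \<tau> \<epsilon>
        = integral {0..T} (\<lambda>t. of_real (q t) * (W t * of_real (mollifier_derivs \<epsilon> m (t - (\<tau> - p t $ 3 / c)))))"
      unfolding pulse_integral_def
    proof (rule Henstock_Kurzweil_Integration.integral_cong)
      fix t assume "t \<in> {0..T}"
      then have "doppler t \<noteq> 0" using doppler_pos by force
      moreover have arr: "arrival t - \<tau> = t - (\<tau> - p t $ 3 / c)" by (simp add: arrival_def)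
      ultimately show "of_real (inverse (doppler t)) * (amplitude q t * W t) * of_real (mollifier_derivs \<epsilon> m (arrival t - \<tau>))
          = of_real (q t) * (W t * of_real (mollifier_derivs \<epsilon> m (t - (\<tau> - p t $ 3 / c))))"
        unfolding arr by (simp add: amplitude_def)
    qed
    then show ?thesis
      by (subst lebesgue_integral_eq_integral)
         (intro continuous_imp_integrable_real source_integrand_continuous that
           Ck_Icc_continuous[OF q] Ck_Icc_continuous[OF W], simp_all)
  qed
  then show "\<forall>\<^sub>F \<epsilon> in at_right 0. pulse_integral (\<lambda>t. amplitude q t * W t) m \<tau> \<epsilon>
      = (\<integral>t. of_real (q t) * (W t * of_real (mollifier_derivs \<epsilon> m (t - (\<tau> - p t $ 3 / c)))) \<partial>lebesgue_on {0..T})"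
    by (auto simp: eventually_at_filter)
qed

lemma Ck_iterated_ret_deriv:
  assumes "Ck_Icc m T H" "m \<le> 5" shows "continuous_on {0..T} ((ret_deriv ^^ m) H)"
  using assms
proof (induction m arbitrary: H)
  case (Suc m)
  then show ?case unfolding funpow_Suc_right comp_apply by (intro Suc.IH Ck_ret_deriv) auto
qed (simp add: Ck_Icc_0)

end

section \<open>The reciprocity gap values of a source configuration\<close>

text \<open>
  One source configuration together with its observed boundary data. The theorem compares two
  such configurations, so all values are first computed for one of them.
\<close>

locale observed_sources =
  fixes c T :: real and \<Omega> D :: "(real^3) set" and K :: nat
    and p :: "nat \<Rightarrow> real \<Rightarrow> real^3" and q :: "nat \<Rightarrow> real \<Rightarrow> real"
    and u :: "real \<Rightarrow> (real^3 \<Rightarrow> complex) \<Rightarrow> complex" and \<phi> :: "spacetime \<Rightarrow> complex"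
  assumes c_pos: "0 < c" and T_pos: "0 < T"
    and open_\<Omega>: "open \<Omega>" and bounded_\<Omega>: "bounded \<Omega>" and D_subset: "D \<subseteq> \<Omega>"
    and sources: "source_config c T D K p q"
    and field: "wave_field c T \<Omega> D (source_functional T K p q) u \<phi>"
    and window: "interior (I0 c T \<Omega>) \<noteq> {}"
begin

lemma moving_point: "k \<in> {1..K} \<Longrightarrow> moving_point c T (p k)"
  using sources c_pos T_pos by (auto simp: source_config_def moving_point_def)

lemma Ck_q: "k \<in> {1..K} \<Longrightarrow> Ck_Icc 5 T (q k)"
  using sources by (simp add: source_config_def)

abbreviation L where "L k \<equiv> moving_point.ret_deriv c T (p k)"
abbreviation amp where "amp k \<equiv> moving_point.amplitude c T (p k) (q k)"
abbreviation w where "w k t \<equiv> p_xy (p k t)"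
abbreviation z where "z k t \<equiv> complex_of_real (p k t $ 3)"
abbreviation ret_time where "ret_time k \<equiv> retarded_time c T (p k)"

lemma bdd_heights: "bdd_above ((\<lambda>r. r $ 3 / c) ` \<Omega>)" "bdd_below ((\<lambda>r. r $ 3 / c) ` \<Omega>)"
proof -
  have "bounded ((\<lambda>r. (1 / c) *\<^sub>R (r $ 3)) ` \<Omega>)"
    by (intro bounded_linear_image bounded_\<Omega> bounded_linear_const_scaleR bounded_linear_vec_nth)
  then show "bdd_above ((\<lambda>r. r $ 3 / c) ` \<Omega>)" "bdd_below ((\<lambda>r. r $ 3 / c) ` \<Omega>)"
    by (auto dest: bounded_imp_bdd_above bounded_imp_bdd_below)
qed

text \<open>
  An open set contains points slightly above and slightly below each of its points.
\<close>

lemma heights_strict: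
  assumes "r \<in> \<Omega>"
  shows "r $ 3 / c < (SUP r\<in>\<Omega>. r $ 3 / c)" "(INF r\<in>\<Omega>. r $ 3 / c) < r $ 3 / c"
proof -
  obtain e where e: "0 < e" "ball r e \<subseteq> \<Omega>" using open_\<Omega> assms open_contains_ball by blast
  have shift: "r + s *\<^sub>R axis 3 1 \<in> \<Omega>" if "\<bar>s\<bar> < e" for s
    using e(2) that by (auto simp: dist_norm norm_axis_1)
  have up: "r + (e/2) *\<^sub>R axis 3 1 \<in> \<Omega>" and down: "r + (- e/2) *\<^sub>R axis 3 1 \<in> \<Omega>"
    using e(1) by (auto intro!: shift simp del: scaleR_minus_left)
  show "r $ 3 / c < (SUP r\<in>\<Omega>. r $ 3 / c)"
    using cSUP_upper[OF up bdd_heights(1)] e(1) c_pos by (simp add: axis_def field_simps)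
  show "(INF r\<in>\<Omega>. r $ 3 / c) < r $ 3 / c"
    using cINF_lower[OF bdd_heights(2) down] e(1) c_pos by (simp add: axis_def field_simps)
qed

text \<open>
  The trajectory lies in \<open>D\<close>, inside the open set \<open>\<Omega>\<close>, so the inequalities are strict even at
  the end points of \<open>I0\<close>. The limits of the source integrals can thus be computed on all of the
  closed interval \<open>I0\<close>, by formulas that are continuous there.
\<close>

lemma I0_arrival:
  assumes "s \<in> I0 c T \<Omega>" "k \<in> {1..K}"
  shows "moving_point.arrival c (p k) 0 < s" "s < moving_point.arrival c (p k) T"
proof -
  interpret moving_point c T "p k" by (rule moving_point[OF assms(2)])
  have "p k 0 \<in> \<Omega>" "p k T \<in> \<Omega>"
    using sources assms(2) D_subset T_pos by (auto simp: source_config_def)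
  then show "arrival 0 < s" "s < arrival T"
    using heights_strict(1)[of "p k 0"] heights_strict(2)[of "p k T"] assms(1)
    by (auto simp: I0_def arrival_def)
qed

lemma rt_in:
  assumes "s \<in> I0 c T \<Omega>" "k \<in> {1..K}" shows "ret_time k s \<in> {0..T}"
proof -
  interpret moving_point c T "p k" by (rule moving_point[OF assms(2)])
  show ?thesis using I0_arrival[OF assms] by (intro rt_props) auto
qed

lemma continuous_on_rt_I0:
  assumes "k \<in> {1..K}" shows "continuous_on (I0 c T \<Omega>) (ret_time k)"
proof -
  interpret moving_point c T "p k" by (rule moving_point[OF assms])
  show ?thesis
    by (rule continuous_on_subset[OF continuous_on_rt]) (use I0_arrival[OF _ assms] in force)
qed

lemma I0_less:
  "max 0 (SUP r\<in>\<Omega>. r $ 3 / c) < min (T + (INF r\<in>\<Omega>. r $ 3 / c)) T"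
  using window by (auto simp: I0_def interior_atLeastAtMost_real)

lemma I0_islimpt:
  assumes "s \<in> I0 c T \<Omega>" shows "s islimpt interior (I0 c T \<Omega>)"
proof -
  have "s \<in> closure (interior (I0 c T \<Omega>))"
    using assms I0_less by (simp add: I0_def interior_atLeastAtMost_real)
  then show ?thesis
    using interior_limit_point[of s "interior (I0 c T \<Omega>)"] by (auto simp: closure_def)
qed

text \<open>
  The limit values of the functionals are built from these sums: the \<open>m\<close>-th derivative, in
  arrival time, of the amplitude-weighted function \<open>W\<close> of the source position.
\<close>

definition moment :: "(nat \<Rightarrow> real \<Rightarrow> complex) \<Rightarrow> nat \<Rightarrow> real \<Rightarrow> complex" where
  "moment W m s = (\<Sum>k\<in>{1..K}. (L k ^^ m) (\<lambda>t. amp k t * W k t) (ret_time k s))"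

lemma continuous_on_moment:
  assumes W: "\<And>k. k \<in> {1..K} \<Longrightarrow> Ck_Icc m T (W k)" and m: "m \<le> 5"
  shows "continuous_on (I0 c T \<Omega>) (moment W m)"
  unfolding moment_def[abs_def]
proof (intro continuous_on_sum)
  fix k assume k: "k \<in> {1..K}"
  interpret moving_point c T "p k" by (rule moving_point[OF k])
  have "continuous_on {0..T} ((L k ^^ m) (\<lambda>t. amp k t * W k t))"
    by (intro Ck_iterated_ret_deriv m Ck_Icc_mult T_pos W[OF k] Ck_Icc_mono[OF Ck_amplitude[OF Ck_q[OF k]]])
  then show "continuous_on (I0 c T \<Omega>) (\<lambda>s. (L k ^^ m) (\<lambda>t. amp k t * W k t) (ret_time k s))"
    by (rule continuous_on_compose2[OF _ continuous_on_rt_I0[OF k]]) (use rt_in k in auto)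
qed

definition pulse_sum :: "(nat \<Rightarrow> real \<Rightarrow> complex) \<Rightarrow> nat \<Rightarrow> real \<Rightarrow> real \<Rightarrow> complex" where
  "pulse_sum W m \<tau> \<epsilon> = (\<Sum>k\<in>{1..K}. \<integral>t. of_real (q k t) *
     (W k t * of_real (mollifier_derivs \<epsilon> m (t - (\<tau> - p k t $ 3 / c)))) \<partial>lebesgue_on {0..T})"

lemma pulse_sum_tendsto:
  assumes W: "\<And>k. k \<in> {1..K} \<Longrightarrow> Ck_Icc m T (W k)" and m: "m \<le> 5" and \<tau>: "\<tau> \<in> I0 c T \<Omega>"
  shows "(pulse_sum W m \<tau> \<longlongrightarrow> (- 1) ^ m * moment W m \<tau>) (at_right 0)"
  unfolding pulse_sum_def[abs_def] moment_def sum_distrib_left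
proof (intro tendsto_sum)
  fix k assume k: "k \<in> {1..K}"
  interpret moving_point c T "p k" by (rule moving_point[OF k])
  show "((\<lambda>\<epsilon>. \<integral>t. of_real (q k t) * (W k t * of_real (mollifier_derivs \<epsilon> m (t - (\<tau> - p k t $ 3 / c))))
      \<partial>lebesgue_on {0..T}) \<longlongrightarrow> (- 1) ^ m * (L k ^^ m) (\<lambda>t. amp k t * W k t) (ret_time k \<tau>)) (at_right 0)"
    by (rule source_integral_tendsto[OF Ck_q[OF k] W[OF k] m I0_arrival[OF \<tau> k]])
qed

lemma source_functional_harmonic_wave:
  "source_functional T K p q (harmonic_wave c \<tau> (mollifier_derivs \<epsilon>) n m)
    = pulse_sum (\<lambda>k t. w k t ^ n) m \<tau> \<epsilon>"
  by (simp add: source_functional_def pulse_sum_def harmonic_wave_def travelling_def)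

lemma source_functional_rotated_wave:
  assumes \<epsilon>: "0 < \<epsilon>"
  shows "source_functional T K p q (rotated_wave c \<tau> (mollifier_derivs \<epsilon>) n m)
    = of_nat (2 * n) * pulse_sum (\<lambda>k t. w k t ^ (n - 1) * z k t) m \<tau> \<epsilon>
      + of_real (- (1 / c)) * pulse_sum (\<lambda>k t. w k t ^ n * cnj (w k t)) (Suc m) \<tau> \<epsilon>"
  unfolding source_functional_def pulse_sum_def sum_distrib_left sum.distrib[symmetric]
proof (rule sum.cong[OF refl])
  fix k assume k: "k \<in> {1..K}"
  interpret moving_point c T "p k" by (rule moving_point[OF k])
  let ?I = "\<lambda>W m t. of_real (q k t) * (W t * of_real (mollifier_derivs \<epsilon> m (t - (\<tau> - p k t $ 3 / c))))"
  have W: "continuous_on {0..T} (\<lambda>t. w k t ^ (n - 1) * z k t)" "continuous_on {0..T} (\<lambda>t. w k t ^ n * cnj (w k t))"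
    by (intro continuous_intros Ck_Icc_continuous[OF Ck_position(1)] Ck_Icc_continuous[OF Ck_position(2)])+
  have int: "integrable (lebesgue_on {0..T}) (?I W m)" if "continuous_on {0..T} W"
    for W :: "real \<Rightarrow> complex" and m
    by (intro continuous_imp_integrable_real source_integrand_continuous \<epsilon> that Ck_Icc_continuous[OF Ck_q[OF k]])
  have "(\<integral>t. of_real (q k t) * rotated_wave c \<tau> (mollifier_derivs \<epsilon>) n m (t, p k t) \<partial>lebesgue_on {0..T})
      = (\<integral>t. of_nat (2 * n) * ?I (\<lambda>t. w k t ^ (n - 1) * z k t) m t
          + of_real (- (1 / c)) * ?I (\<lambda>t. w k t ^ n * cnj (w k t)) (Suc m) t \<partial>lebesgue_on {0..T})"
    by (rule Bochner_Integration.integral_cong) (auto simp: rotated_wave_def travelling_def algebra_simps)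
  also have "\<dots> = of_nat (2 * n) * (\<integral>t. ?I (\<lambda>t. w k t ^ (n - 1) * z k t) m t \<partial>lebesgue_on {0..T})
      + of_real (- (1 / c)) * (\<integral>t. ?I (\<lambda>t. w k t ^ n * cnj (w k t)) (Suc m) t \<partial>lebesgue_on {0..T})"
    using int[OF W(1), of m] int[OF W(2), of "Suc m"]
    by (simp only: Bochner_Integration.integral_add Bochner_Integration.integrable_mult_right
        Bochner_Integration.integral_mult_right_zero)
  finally show "(\<integral>t. of_real (q k t) * rotated_wave c \<tau> (mollifier_derivs \<epsilon>) n m (t, p k t) \<partial>lebesgue_on {0..T}) = \<dots>" .
qed

text \<open>
  Two cases of the definition of \<open>RG_value\<close>: inside \<open>I0\<close> the gap equals the source functional
  for small \<open>\<epsilon>\<close>, and at the end points the limit of the interior values is found by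
  continuity of \<open>V\<close>.
\<close>

lemma RG_value_eqI:
  assumes v: "v \<in> {test_f, test_g, test_h, test_i, test_j}"
    and lim: "\<And>s. s \<in> I0 c T \<Omega> \<Longrightarrow> ((\<lambda>\<epsilon>. source_functional T K p q (v c n \<epsilon> s)) \<longlongrightarrow> V s) (at_right 0)"
    and cont: "continuous_on (I0 c T \<Omega>) V" and \<tau>: "\<tau> \<in> I0 c T \<Omega>"
  shows "RG_value c T \<Omega> \<phi> v n \<tau> = V \<tau>"
proof -
  have interior: "RG_interior c T \<Omega> \<phi> v n s = V s" if s: "s \<in> interior (I0 c T \<Omega>)" for s
    unfolding RG_interior_def
  proof (rule tendsto_Lim)
    have sI: "s \<in> I0 c T \<Omega>" using s interior_subset by blast
    \<comment> \<open>Up to this width the pulse has left \<open>\<Omega>\<close> at the final time.\<close>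
    define \<epsilon>0 where "\<epsilon>0 = T + (INF r\<in>\<Omega>. r $ 3 / c) - s"
    have "\<epsilon>0 > 0" using s by (simp add: \<epsilon>0_def I0_def interior_atLeastAtMost_real)
    then have "\<forall>\<^sub>F \<epsilon> in at_right 0. 0 < \<epsilon> \<and> \<epsilon> < \<epsilon>0"
      unfolding eventually_at_right_field by (intro exI[of _ \<epsilon>0]) auto
    then have "\<forall>\<^sub>F \<epsilon> in at_right 0. source_functional T K p q (v c n \<epsilon> s) = RG T \<Omega> \<phi> (v c n \<epsilon> s)"
    proof eventually_elim
      case (elim \<epsilon>)
      have "\<epsilon> < T - (s - r $ 3 / c)" if "r \<in> \<Omega>" for r
        using elim cINF_lower[OF bdd_heights(2) that] by (simp add: \<epsilon>0_def)
      then show ?case using elim RG_test_waves[OF _ field T_pos _ v] by simp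
    qed
    then show "((\<lambda>\<epsilon>. RG T \<Omega> \<phi> (v c n \<epsilon> s)) \<longlongrightarrow> V s) (at_right 0)"
      by (rule Lim_transform_eventually[OF lim[OF sI]])
  qed simp
  show ?thesis
  proof (cases "\<tau> \<in> interior (I0 c T \<Omega>)")
    case True
    then show ?thesis by (simp add: RG_value_def interior)
  next
    case False
    have "(V \<longlongrightarrow> V \<tau>) (at \<tau> within interior (I0 c T \<Omega>))"
      using cont \<tau> tendsto_within_subset interior_subset unfolding continuous_on_def by blast
    then have "(RG_interior c T \<Omega> \<phi> v n \<longlongrightarrow> V \<tau>) (at \<tau> within interior (I0 c T \<Omega>))"
      by (rule Lim_transform_eventually) (auto simp: eventually_at_filter interior)
    moreover have "at \<tau> within interior (I0 c T \<Omega>) \<noteq> bot"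
      using I0_islimpt[OF \<tau>] by (simp add: trivial_limit_within)
    ultimately show ?thesis using False by (simp add: RG_value_def tendsto_Lim)
  qed
qed

lemma Ck_weights:
  assumes "k \<in> {1..K}" "m \<le> 2"
  shows "Ck_Icc m T (\<lambda>t. w k t ^ n)" "Ck_Icc m T (\<lambda>t. w k t ^ n * z k t)"
    "Ck_Icc m T (\<lambda>t. w k t ^ n * cnj (w k t))"
proof -
  interpret moving_point c T "p k" by (rule moving_point[OF assms(1)])
  note C = Ck_Icc_mono[OF Ck_position(1) assms(2)] Ck_Icc_mono[OF Ck_position(2) assms(2)]
  show "Ck_Icc m T (\<lambda>t. w k t ^ n)" "Ck_Icc m T (\<lambda>t. w k t ^ n * z k t)"
    "Ck_Icc m T (\<lambda>t. w k t ^ n * cnj (w k t))"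
    by (intro Ck_Icc_mult Ck_Icc_power C T_pos Ck_Icc_bounded_linear[OF T_pos bounded_linear_cnj])+
qed

lemma harmonic_tendsto:
  assumes "m \<le> 2" "s \<in> I0 c T \<Omega>"
  shows "((\<lambda>\<epsilon>. source_functional T K p q (harmonic_wave c s (mollifier_derivs \<epsilon>) n m))
    \<longlongrightarrow> (- 1) ^ m * moment (\<lambda>k t. w k t ^ n) m s) (at_right 0)"
  unfolding source_functional_harmonic_wave
  using assms by (intro pulse_sum_tendsto Ck_weights) auto

lemma rotated_tendsto:
  assumes "m \<le> 1" "s \<in> I0 c T \<Omega>"
  shows "((\<lambda>\<epsilon>. source_functional T K p q (rotated_wave c s (mollifier_derivs \<epsilon>) n m))
    \<longlongrightarrow> of_nat (2 * n) * ((- 1) ^ m * moment (\<lambda>k t. w k t ^ (n - 1) * z k t) m s)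
      + of_real (- (1 / c)) * ((- 1) ^ Suc m * moment (\<lambda>k t. w k t ^ n * cnj (w k t)) (Suc m) s)) (at_right 0)"
proof (rule Lim_transform_eventually)
  show "((\<lambda>\<epsilon>. of_nat (2 * n) * pulse_sum (\<lambda>k t. w k t ^ (n - 1) * z k t) m s \<epsilon>
      + of_real (- (1 / c)) * pulse_sum (\<lambda>k t. w k t ^ n * cnj (w k t)) (Suc m) s \<epsilon>)
    \<longlongrightarrow> of_nat (2 * n) * ((- 1) ^ m * moment (\<lambda>k t. w k t ^ (n - 1) * z k t) m s)
      + of_real (- (1 / c)) * ((- 1) ^ Suc m * moment (\<lambda>k t. w k t ^ n * cnj (w k t)) (Suc m) s)) (at_right 0)"
    using assms by (intro tendsto_intros pulse_sum_tendsto Ck_weights) auto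
qed (auto simp: eventually_at_filter source_functional_rotated_wave)

lemma source_functional_uminus:
  "source_functional T K p q (\<lambda>y. - v y) = - source_functional T K p q v"
  by (simp add: source_functional_def sum_negf)

lemma continuous_on_moments:
  assumes "m \<le> 2"
  shows "continuous_on (I0 c T \<Omega>) (moment (\<lambda>k t. w k t ^ n) m)"
    "continuous_on (I0 c T \<Omega>) (moment (\<lambda>k t. w k t ^ n * z k t) m)"
    "continuous_on (I0 c T \<Omega>) (moment (\<lambda>k t. w k t ^ n * cnj (w k t)) m)"
  using assms by (intro continuous_on_moment Ck_weights; simp)+

lemma RG_values:
  assumes \<tau>: "\<tau> \<in> I0 c T \<Omega>"
  shows "RG_value c T \<Omega> \<phi> test_f n \<tau> = moment (\<lambda>k t. w k t ^ n) 0 \<tau>"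
    and "RG_value c T \<Omega> \<phi> test_g n \<tau> = moment (\<lambda>k t. w k t ^ n) 1 \<tau>"
    and "RG_value c T \<Omega> \<phi> test_i n \<tau> = moment (\<lambda>k t. w k t ^ n) 2 \<tau>"
    and "RG_value c T \<Omega> \<phi> test_h n \<tau> = of_nat (2 * n) * moment (\<lambda>k t. w k t ^ (n - 1) * z k t) 0 \<tau>
          + of_real (1 / c) * moment (\<lambda>k t. w k t ^ n * cnj (w k t)) 1 \<tau>"
    and "RG_value c T \<Omega> \<phi> test_j n \<tau> = of_nat (2 * n) * moment (\<lambda>k t. w k t ^ (n - 1) * z k t) 1 \<tau>
          + of_real (1 / c) * moment (\<lambda>k t. w k t ^ n * cnj (w k t)) 2 \<tau>"
proof -
  note pos = eventually_at_right_less[of "0::real"]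
  show "RG_value c T \<Omega> \<phi> test_f n \<tau> = moment (\<lambda>k t. w k t ^ n) 0 \<tau>"
  proof (rule RG_value_eqI[OF _ _ continuous_on_moments(1) \<tau>])
    fix s assume s: "s \<in> I0 c T \<Omega>"
    show "((\<lambda>\<epsilon>. source_functional T K p q (test_f c n \<epsilon> s)) \<longlongrightarrow> moment (\<lambda>k t. w k t ^ n) 0 s) (at_right 0)"
      using harmonic_tendsto[OF _ s, of 0 n]
      by (auto elim!: Lim_transform_eventually intro!: eventually_mono[OF pos] simp: test_f_eq)
  qed simp_all
  show "RG_value c T \<Omega> \<phi> test_g n \<tau> = moment (\<lambda>k t. w k t ^ n) 1 \<tau>"
  proof (rule RG_value_eqI[OF _ _ continuous_on_moments(1) \<tau>])
    fix s assume s: "s \<in> I0 c T \<Omega>"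
    show "((\<lambda>\<epsilon>. source_functional T K p q (test_g c n \<epsilon> s)) \<longlongrightarrow> moment (\<lambda>k t. w k t ^ n) 1 s) (at_right 0)"
      using tendsto_minus[OF harmonic_tendsto[OF _ s, of 1 n]]
      by (auto elim!: Lim_transform_eventually intro!: eventually_mono[OF pos]
          simp: test_g_eq source_functional_uminus)
  qed simp_all
  show "RG_value c T \<Omega> \<phi> test_i n \<tau> = moment (\<lambda>k t. w k t ^ n) 2 \<tau>"
  proof (rule RG_value_eqI[OF _ _ continuous_on_moments(1) \<tau>])
    fix s assume s: "s \<in> I0 c T \<Omega>"
    show "((\<lambda>\<epsilon>. source_functional T K p q (test_i c n \<epsilon> s)) \<longlongrightarrow> moment (\<lambda>k t. w k t ^ n) 2 s) (at_right 0)"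
      using harmonic_tendsto[OF _ s, of 2 n]
      by (auto elim!: Lim_transform_eventually intro!: eventually_mono[OF pos] simp: test_i_eq)
  qed simp_all
  show "RG_value c T \<Omega> \<phi> test_h n \<tau> = of_nat (2 * n) * moment (\<lambda>k t. w k t ^ (n - 1) * z k t) 0 \<tau>
          + of_real (1 / c) * moment (\<lambda>k t. w k t ^ n * cnj (w k t)) 1 \<tau>"
  proof (rule RG_value_eqI[OF _ _ _ \<tau>, where V = "\<lambda>s. of_nat (2 * n) * moment (\<lambda>k t. w k t ^ (n - 1) * z k t) 0 s
          + of_real (1 / c) * moment (\<lambda>k t. w k t ^ n * cnj (w k t)) 1 s"])
    fix s assume s: "s \<in> I0 c T \<Omega>"
    show "((\<lambda>\<epsilon>. source_functional T K p q (test_h c n \<epsilon> s)) \<longlongrightarrow>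
        of_nat (2 * n) * moment (\<lambda>k t. w k t ^ (n - 1) * z k t) 0 s
          + of_real (1 / c) * moment (\<lambda>k t. w k t ^ n * cnj (w k t)) 1 s) (at_right 0)"
      using rotated_tendsto[OF _ s, of 0 n]
      by (auto elim!: Lim_transform_eventually intro!: eventually_mono[OF pos] simp: test_h_eq)
  next
    show "continuous_on (I0 c T \<Omega>) (\<lambda>s. of_nat (2 * n) * moment (\<lambda>k t. w k t ^ (n - 1) * z k t) 0 s
          + of_real (1 / c) * moment (\<lambda>k t. w k t ^ n * cnj (w k t)) 1 s)"
      by (intro continuous_on_add continuous_on_mult continuous_on_const continuous_on_moments) simp_all
  qed simp
  show "RG_value c T \<Omega> \<phi> test_j n \<tau> = of_nat (2 * n) * moment (\<lambda>k t. w k t ^ (n - 1) * z k t) 1 \<tau>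
          + of_real (1 / c) * moment (\<lambda>k t. w k t ^ n * cnj (w k t)) 2 \<tau>"
  proof (rule RG_value_eqI[OF _ _ _ \<tau>, where V = "\<lambda>s. of_nat (2 * n) * moment (\<lambda>k t. w k t ^ (n - 1) * z k t) 1 s
          + of_real (1 / c) * moment (\<lambda>k t. w k t ^ n * cnj (w k t)) 2 s"])
    fix s assume s: "s \<in> I0 c T \<Omega>"
    show "((\<lambda>\<epsilon>. source_functional T K p q (test_j c n \<epsilon> s)) \<longlongrightarrow>
        of_nat (2 * n) * moment (\<lambda>k t. w k t ^ (n - 1) * z k t) 1 s
          + of_real (1 / c) * moment (\<lambda>k t. w k t ^ n * cnj (w k t)) 2 s) (at_right 0)"
      using tendsto_minus[OF rotated_tendsto[OF _ s, of 1 n]]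
      by (auto elim!: Lim_transform_eventually intro!: eventually_mono[OF pos]
          simp: test_j_eq source_functional_uminus numeral_2_eq_2 add.commute)
  next
    show "continuous_on (I0 c T \<Omega>) (\<lambda>s. of_nat (2 * n) * moment (\<lambda>k t. w k t ^ (n - 1) * z k t) 1 s
          + of_real (1 / c) * moment (\<lambda>k t. w k t ^ n * cnj (w k t)) 2 s)"
      by (intro continuous_on_add continuous_on_mult continuous_on_const continuous_on_moments) simp_all
  qed simp
qed

end

section \<open>Expansion in retarded jets\<close>

text \<open>
  The first and second derivatives of \<open>w\<^sup>n\<close> as functions of the jet of \<open>w\<close>; likewise
  \<open>twisted_jet1\<close> and \<open>twisted_jet2\<close> below are those of \<open>a w\<^sup>n w\<^sup>*\<close>. What matters later is
  only on which entries of the jets they depend.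
\<close>

definition power_jet1 :: "nat \<Rightarrow> complex \<Rightarrow> complex \<Rightarrow> complex" where
  "power_jet1 n w0 w1 = of_nat n * w0 ^ (n - 1) * w1"

definition power_jet2 :: "nat \<Rightarrow> complex \<Rightarrow> complex \<Rightarrow> complex \<Rightarrow> complex" where
  "power_jet2 n w0 w1 w2 = of_nat n * of_nat (n - 1) * w0 ^ (n - 2) * w1\<^sup>2 + of_nat n * w0 ^ (n - 1) * w2"

text \<open>
  The part of the second derivative of \<open>a w\<^sup>n\<close> without second derivatives of \<open>a\<close> or \<open>w\<close>.
\<close>

definition second_order_rest :: "nat \<Rightarrow> complex \<Rightarrow> complex \<Rightarrow> complex \<Rightarrow> complex \<Rightarrow> complex" where
  "second_order_rest n a0 a1 w0 w1 = 2 * a1 * power_jet1 n w0 w1 + a0 * power_jet2 n w0 w1 0"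

definition twisted_jet1 :: "nat \<Rightarrow> complex \<Rightarrow> complex \<Rightarrow> complex \<Rightarrow> complex \<Rightarrow> complex" where
  "twisted_jet1 n a0 a1 w0 w1 =
     a1 * (w0 ^ n * cnj w0) + a0 * (power_jet1 n w0 w1 * cnj w0 + w0 ^ n * cnj w1)"

definition twisted_jet2 ::
  "nat \<Rightarrow> complex \<Rightarrow> complex \<Rightarrow> complex \<Rightarrow> complex \<Rightarrow> complex \<Rightarrow> complex \<Rightarrow> complex" where
  "twisted_jet2 n a0 a1 a2 w0 w1 w2 =
     a2 * (w0 ^ n * cnj w0) + 2 * a1 * (power_jet1 n w0 w1 * cnj w0 + w0 ^ n * cnj w1)
     + a0 * (power_jet2 n w0 w1 w2 * cnj w0 + 2 * power_jet1 n w0 w1 * cnj w1 + w0 ^ n * cnj w2)"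

context observed_sources
begin

abbreviation a0 where "a0 k s \<equiv> amp k (ret_time k s)"
abbreviation a1 where "a1 k s \<equiv> L k (amp k) (ret_time k s)"
abbreviation a2 where "a2 k s \<equiv> L k (L k (amp k)) (ret_time k s)"
abbreviation w0 where "w0 k s \<equiv> w k (ret_time k s)"
abbreviation w1 where "w1 k s \<equiv> L k (w k) (ret_time k s)"
abbreviation w2 where "w2 k s \<equiv> L k (L k (w k)) (ret_time k s)"
abbreviation z0 where "z0 k s \<equiv> z k (ret_time k s)"
abbreviation z1 where "z1 k s \<equiv> L k (z k) (ret_time k s)"

lemma moment_expansions:
  assumes s: "s \<in> I0 c T \<Omega>"
  shows "moment (\<lambda>k t. w k t ^ n) 0 s = (\<Sum>k\<in>{1..K}. a0 k s * w0 k s ^ n)"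
    "moment (\<lambda>k t. w k t ^ n) 1 s =
      (\<Sum>k\<in>{1..K}. a1 k s * w0 k s ^ n + a0 k s * w1 k s * (of_nat n * w0 k s ^ (n - 1)))"
    "moment (\<lambda>k t. w k t ^ n) 2 s =
      (\<Sum>k\<in>{1..K}. a2 k s * w0 k s ^ n + a0 k s * w2 k s * (of_nat n * w0 k s ^ (n - 1))
        + second_order_rest n (a0 k s) (a1 k s) (w0 k s) (w1 k s))"
    "moment (\<lambda>k t. w k t ^ n * z k t) 0 s = (\<Sum>k\<in>{1..K}. z0 k s * a0 k s * w0 k s ^ n)"
    "moment (\<lambda>k t. w k t ^ n * z k t) 1 s = (\<Sum>k\<in>{1..K}. z1 k s * a0 k s * w0 k s ^ n
        + z0 k s * (a1 k s * w0 k s ^ n + a0 k s * power_jet1 n (w0 k s) (w1 k s)))"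
    "moment (\<lambda>k t. w k t ^ n * cnj (w k t)) 1 s =
      (\<Sum>k\<in>{1..K}. twisted_jet1 n (a0 k s) (a1 k s) (w0 k s) (w1 k s))"
    "moment (\<lambda>k t. w k t ^ n * cnj (w k t)) 2 s =
      (\<Sum>k\<in>{1..K}. twisted_jet2 n (a0 k s) (a1 k s) (a2 k s) (w0 k s) (w1 k s) (w2 k s))"
proof -
  show "moment (\<lambda>k t. w k t ^ n) 0 s = (\<Sum>k\<in>{1..K}. a0 k s * w0 k s ^ n)"
    "moment (\<lambda>k t. w k t ^ n * z k t) 0 s = (\<Sum>k\<in>{1..K}. z0 k s * a0 k s * w0 k s ^ n)"
    by (simp_all add: moment_def mult_ac)
  have per_source:
    "L k (\<lambda>t. amp k t * w k t ^ n) (ret_time k s)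
      = a1 k s * w0 k s ^ n + a0 k s * w1 k s * (of_nat n * w0 k s ^ (n - 1))"
    "L k (L k (\<lambda>t. amp k t * w k t ^ n)) (ret_time k s)
      = a2 k s * w0 k s ^ n + a0 k s * w2 k s * (of_nat n * w0 k s ^ (n - 1))
        + second_order_rest n (a0 k s) (a1 k s) (w0 k s) (w1 k s)"
    "L k (\<lambda>t. amp k t * (w k t ^ n * z k t)) (ret_time k s)
      = z1 k s * a0 k s * w0 k s ^ n
        + z0 k s * (a1 k s * w0 k s ^ n + a0 k s * power_jet1 n (w0 k s) (w1 k s))"
    "L k (\<lambda>t. amp k t * (w k t ^ n * cnj (w k t))) (ret_time k s)
      = twisted_jet1 n (a0 k s) (a1 k s) (w0 k s) (w1 k s)"
    "L k (L k (\<lambda>t. amp k t * (w k t ^ n * cnj (w k t)))) (ret_time k s)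
      = twisted_jet2 n (a0 k s) (a1 k s) (a2 k s) (w0 k s) (w1 k s) (w2 k s)"
    if k: "k \<in> {1..K}" for k
  proof -
    interpret moving_point c T "p k" by (rule moving_point[OF k])
    note t = rt_in[OF s k]
    have A: "Ck_Icc 2 T (amp k)" by (rule Ck_Icc_mono[OF Ck_amplitude[OF Ck_q[OF k]]]) simp
    note W = Ck_position(1) and Z = Ck_position(2)
    have Wc: "Ck_Icc 2 T (\<lambda>t. cnj (w k t))"
      by (rule Ck_Icc_bounded_linear[OF T_pos bounded_linear_cnj W])
    have Wn: "Ck_Icc 2 T (\<lambda>t. w k t ^ n)" by (rule Ck_Icc_power[OF T_pos W])
    note WZ = Ck_Icc_mult[OF T_pos Wn Z] and WW = Ck_Icc_mult[OF T_pos Wn Wc]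
    note rules = ret_deriv_mult[OF A[THEN Ck_1_of_2] Wn[THEN Ck_1_of_2] t]
      ret_deriv2_mult[OF A Wn t]
      ret_deriv_mult[OF A[THEN Ck_1_of_2] WZ[THEN Ck_1_of_2] t]
      ret_deriv_mult[OF A[THEN Ck_1_of_2] WW[THEN Ck_1_of_2] t]
      ret_deriv2_mult[OF A WW t]
      ret_deriv_mult[OF Wn[THEN Ck_1_of_2] Z[THEN Ck_1_of_2] t]
      ret_deriv_mult[OF Wn[THEN Ck_1_of_2] Wc[THEN Ck_1_of_2] t]
      ret_deriv2_mult[OF Wn Wc t]
      ret_deriv_power[OF W[THEN Ck_1_of_2] t] ret_deriv2_power[OF W t]
      ret_deriv_cnj[OF W[THEN Ck_1_of_2] t] ret_deriv2_cnj[OF W t]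
    show "L k (\<lambda>t. amp k t * w k t ^ n) (ret_time k s)
      = a1 k s * w0 k s ^ n + a0 k s * w1 k s * (of_nat n * w0 k s ^ (n - 1))"
      by (simp only: rules) (simp add: algebra_simps)
    show "L k (L k (\<lambda>t. amp k t * w k t ^ n)) (ret_time k s)
      = a2 k s * w0 k s ^ n + a0 k s * w2 k s * (of_nat n * w0 k s ^ (n - 1))
        + second_order_rest n (a0 k s) (a1 k s) (w0 k s) (w1 k s)"
      by (simp only: rules) (simp add: second_order_rest_def power_jet1_def power_jet2_def algebra_simps)
    show "L k (\<lambda>t. amp k t * (w k t ^ n * z k t)) (ret_time k s)
      = z1 k s * a0 k s * w0 k s ^ n
        + z0 k s * (a1 k s * w0 k s ^ n + a0 k s * power_jet1 n (w0 k s) (w1 k s))"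
      by (simp only: rules) (simp add: power_jet1_def algebra_simps)
    show "L k (\<lambda>t. amp k t * (w k t ^ n * cnj (w k t))) (ret_time k s)
      = twisted_jet1 n (a0 k s) (a1 k s) (w0 k s) (w1 k s)"
      by (simp only: rules) (simp add: twisted_jet1_def power_jet1_def algebra_simps)
    show "L k (L k (\<lambda>t. amp k t * (w k t ^ n * cnj (w k t)))) (ret_time k s)
      = twisted_jet2 n (a0 k s) (a1 k s) (a2 k s) (w0 k s) (w1 k s) (w2 k s)"
      by (simp only: rules)
         (simp add: twisted_jet2_def power_jet1_def power_jet2_def algebra_simps)
  qed
  have iterate: "moment W 1 s = (\<Sum>k\<in>{1..K}. L k (\<lambda>t. amp k t * W k t) (ret_time k s))"
    "moment W 2 s = (\<Sum>k\<in>{1..K}. L k (L k (\<lambda>t. amp k t * W k t)) (ret_time k s))" for W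
    by (simp_all add: moment_def numeral_2_eq_2)
  show "moment (\<lambda>k t. w k t ^ n) 1 s =
      (\<Sum>k\<in>{1..K}. a1 k s * w0 k s ^ n + a0 k s * w1 k s * (of_nat n * w0 k s ^ (n - 1)))"
    unfolding iterate
    by (rule sum.cong[OF refl]) (rule per_source)
  show "moment (\<lambda>k t. w k t ^ n) 2 s =
      (\<Sum>k\<in>{1..K}. a2 k s * w0 k s ^ n + a0 k s * w2 k s * (of_nat n * w0 k s ^ (n - 1))
        + second_order_rest n (a0 k s) (a1 k s) (w0 k s) (w1 k s))"
    unfolding iterate
    by (rule sum.cong[OF refl]) (rule per_source)
  show "moment (\<lambda>k t. w k t ^ n * z k t) 1 s = (\<Sum>k\<in>{1..K}. z1 k s * a0 k s * w0 k s ^ n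
        + z0 k s * (a1 k s * w0 k s ^ n + a0 k s * power_jet1 n (w0 k s) (w1 k s)))"
    unfolding iterate
    by (rule sum.cong[OF refl]) (rule per_source)
  show "moment (\<lambda>k t. w k t ^ n * cnj (w k t)) 1 s =
      (\<Sum>k\<in>{1..K}. twisted_jet1 n (a0 k s) (a1 k s) (w0 k s) (w1 k s))"
    unfolding iterate
    by (rule sum.cong[OF refl]) (rule per_source)
  show "moment (\<lambda>k t. w k t ^ n * cnj (w k t)) 2 s =
      (\<Sum>k\<in>{1..K}. twisted_jet2 n (a0 k s) (a1 k s) (a2 k s) (w0 k s) (w1 k s) (w2 k s))"
    unfolding iterate
    by (rule sum.cong[OF refl]) (rule per_source)
qed

abbreviation act where "act s \<equiv> active c T K p q s"

lemma active_subset: "act s \<subseteq> {1..K}" and finite_active: "finite (act s)"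
  by (auto simp: active_def)

lemma a0_eq_0_iff:
  assumes s: "s \<in> I0 c T \<Omega>" and k: "k \<in> {1..K}"
  shows "a0 k s = 0 \<longleftrightarrow> k \<notin> act s"
proof -
  interpret moving_point c T "p k" by (rule moving_point[OF k])
  show ?thesis using amplitude_eq_0_iff[OF rt_in[OF s k]] k by (simp add: active_def q_at_def)
qed

lemma a0_active:
  assumes "s \<in> I0 c T \<Omega>" "k \<in> act s" shows "a0 k s \<noteq> 0"
  using a0_eq_0_iff[OF assms(1) subsetD[OF active_subset assms(2)]] assms(2) by blast

lemma silent_jets:
  assumes s: "s \<in> I0 c T \<Omega>" and k: "k \<in> {1..K} - act s" and silent: "inactive_silent c T K p q s"
  shows "a0 k s = 0" "a1 k s = 0" "a2 k s = 0"
proof -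
  have k': "k \<in> {1..K}" using k by simp
  interpret moving_point c T "p k" by (rule moving_point[OF k'])
  have "q_at c T p q s k = 0" using k by (simp add: active_def)
  then show "a0 k s = 0" "a1 k s = 0" "a2 k s = 0"
    using amplitude_silent[OF Ck_q[OF k'] rt_in[OF s k']] silent k'
    by (auto simp: inactive_silent_def q_at_def)
qed

text \<open>
  Since the amplitude is magnitude times Doppler factor, this makes the magnitude a function of
  the amplitude and the derivative of the height.
\<close>

lemma doppler_of_height:
  assumes s: "s \<in> I0 c T \<Omega>" and k: "k \<in> {1..K}"
  shows "a0 k s = of_real (q_at c T p q s k) * (1 - z1 k s / of_real c)" "1 - z1 k s / of_real c \<noteq> 0"
proof -
  interpret moving_point c T "p k" by (rule moving_point[OF k])
  note t = rt_in[OF s k]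
  have "1 - z1 k s / of_real c = of_real (doppler (ret_time k s))"
    using c_pos by (simp add: ret_deriv_height[OF t])
  then show "a0 k s = of_real (q_at c T p q s k) * (1 - z1 k s / of_real c)" "1 - z1 k s / of_real c \<noteq> 0"
    using doppler_pos[OF t] by (simp_all add: amplitude_def q_at_def)
qed

lemma sum_active:
  assumes "\<And>k. k \<in> {1..K} - act s \<Longrightarrow> f k = (0::complex)"
  shows "(\<Sum>k\<in>{1..K}. f k) = (\<Sum>k\<in>act s. f k)"
  using assms active_subset by (intro sum.mono_neutral_right) auto

lemma RG_f_active:
  assumes s: "s \<in> I0 c T \<Omega>"
  shows "RG_value c T \<Omega> \<phi> test_f n s = (\<Sum>k\<in>act s. a0 k s * w0 k s ^ n)"
  unfolding RG_values[OF s] moment_expansions[OF s]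
  by (rule sum_active) (use a0_eq_0_iff[OF s] in auto)

lemma RG_values_active:
  assumes s: "s \<in> I0 c T \<Omega>" and silent: "inactive_silent c T K p q s"
  shows "RG_value c T \<Omega> \<phi> test_g n s =
      (\<Sum>k\<in>act s. a1 k s * w0 k s ^ n + a0 k s * w1 k s * (of_nat n * w0 k s ^ (n - 1)))"
    "RG_value c T \<Omega> \<phi> test_i n s =
      (\<Sum>k\<in>act s. a2 k s * w0 k s ^ n + a0 k s * w2 k s * (of_nat n * w0 k s ^ (n - 1))
        + second_order_rest n (a0 k s) (a1 k s) (w0 k s) (w1 k s))"
    "RG_value c T \<Omega> \<phi> test_h (Suc n) s =
      (\<Sum>k\<in>act s. of_nat (2 * Suc n) * (z0 k s * a0 k s * w0 k s ^ n)
        + of_real (1 / c) * twisted_jet1 (Suc n) (a0 k s) (a1 k s) (w0 k s) (w1 k s))"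
    "RG_value c T \<Omega> \<phi> test_j (Suc n) s =
      (\<Sum>k\<in>act s. of_nat (2 * Suc n) * (z1 k s * a0 k s * w0 k s ^ n)
        + (of_nat (2 * Suc n) * (z0 k s * (a1 k s * w0 k s ^ n + a0 k s * power_jet1 n (w0 k s) (w1 k s)))
           + of_real (1 / c) * twisted_jet2 (Suc n) (a0 k s) (a1 k s) (a2 k s) (w0 k s) (w1 k s) (w2 k s)))"
proof -
  note zero = silent_jets[OF s _ silent]
  show "RG_value c T \<Omega> \<phi> test_g n s =
      (\<Sum>k\<in>act s. a1 k s * w0 k s ^ n + a0 k s * w1 k s * (of_nat n * w0 k s ^ (n - 1)))"
    unfolding RG_values[OF s] moment_expansions[OF s]
    by (rule sum_active) (simp add: zero)
  show "RG_value c T \<Omega> \<phi> test_i n s =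
      (\<Sum>k\<in>act s. a2 k s * w0 k s ^ n + a0 k s * w2 k s * (of_nat n * w0 k s ^ (n - 1))
        + second_order_rest n (a0 k s) (a1 k s) (w0 k s) (w1 k s))"
    unfolding RG_values[OF s] moment_expansions[OF s]
    by (rule sum_active) (simp add: zero second_order_rest_def)
  show "RG_value c T \<Omega> \<phi> test_h (Suc n) s =
      (\<Sum>k\<in>act s. of_nat (2 * Suc n) * (z0 k s * a0 k s * w0 k s ^ n)
        + of_real (1 / c) * twisted_jet1 (Suc n) (a0 k s) (a1 k s) (w0 k s) (w1 k s))"
    unfolding RG_values[OF s] moment_expansions[OF s] sum_distrib_left sum.distrib[symmetric] diff_Suc_1
    by (rule sum_active) (simp add: zero twisted_jet1_def)
  show "RG_value c T \<Omega> \<phi> test_j (Suc n) s =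
      (\<Sum>k\<in>act s. of_nat (2 * Suc n) * (z1 k s * a0 k s * w0 k s ^ n)
        + (of_nat (2 * Suc n) * (z0 k s * (a1 k s * w0 k s ^ n + a0 k s * power_jet1 n (w0 k s) (w1 k s)))
           + of_real (1 / c) * twisted_jet2 (Suc n) (a0 k s) (a1 k s) (a2 k s) (w0 k s) (w1 k s) (w2 k s)))"
    unfolding RG_values[OF s] moment_expansions[OF s] sum_distrib_left sum.distrib[symmetric] diff_Suc_1
      distrib_left add.assoc
    by (rule sum_active) (simp add: zero twisted_jet2_def)
qed

lemma inj_on_w0:
  assumes "separated c T K p s" shows "inj_on (\<lambda>k. w0 k s) (act s)"
  using assms active_subset unfolding separated_def p_at_def inj_on_def by blast

lemma continuous_on_p_at: "k \<in> {1..K} \<Longrightarrow> continuous_on (I0 c T \<Omega>) (\<lambda>s. p_at c T p s k)"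
  and continuous_on_q_at: "k \<in> {1..K} \<Longrightarrow> continuous_on (I0 c T \<Omega>) (\<lambda>s. q_at c T p q s k)"
proof -
  assume k: "k \<in> {1..K}"
  interpret moving_point c T "p k" by (rule moving_point[OF k])
  have rt: "ret_time k ` I0 c T \<Omega> \<subseteq> {0..T}" using rt_in[OF _ k] by blast
  show "continuous_on (I0 c T \<Omega>) (\<lambda>s. p_at c T p s k)"
    unfolding p_at_def
    by (rule continuous_on_compose2[OF Ck_Icc_continuous[OF Ck_p] continuous_on_rt_I0[OF k] rt])
  show "continuous_on (I0 c T \<Omega>) (\<lambda>s. q_at c T p q s k)"
    unfolding q_at_def
    by (rule continuous_on_compose2[OF Ck_Icc_continuous[OF Ck_q[OF k]] continuous_on_rt_I0[OF k] rt])
qed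

text \<open>
  Emission times whose fronts fall in an open interval form a relatively open set, and a function
  vanishing there has vanishing derivative there.
\<close>

lemma dIcc_eq_0_on_window:
  fixes f :: "real \<Rightarrow> real"
  assumes k: "k \<in> {1..K}" and f: "\<And>t. t \<in> {0..T} \<Longrightarrow> moving_point.arrival c (p k) t \<in> {a<..<b} \<Longrightarrow> f t = 0"
    and t: "t \<in> {0..T}" "moving_point.arrival c (p k) t \<in> {a<..<b}"
  shows "dIcc T f t = 0"
proof -
  interpret moving_point c T "p k" by (rule moving_point[OF k])
  have "\<forall>\<^sub>F s in at t within {0..T}. arrival s \<in> {a<..<b}"
    using continuous_on_arrival t unfolding continuous_on_def
    by (intro topological_tendstoD[of arrival "arrival t"]) auto
  then obtain d where "0 < d" and d: "\<And>s. s \<in> {0..T} \<Longrightarrow> s \<noteq> t \<Longrightarrow> dist s t < d \<Longrightarrow> arrival s \<in> {a<..<b}"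
    unfolding eventually_at by blast
  have "(f has_vector_derivative 0) (at t within {0..T})"
    by (rule has_vector_derivative_transform_within[OF has_vector_derivative_const \<open>0 < d\<close> t(1), of 0])
       (use d f t in metis)
  then show ?thesis by (rule dIcc_eqI[OF T_pos t(1)])
qed

text \<open>
  A dichotomy for one source: if its magnitude is nonzero at some time of the interval, it stays
  nonzero on a smaller interval; otherwise it vanishes identically, together with its derivatives.
\<close>

lemma silent_window_single:
  assumes k: "k \<in> {1..K}" and ab: "a < b" "{a<..<b} \<subseteq> I0 c T \<Omega>"
  obtains a' b' where "a \<le> a'" "a' < b'" "b' \<le> b"
    "\<And>s. s \<in> {a'<..<b'} \<Longrightarrow> q_at c T p q s k = 0 \<Longrightarrow>
      dIcc T (q k) (ret_time k s) = 0 \<and> (dIcc T ^^ 2) (q k) (ret_time k s) = 0"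
proof (cases "\<exists>s0\<in>{a<..<b}. q_at c T p q s0 k \<noteq> 0")
  case True
  then obtain s0 where s0: "s0 \<in> {a<..<b}" "q_at c T p q s0 k \<noteq> 0" by blast
  have "continuous_on {a<..<b} (\<lambda>s. q_at c T p q s k)"
    using continuous_on_q_at[OF k] ab(2) by (rule continuous_on_subset)
  then obtain d where d: "0 < d" "\<And>s. s \<in> {a<..<b} \<Longrightarrow> dist s s0 < d \<Longrightarrow>
      dist (q_at c T p q s k) (q_at c T p q s0 k) < \<bar>q_at c T p q s0 k\<bar>"
    using s0 unfolding continuous_on_iff by (metis zero_less_abs_iff)
  show thesis
  proof (rule that[of "max a (s0 - d)" "min b (s0 + d)"])
    fix s assume s: "s \<in> {max a (s0 - d)<..<min b (s0 + d)}" "q_at c T p q s k = 0"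
    then have "dist (q_at c T p q s k) (q_at c T p q s0 k) < \<bar>q_at c T p q s0 k\<bar>"
      by (intro d(2)) (auto simp: dist_real_def)
    then show "dIcc T (q k) (ret_time k s) = 0 \<and> (dIcc T ^^ 2) (q k) (ret_time k s) = 0"
      using s(2) by (simp add: dist_real_def)
  qed (use d(1) s0(1) in auto)
next
  case False
  interpret moving_point c T "p k" by (rule moving_point[OF k])
  have q0: "q k t = 0" if "t \<in> {0..T}" "arrival t \<in> {a<..<b}" for t
  proof -
    have "q_at c T p q (arrival t) k = 0" using False that(2) by blast
    then show ?thesis by (simp add: q_at_def rt_arrival[OF that(1)])
  qed
  show thesis
  proof (rule that[of a b])
    fix s assume s: "s \<in> {a<..<b}"
    then have sI: "s \<in> I0 c T \<Omega>" using ab by blast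
    have arr: "arrival (ret_time k s) = s" using I0_arrival[OF sI k] by (intro rt_props) simp
    note t = rt_in[OF sI k]
    have 1: "dIcc T (q k) t = 0" if "t \<in> {0..T}" "arrival t \<in> {a<..<b}" for t
      by (rule dIcc_eq_0_on_window[OF k q0 that])
    have "dIcc T (dIcc T (q k)) (ret_time k s) = 0"
      by (rule dIcc_eq_0_on_window[OF k 1 t]) (use arr s in auto)
    then show "dIcc T (q k) (ret_time k s) = 0 \<and> (dIcc T ^^ 2) (q k) (ret_time k s) = 0"
      using 1[OF t] arr s by (simp add: numeral_2_eq_2)
  qed (use ab in auto)
qed

text \<open>
  Shrinking the interval once for each of the finitely many sources.
\<close>

lemma silent_window:
  assumes ab: "a < b" "{a<..<b} \<subseteq> I0 c T \<Omega>"
  obtains a' b' where "a \<le> a'" "a' < b'" "b' \<le> b"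
    "\<And>s. s \<in> {a'<..<b'} \<Longrightarrow> inactive_silent c T K p q s"
proof -
  have "\<exists>a' b'. a \<le> a' \<and> a' < b' \<and> b' \<le> b \<and> (\<forall>k\<in>S. \<forall>s\<in>{a'<..<b'}. q_at c T p q s k = 0 \<longrightarrow>
      dIcc T (q k) (ret_time k s) = 0 \<and> (dIcc T ^^ 2) (q k) (ret_time k s) = 0)"
    if "finite S" "S \<subseteq> {1..K}" for S
    using that
  proof (induction S)
    case empty
    then show ?case using ab by auto
  next
    case (insert k S)
    then obtain a' b' where 1: "a \<le> a'" "a' < b'" "b' \<le> b"
      and 2: "\<forall>k\<in>S. \<forall>s\<in>{a'<..<b'}. q_at c T p q s k = 0 \<longrightarrow>
        dIcc T (q k) (ret_time k s) = 0 \<and> (dIcc T ^^ 2) (q k) (ret_time k s) = 0" by auto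
    have k: "k \<in> {1..K}" using insert by simp
    have "{a'<..<b'} \<subseteq> I0 c T \<Omega>" using 1 ab(2) by fastforce
    from silent_window_single[OF k 1(2) this]
    obtain a'' b'' where 3: "a' \<le> a''" "a'' < b''" "b'' \<le> b'"
      and 4: "\<And>s. s \<in> {a''<..<b''} \<Longrightarrow> q_at c T p q s k = 0 \<Longrightarrow>
        dIcc T (q k) (ret_time k s) = 0 \<and> (dIcc T ^^ 2) (q k) (ret_time k s) = 0" by blast
    have "a \<le> a''" "b'' \<le> b" "\<And>s. s \<in> {a''<..<b''} \<Longrightarrow> s \<in> {a'<..<b'}" using 1 3 by auto
    with 2 3(2) 4 show ?case by (intro exI[of _ a''] exI[of _ b'']) blast
  qed
  from this[of "{1..K}"] show thesis
    using that by (auto simp: inactive_silent_def)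
qed

end

section \<open>Comparison of two source configurations\<close>

locale two_observations =
  X: observed_sources c T \<Omega> D K p q u \<phi> + Y: observed_sources c T \<Omega> D K' p' q' u' \<phi>'
  for c T :: real and \<Omega> D :: "(real^3) set" and K p q u \<phi> K' p' q' u' \<phi>'
begin

text \<open>
  At most \<open>2 N\<close> nodes occur in the two exponential sums together, so \<open>2 N\<close> moments suffice.
\<close>

lemma card_active_eq:
  assumes s: "s \<in> I0 c T \<Omega>"
    and sep: "separated c T K p s" "separated c T K' p' s"
    and card: "card (active c T K p q s) \<le> N" "card (active c T K' p' q' s) \<le> N"
    and eq: "\<And>n. n < 2 * N \<Longrightarrow> RG_value c T \<Omega> \<phi> test_f n s = RG_value c T \<Omega> \<phi>' test_f n s"
  shows "card (active c T K p q s) = card (active c T K' p' q' s)"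
proof -
  have "(\<Sum>k\<in>X.act s. X.a0 k s * X.w0 k s ^ n) = (\<Sum>k\<in>Y.act s. Y.a0 k s * Y.w0 k s ^ n)"
    if "n < card (X.act s) + card (Y.act s)" for n
    using eq[of n] that card unfolding X.RG_f_active[OF s] Y.RG_f_active[OF s] by simp
  from prony_unique[OF X.finite_active Y.finite_active X.inj_on_w0[OF sep(1)] Y.inj_on_w0[OF sep(2)]
      X.a0_active[OF s] Y.a0_active[OF s] this]
  obtain \<sigma> where "bij_betw \<sigma> (X.act s) (Y.act s)" by blast
  then show ?thesis by (rule bij_betw_same_card)
qed

lemma same_active_sources_pointwise:
  assumes s: "s \<in> I0 c T \<Omega>"
    and sep: "separated c T K p s" "separated c T K' p' s"
    and card: "card (active c T K p q s) = m" "card (active c T K' p' q' s) = m"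
    and silent: "inactive_silent c T K p q s" "inactive_silent c T K' p' q' s"
    and agree: "listed_values_agree c T \<Omega> \<phi> \<phi>' m s"
  shows "same_active_sources c T K p q K' p' q' s"
proof -
  have eqs: "\<And>n. n < 2 * m \<Longrightarrow> RG_value c T \<Omega> \<phi> test_f n s = RG_value c T \<Omega> \<phi>' test_f n s"
    "\<And>n. n < 2 * m \<Longrightarrow> RG_value c T \<Omega> \<phi> test_g n s = RG_value c T \<Omega> \<phi>' test_g n s"
    "\<And>n. n < 2 * m \<Longrightarrow> RG_value c T \<Omega> \<phi> test_i n s = RG_value c T \<Omega> \<phi>' test_i n s"
    "\<And>n. n < m \<Longrightarrow> RG_value c T \<Omega> \<phi> test_h (Suc n) s = RG_value c T \<Omega> \<phi>' test_h (Suc n) s"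
    "\<And>n. n < m \<Longrightarrow> RG_value c T \<Omega> \<phi> test_j (Suc n) s = RG_value c T \<Omega> \<phi>' test_j (Suc n) s"
    using agree by (auto simp: listed_values_agree_def)
  note eqs' = eqs(1)[unfolded X.RG_f_active[OF s] Y.RG_f_active[OF s]]
    eqs(2-5)[unfolded X.RG_values_active[OF s silent(1)] Y.RG_values_active[OF s silent(2)]]
  obtain \<sigma> where \<sigma>: "bij_betw \<sigma> (X.act s) (Y.act s)"
    and jets: "\<And>k. k \<in> X.act s \<Longrightarrow> Y.w0 (\<sigma> k) s = X.w0 k s \<and> Y.a0 (\<sigma> k) s = X.a0 k s \<and>
      Y.z0 (\<sigma> k) s = X.z0 k s \<and> Y.z1 (\<sigma> k) s = X.z1 k s"
    by (rule sources_from_moments[where m = m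
          and A = "X.act s" and a = "\<lambda>k. X.a0 k s" and da = "\<lambda>k. X.a1 k s" and dda = "\<lambda>k. X.a2 k s"
          and w = "\<lambda>k. X.w0 k s" and dw = "\<lambda>k. X.w1 k s" and ddw = "\<lambda>k. X.w2 k s"
          and z = "\<lambda>k. X.z0 k s" and dz = "\<lambda>k. X.z1 k s"
          and A' = "Y.act s" and a' = "\<lambda>k. Y.a0 k s" and da' = "\<lambda>k. Y.a1 k s" and dda' = "\<lambda>k. Y.a2 k s"
          and w' = "\<lambda>k. Y.w0 k s" and dw' = "\<lambda>k. Y.w1 k s" and ddw' = "\<lambda>k. Y.w2 k s"
          and z' = "\<lambda>k. Y.z0 k s" and dz' = "\<lambda>k. Y.z1 k s"
          and \<Phi> = second_order_rest
          and \<Psi> = "\<lambda>n a da w dw. of_real (1 / c) * twisted_jet1 (Suc n) a da w dw"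
          and \<Theta> = "\<lambda>n z a da dda w dw ddw.
            of_nat (2 * Suc n) * (z * (da * w ^ n + a * power_jet1 n w dw))
            + of_real (1 / c) * twisted_jet2 (Suc n) a da dda w dw ddw"])
       (rule that X.finite_active Y.finite_active card X.inj_on_w0[OF sep(1)] Y.inj_on_w0[OF sep(2)]
          X.a0_active[OF s] Y.a0_active[OF s] eqs' | assumption)+
  have "p_at c T p' s (\<sigma> k) = p_at c T p s k \<and> q_at c T p' q' s (\<sigma> k) = q_at c T p q s k"
    if k: "k \<in> X.act s" for k
  proof
    have kX: "k \<in> {1..K}" and kY: "\<sigma> k \<in> {1..K'}"
      using subsetD[OF X.active_subset k] subsetD[OF Y.active_subset bij_betw_apply[OF \<sigma> k]] .
    note j = jets[OF k]
    show "p_at c T p' s (\<sigma> k) = p_at c T p s k"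
      using j by (auto simp: vec_eq_iff forall_3 p_at_def p_xy_def)
    have "of_real (q_at c T p' q' s (\<sigma> k)) * (1 - X.z1 k s / of_real c)
        = complex_of_real (q_at c T p q s k) * (1 - X.z1 k s / of_real c)"
      using X.doppler_of_height(1)[OF s kX] Y.doppler_of_height(1)[OF s kY] j by auto
    then show "q_at c T p' q' s (\<sigma> k) = q_at c T p q s k"
      using X.doppler_of_height(2)[OF s kX] by auto
  qed
  then show ?thesis using \<sigma> unfolding same_active_sources_def by blast
qed

lemma common_silent_time:
  assumes ab: "a < b" "{a<..<b} \<subseteq> I0 c T \<Omega>"
  obtains s where "s \<in> {a<..<b}" "inactive_silent c T K p q s" "inactive_silent c T K' p' q' s"
proof -
  obtain a1 b1 where 1: "a \<le> a1" "a1 < b1" "b1 \<le> b"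
    "\<And>s. s \<in> {a1<..<b1} \<Longrightarrow> inactive_silent c T K p q s"
    using X.silent_window[OF ab] by blast
  have "{a1<..<b1} \<subseteq> I0 c T \<Omega>" using 1 ab(2) by fastforce
  then obtain a2 b2 where 2: "a1 \<le> a2" "a2 < b2" "b2 \<le> b1"
    "\<And>s. s \<in> {a2<..<b2} \<Longrightarrow> inactive_silent c T K' p' q' s"
    using Y.silent_window[OF 1(2)] by blast
  have "(a2 + b2) / 2 \<in> {a2<..<b2}" using 2(2) by simp
  then show thesis using 1 2 by (intro that[of "(a2 + b2) / 2"]) auto
qed

end

context observed_sources
begin

lemma eventually_separated:
  assumes \<tau>: "\<tau> \<in> I0 c T \<Omega>" and sep: "separated c T K p \<tau>"
  shows "\<forall>\<^sub>F s in at \<tau> within I0 c T \<Omega>. separated c T K p s"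
proof -
  have "\<forall>\<^sub>F s in at \<tau> within I0 c T \<Omega>. j \<noteq> k \<longrightarrow> p_xy (p_at c T p s j) \<noteq> p_xy (p_at c T p s k)"
    if jk: "j \<in> {1..K}" "k \<in> {1..K}" for j k
  proof (cases "j = k")
    case False
    have "((\<lambda>s. p_xy (p_at c T p s i)) \<longlongrightarrow> p_xy (p_at c T p \<tau> i)) (at \<tau> within I0 c T \<Omega>)" if "i \<in> {1..K}" for i
      using continuous_on_p_at[OF that] \<tau> unfolding continuous_on_def
      by (intro bounded_linear.tendsto[OF bounded_linear_p_xy]) auto
    from tendsto_diff[OF this[OF jk(1)] this[OF jk(2)]]
    have "\<forall>\<^sub>F s in at \<tau> within I0 c T \<Omega>. p_xy (p_at c T p s j) - p_xy (p_at c T p s k) \<noteq> 0"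
      by (rule tendsto_imp_eventually_ne) (use sep jk False in \<open>auto simp: separated_def\<close>)
    then show ?thesis by eventually_elim simp
  qed simp
  then show ?thesis
    unfolding separated_def by (intro eventually_ball_finite ballI) auto
qed

end

context two_observations
begin

text \<open>
  If no source of the second configuration had the position and magnitude of the \<open>k\<close>-th source at
  \<open>\<tau>\<close>, then by continuity the same would hold at all times near \<open>\<tau>\<close>, because there are only
  finitely many candidates. But among those times there is one at which both configurations are
  silent, and there the active sources of both coincide.
\<close>

lemma partner_from_nearby_times:
  assumes \<tau>: "\<tau> \<in> I0 c T \<Omega>" and sep: "separated c T K p \<tau>" "separated c T K' p' \<tau>"
    and e: "0 < e" and agree: "\<And>s. s \<in> I0 c T \<Omega> \<Longrightarrow> \<bar>s - \<tau>\<bar> < e \<Longrightarrow>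
      \<exists>m. card (active c T K p q s) = m \<and> card (active c T K' p' q' s) = m \<and>
        listed_values_agree c T \<Omega> \<phi> \<phi>' m s"
    and k: "k \<in> active c T K p q \<tau>"
  shows "\<exists>k'\<in>{1..K'}. p_at c T p' \<tau> k' = p_at c T p \<tau> k \<and> q_at c T p' q' \<tau> k' = q_at c T p q \<tau> k"
proof (rule ccontr)
  assume none: "\<not> ?thesis"
  let ?F = "at \<tau> within I0 c T \<Omega>"
  have kX: "k \<in> {1..K}" using k X.active_subset by blast
  have pX: "((\<lambda>s. (p_at c T p s k, q_at c T p q s k)) \<longlongrightarrow> (p_at c T p \<tau> k, q_at c T p q \<tau> k)) ?F"
    using X.continuous_on_p_at[OF kX] X.continuous_on_q_at[OF kX] \<tau>
    unfolding continuous_on_def by (intro tendsto_Pair) auto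
  have "\<forall>\<^sub>F s in ?F. (p_at c T p' s k', q_at c T p' q' s k') \<noteq> (p_at c T p s k, q_at c T p q s k)"
    if k': "k' \<in> {1..K'}" for k'
  proof -
    have "((\<lambda>s. (p_at c T p' s k', q_at c T p' q' s k')) \<longlongrightarrow> (p_at c T p' \<tau> k', q_at c T p' q' \<tau> k')) ?F"
      using Y.continuous_on_p_at[OF k'] Y.continuous_on_q_at[OF k'] \<tau>
      unfolding continuous_on_def by (intro tendsto_Pair) auto
    from tendsto_diff[OF this pX]
    have "\<forall>\<^sub>F s in ?F. (p_at c T p' s k', q_at c T p' q' s k') - (p_at c T p s k, q_at c T p q s k) \<noteq> 0"
      by (rule tendsto_imp_eventually_ne) (use none k' in \<open>auto simp: zero_prod_def\<close>)
    then show ?thesis by eventually_elim (auto simp: zero_prod_def)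
  qed
  then have unmatched: "\<forall>\<^sub>F s in ?F. \<forall>k'\<in>{1..K'}.
      (p_at c T p' s k', q_at c T p' q' s k') \<noteq> (p_at c T p s k, q_at c T p q s k)"
    by (intro eventually_ball_finite) auto
  have "\<forall>\<^sub>F s in ?F. q_at c T p q s k \<noteq> 0"
    using X.continuous_on_q_at[OF kX] \<tau> k unfolding continuous_on_def
    by (intro tendsto_imp_eventually_ne[of _ "q_at c T p q \<tau> k"]) (auto simp: active_def)
  then have active: "\<forall>\<^sub>F s in ?F. k \<in> active c T K p q s"
    by eventually_elim (use kX in \<open>simp add: active_def\<close>)
  have near: "\<forall>\<^sub>F s in ?F. \<bar>s - \<tau>\<bar> < e"
    using e unfolding eventually_at by (auto simp: dist_real_def)
  have "\<forall>\<^sub>F s in ?F. (\<forall>k'\<in>{1..K'}. (p_at c T p' s k', q_at c T p' q' s k') \<noteq> (p_at c T p s k, q_at c T p q s k))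
      \<and> k \<in> active c T K p q s \<and> \<bar>s - \<tau>\<bar> < e \<and> separated c T K p s \<and> separated c T K' p' s"
    using unmatched active near X.eventually_separated[OF \<tau> sep(1)] Y.eventually_separated[OF \<tau> sep(2)]
    by eventually_elim blast
  then obtain d where "0 < d" and d: "\<And>s. s \<in> I0 c T \<Omega> \<Longrightarrow> s \<noteq> \<tau> \<Longrightarrow> dist s \<tau> < d \<Longrightarrow>
      (\<forall>k'\<in>{1..K'}. (p_at c T p' s k', q_at c T p' q' s k') \<noteq> (p_at c T p s k, q_at c T p q s k))
      \<and> k \<in> active c T K p q s \<and> \<bar>s - \<tau>\<bar> < e \<and> separated c T K p s \<and> separated c T K' p' s"
    unfolding eventually_at by blast
  \<comment> \<open>The set is open and, as \<open>\<tau>\<close> is a limit point of the interior of \<open>I0\<close>, nonempty. It may lie on one side of \<open>\<tau>\<close> only.\<close>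
  let ?U = "interior (I0 c T \<Omega>) \<inter> ball \<tau> d - {\<tau>}"
  have "open ?U" by (intro open_Diff open_Int) auto
  moreover obtain y where "y \<in> ?U"
    using X.I0_islimpt[OF \<tau>] \<open>0 < d\<close> unfolding islimpt_approachable by (auto simp: dist_commute)
  ultimately obtain r where r: "0 < r" "ball y r \<subseteq> ?U" unfolding open_contains_ball by blast
  have ball: "{y - r<..<y + r} = ball y r" by (simp add: ball_eq_greaterThanLessThan)
  obtain s where s: "s \<in> {y - r<..<y + r}"
    and silent: "inactive_silent c T K p q s" "inactive_silent c T K' p' q' s"
    using common_silent_time[of "y - r" "y + r"] r interior_subset[of "I0 c T \<Omega>"] unfolding ball by auto
  then have sU: "s \<in> ?U" using r ball by blast
  then have sI: "s \<in> I0 c T \<Omega>" using interior_subset by blast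
  have P: "\<forall>k'\<in>{1..K'}. (p_at c T p' s k', q_at c T p' q' s k') \<noteq> (p_at c T p s k, q_at c T p q s k)"
    "k \<in> active c T K p q s" "\<bar>s - \<tau>\<bar> < e" "separated c T K p s" "separated c T K' p' s"
    using d[OF sI] sU by (auto simp: dist_commute)
  obtain m where "card (active c T K p q s) = m" "card (active c T K' p' q' s) = m"
    "listed_values_agree c T \<Omega> \<phi> \<phi>' m s" using agree[OF sI P(3)] by blast
  then have "same_active_sources c T K p q K' p' q' s"
    using same_active_sources_pointwise[OF sI P(4,5) _ _ silent] by blast
  then obtain k' where "k' \<in> active c T K' p' q' s"
    "p_at c T p' s k' = p_at c T p s k" "q_at c T p' q' s k' = q_at c T p q s k"
    using P(2) unfolding same_active_sources_def by (meson bij_betwE)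
  then show False using P(1) Y.active_subset by auto
qed

text \<open>
  The partners are distinct because the sources are separated, and the numbers of active sources
  agree at \<open>\<tau>\<close>, so the assignment of partners is a bijection.
\<close>

lemma same_active_sources_from_nearby_times:
  assumes \<tau>: "\<tau> \<in> I0 c T \<Omega>" and sep: "separated c T K p \<tau>" "separated c T K' p' \<tau>"
    and e: "0 < e" and agree: "\<And>s. s \<in> I0 c T \<Omega> \<Longrightarrow> \<bar>s - \<tau>\<bar> < e \<Longrightarrow>
      \<exists>m. card (active c T K p q s) = m \<and> card (active c T K' p' q' s) = m \<and>
        listed_values_agree c T \<Omega> \<phi> \<phi>' m s"
  shows "same_active_sources c T K p q K' p' q' \<tau>"
proof -
  have "\<forall>k\<in>X.act \<tau>. \<exists>k'. k' \<in> {1..K'} \<and>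
      p_at c T p' \<tau> k' = p_at c T p \<tau> k \<and> q_at c T p' q' \<tau> k' = q_at c T p q \<tau> k"
    using partner_from_nearby_times[OF \<tau> sep e agree] by (simp add: Bex_def)
  from bchoice[OF this]
  obtain \<sigma> where \<sigma>: "\<And>k. k \<in> X.act \<tau> \<Longrightarrow> \<sigma> k \<in> {1..K'} \<and>
      p_at c T p' \<tau> (\<sigma> k) = p_at c T p \<tau> k \<and> q_at c T p' q' \<tau> (\<sigma> k) = q_at c T p q \<tau> k"
    by blast
  have "\<sigma> ` X.act \<tau> \<subseteq> Y.act \<tau>" using \<sigma> by (auto simp: active_def)
  moreover have inj: "inj_on \<sigma> (X.act \<tau>)"
  proof (rule inj_onI)
    fix j k assume jk: "j \<in> X.act \<tau>" "k \<in> X.act \<tau>" "\<sigma> j = \<sigma> k"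
    then have "p_at c T p \<tau> j = p_at c T p \<tau> k" using \<sigma>[OF jk(1)] \<sigma>[OF jk(2)] by simp
    then have "X.w0 j \<tau> = X.w0 k \<tau>" by (simp add: p_at_def)
    then show "j = k" by (rule inj_onD[OF X.inj_on_w0[OF sep(1)] _ jk(1,2)])
  qed
  moreover have "card (X.act \<tau>) = card (Y.act \<tau>)" using agree[OF \<tau>] e by auto
  ultimately have "\<sigma> ` X.act \<tau> = Y.act \<tau>"
    by (intro card_subset_eq Y.finite_active) (auto simp: card_image)
  with inj \<sigma> show ?thesis unfolding same_active_sources_def bij_betw_def by blast
qed

end

theorem theorem3p1:
  fixes \<Omega> D :: "(real^3) set" and c T \<tau> :: real and K_M K K' :: nat
    and p p' :: "nat \<Rightarrow> real \<Rightarrow> real^3" and q q' :: "nat \<Rightarrow> real \<Rightarrow> real"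
    and u u' :: "real \<Rightarrow> (real^3 \<Rightarrow> complex) \<Rightarrow> complex"
    and \<phi> \<phi>' :: "spacetime \<Rightarrow> complex"
  assumes "open \<Omega>" "connected \<Omega>" "\<Omega> \<noteq> {}" "simply_connected \<Omega>" "bounded \<Omega>" "smooth_boundary \<Omega>"
    and "compact D" "D \<subseteq> \<Omega>"
    and "c > 0" "T > 2 * diameter \<Omega> / c"
    and "source_config c T D K p q" "source_config c T D K' p' q'"
    and "wave_field c T \<Omega> D (source_functional T K p q) u \<phi>"
    and "wave_field c T \<Omega> D (source_functional T K' p' q') u' \<phi>'"
    and "interior (I0 c T \<Omega>) \<noteq> {}" "\<tau> \<in> I0 c T \<Omega>"
    and "card (active c T K p q \<tau>) \<le> K_M" "card (active c T K' p' q' \<tau>) \<le> K_M"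
    and "separated c T K p \<tau>" "separated c T K' p' \<tau>"
  shows
    "((\<forall>n\<in>{0..2 * K_M}. RG_value c T \<Omega> \<phi> test_f n \<tau> = RG_value c T \<Omega> \<phi>' test_f n \<tau>) \<longrightarrow>
        card (active c T K p q \<tau>) = card (active c T K' p' q' \<tau>))
     \<and>
     (\<forall>m. card (active c T K p q \<tau>) = m \<and> card (active c T K' p' q' \<tau>) = m \<and>
        inactive_silent c T K p q \<tau> \<and> inactive_silent c T K' p' q' \<tau> \<and>
        listed_values_agree c T \<Omega> \<phi> \<phi>' m \<tau> \<longrightarrow>
        same_active_sources c T K p q K' p' q' \<tau>)
     \<and>
     ((\<exists>e>0. \<forall>s\<in>I0 c T \<Omega>. \<bar>s - \<tau>\<bar> < e \<longrightarrow>
         (\<exists>m. card (active c T K p q s) = m \<and> card (active c T K' p' q' s) = m \<and>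
            listed_values_agree c T \<Omega> \<phi> \<phi>' m s)) \<longrightarrow>
        same_active_sources c T K p q K' p' q' \<tau>)"
proof -
  have "0 \<le> 2 * diameter \<Omega> / c"
    using assms(5,9) by (simp add: diameter_ge_0)
  then have T: "0 < T" using assms(10) by linarith
  interpret two_observations c T \<Omega> D K p q u \<phi> K' p' q' u' \<phi>'
    using assms T by unfold_locales
  show ?thesis
  proof (intro conjI impI allI)
    assume "\<forall>n\<in>{0..2 * K_M}. RG_value c T \<Omega> \<phi> test_f n \<tau> = RG_value c T \<Omega> \<phi>' test_f n \<tau>"
    then show "card (active c T K p q \<tau>) = card (active c T K' p' q' \<tau>)"
      using assms(16-20) by (intro card_active_eq[where N = K_M]) auto
  next
    fix m assume "card (active c T K p q \<tau>) = m \<and> card (active c T K' p' q' \<tau>) = m \<and>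
        inactive_silent c T K p q \<tau> \<and> inactive_silent c T K' p' q' \<tau> \<and>
        listed_values_agree c T \<Omega> \<phi> \<phi>' m \<tau>"
    then show "same_active_sources c T K p q K' p' q' \<tau>"
      using assms(16,19,20) same_active_sources_pointwise by blast
  next
    assume "\<exists>e>0. \<forall>s\<in>I0 c T \<Omega>. \<bar>s - \<tau>\<bar> < e \<longrightarrow>
         (\<exists>m. card (active c T K p q s) = m \<and> card (active c T K' p' q' s) = m \<and>
            listed_values_agree c T \<Omega> \<phi> \<phi>' m s)"
    then show "same_active_sources c T K p q K' p' q' \<tau>"
      using assms(16,19,20) same_active_sources_from_nearby_times by blast
  qed
qed

end
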